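(* Let $G=(A,\Phi)$ be a compact quantum group. Then the group $\operatorname{Out}_\chi(G)=\operatorname{Aut}(G)/\operatorname{Aut}_\chi(G)$, with the quotient topology, is totally disconnected.
   Context: A compact quantum group $G=(A,\Phi)$ is a unital $C^*$-algebra $A$ with a coassociative unital $*$-homomorphism $\Phi:A\to A\otimes A$ (minimal tensor product) such that $(A\otimes 1)\Phi(A)$ and $(1\otimes A)\Phi(A)$ have dense linear span in $A\otimes A$. A finite-dimensional representation is a unitary $u=((u_{ij}))\in M_n(A)$ with $\Phi(u_{ij})=\sum_k u_{ik}\otimes u_{kj}$; its character is $\chi_u=\sum_i u_{ii}$. An automorphism of $G$ is a $C^*$-algebra automorphism $\alpha:A\to A$ with $(\alpha\otimes\alpha)\Phi=\Phi\circ\alpha$; the group of these is $\operatorname{Aut}(G)$. $\operatorname{Aut}_\chi(G)$ is the (closed normal) subgroup of all $\alpha\in\operatorname{Aut}(G)$ such that $\alpha(\chi_v)=\chi_v$ for every irreducible representation $v$ of $G$. $\operatorname{Aut}(G)$ is topologised by taking as basic neighbourhoods of the identity the sets $\{\alpha\in\operatorname{Aut}(G): \|a_i-\alpha(a_i)\|<\varepsilon,\ i=1,\dots,n\}$ with $a_1,\dots,a_n\in A$, $\varepsilon>0$. *)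

theory Defs
  imports
    "HOL-Analysis.Analysis"
    "HOL-Algebra.Coset"
    "Jordan_Normal_Form.Matrix"
begin

section \<open>Unital C*-algebras\<close>

class scaleC =
  fixes scaleC :: "complex \<Rightarrow> 'a \<Rightarrow> 'a" (infixr "*\<^sub>C" 75)

class star =
  fixes star :: "'a \<Rightarrow> 'a"

class cstar_algebra = real_normed_algebra_1 + banach + scaleC + star +
  assumes scaleC_add_right: "c *\<^sub>C (x + y) = c *\<^sub>C x + c *\<^sub>C y"
    and scaleC_add_left: "(c + d) *\<^sub>C x = c *\<^sub>C x + d *\<^sub>C x"
    and scaleC_scaleC: "c *\<^sub>C d *\<^sub>C x = (c * d) *\<^sub>C x"
    and scaleR_scaleC: "r *\<^sub>R x = complex_of_real r *\<^sub>C x"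
    and mult_scaleC_left: "(c *\<^sub>C x) * y = c *\<^sub>C (x * y)"
    and mult_scaleC_right: "x * (c *\<^sub>C y) = c *\<^sub>C (x * y)"
    and norm_scaleC: "norm (c *\<^sub>C x) = cmod c * norm x"
    and star_add: "star (x + y) = star x + star y"
    and star_scaleC: "star (c *\<^sub>C x) = cnj c *\<^sub>C star x"
    and star_mult: "star (x * y) = star y * star x"
    and star_star: "star (star x) = x"
    and norm_star_mult_self: "norm (star x * x) = (norm x)\<^sup>2"

instantiation complex :: cstar_algebra
begin

definition scaleC_complex :: "complex \<Rightarrow> complex \<Rightarrow> complex"
  where "scaleC_complex c x = c * x"

definition star_complex :: "complex \<Rightarrow> complex"
  where "star_complex = cnj"

instance
  by standard
    (auto simp: scaleC_complex_def star_complex_def algebra_simps scaleR_conv_of_real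
      norm_mult power2_eq_square)

end

definition star_hom :: "('a::cstar_algebra \<Rightarrow> 'b::cstar_algebra) \<Rightarrow> bool" where
  "star_hom f \<longleftrightarrow>
     (\<forall>x y. f (x + y) = f x + f y) \<and>
     (\<forall>c x. f (c *\<^sub>C x) = c *\<^sub>C f x) \<and>
     (\<forall>x y. f (x * y) = f x * f y) \<and>
     (\<forall>x. f (star x) = star (f x)) \<and>
     f 1 = 1"


section \<open>Representations on \<open>\<ell>\<^sup>2\<close> spaces\<close>

text \<open>The Hilbert space \<open>\<ell>\<^sup>2('i)\<close> is a set of functions; operators on it are functions whose
  values outside that set are irrelevant. The inner product is linear in the second argument.\<close>

definition ell2 :: "('i \<Rightarrow> complex) set" where
  "ell2 = {f. (\<lambda>i. (cmod (f i))\<^sup>2) summable_on UNIV}"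

definition ell2_inner :: "('i \<Rightarrow> complex) \<Rightarrow> ('i \<Rightarrow> complex) \<Rightarrow> complex" where
  "ell2_inner f g = (\<Sum>\<^sub>\<infinity>i. cnj (f i) * g i)"

definition ell2_norm :: "('i \<Rightarrow> complex) \<Rightarrow> real" where
  "ell2_norm f = sqrt (\<Sum>\<^sub>\<infinity>i. (cmod (f i))\<^sup>2)"

definition ell2_bounded_operator :: "(('i \<Rightarrow> complex) \<Rightarrow> ('i \<Rightarrow> complex)) \<Rightarrow> bool" where
  "ell2_bounded_operator T \<longleftrightarrow>
     (\<forall>f\<in>ell2. T f \<in> ell2) \<and>
     (\<forall>f\<in>ell2. \<forall>g\<in>ell2. T (\<lambda>i. f i + g i) = (\<lambda>i. T f i + T g i)) \<and>
     (\<forall>c. \<forall>f\<in>ell2. T (\<lambda>i. c * f i) = (\<lambda>i. c * T f i)) \<and>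
     (\<exists>K. \<forall>f\<in>ell2. ell2_norm (T f) \<le> K * ell2_norm f)"

definition ell2_onorm :: "(('i \<Rightarrow> complex) \<Rightarrow> ('i \<Rightarrow> complex)) \<Rightarrow> real" where
  "ell2_onorm T = (SUP f\<in>{f\<in>ell2. ell2_norm f \<le> 1}. ell2_norm (T f))"

text \<open>Faithful unital *-representations on \<open>\<ell>\<^sup>2('i)\<close>. Faithful representations of a C*-algebra
  are isometric, and it is as an isometry that faithfulness is recorded here.\<close>

definition faithful_rep :: "('a::cstar_algebra \<Rightarrow> ('i \<Rightarrow> complex) \<Rightarrow> ('i \<Rightarrow> complex)) \<Rightarrow> bool" where
  "faithful_rep \<pi> \<longleftrightarrow>
     (\<forall>a. ell2_bounded_operator (\<pi> a)) \<and>
     (\<forall>a b. \<forall>f\<in>ell2. \<pi> (a + b) f = (\<lambda>i. \<pi> a f i + \<pi> b f i)) \<and>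
     (\<forall>c a. \<forall>f\<in>ell2. \<pi> (c *\<^sub>C a) f = (\<lambda>i. c * \<pi> a f i)) \<and>
     (\<forall>a b. \<forall>f\<in>ell2. \<pi> (a * b) f = \<pi> a (\<pi> b f)) \<and>
     (\<forall>f\<in>ell2. \<pi> 1 f = f) \<and>
     (\<forall>a. \<forall>f\<in>ell2. \<forall>g\<in>ell2. ell2_inner (\<pi> (star a) f) g = ell2_inner f (\<pi> a g)) \<and>
     (\<forall>a. ell2_onorm (\<pi> a) = norm a)"


section \<open>The minimal tensor product\<close>

definition ell2_tensor :: "('i \<Rightarrow> complex) \<Rightarrow> ('j \<Rightarrow> complex) \<Rightarrow> ('i \<times> 'j \<Rightarrow> complex)" where
  "ell2_tensor f g = (\<lambda>(i, j). f i * g j)"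

text \<open>\<open>min_tensor t\<close>: the C*-algebra \<open>'c\<close> together with \<open>t a b = a \<otimes> b\<close> is the minimal (spatial)
  tensor product of \<open>'a\<close> and \<open>'b\<close>. That is, for faithful representations \<open>\<pi>\<^sub>1\<close>, \<open>\<pi>\<^sub>2\<close> of \<open>'a\<close>, \<open>'b\<close>
  on Hilbert spaces \<open>H\<close>, \<open>K\<close>, it is (via \<open>\<rho>\<close>) the norm-closed span of the operators
  \<open>\<pi>\<^sub>1 a \<otimes> \<pi>\<^sub>2 b\<close> in \<open>B(H \<otimes> K)\<close>, with the operator norm; bilinearity and multiplicativity of \<open>t\<close>
  follow. The result does not depend on the choice of \<open>\<pi>\<^sub>1\<close>, \<open>\<pi>\<^sub>2\<close>. The index types cost no
  generality: every unital C*-algebra \<open>'a\<close> has a faithful unital representation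
  on \<open>\<ell>\<^sup>2('a)\<close>, since cyclic representations have dimension at most the cardinality of \<open>'a\<close>.
  The range of \<open>t\<close> is closed under complex scaling, so its real span is its complex span.\<close>

definition min_tensor :: "('a::cstar_algebra \<Rightarrow> 'b::cstar_algebra \<Rightarrow> 'c::cstar_algebra) \<Rightarrow> bool" where
  "min_tensor t \<longleftrightarrow>
     closure (span {t a b | a b. True}) = UNIV \<and>
     (\<exists>(\<pi>\<^sub>1 :: 'a \<Rightarrow> ('a \<Rightarrow> complex) \<Rightarrow> ('a \<Rightarrow> complex))
       (\<pi>\<^sub>2 :: 'b \<Rightarrow> ('b \<Rightarrow> complex) \<Rightarrow> ('b \<Rightarrow> complex))
       (\<rho> :: 'c \<Rightarrow> ('a \<times> 'b \<Rightarrow> complex) \<Rightarrow> ('a \<times> 'b \<Rightarrow> complex)).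
        faithful_rep \<pi>\<^sub>1 \<and> faithful_rep \<pi>\<^sub>2 \<and> faithful_rep \<rho> \<and>
        (\<forall>a b. \<forall>f\<in>ell2. \<forall>g\<in>ell2. \<rho> (t a b) (ell2_tensor f g) = ell2_tensor (\<pi>\<^sub>1 a f) (\<pi>\<^sub>2 b g)))"

text \<open>\<open>F = f \<otimes> g\<close>, as a *-homomorphism between minimal tensor products. Such an \<open>F\<close> is unique
  because *-homomorphisms are continuous, and it exists for all *-homomorphisms \<open>f\<close>, \<open>g\<close>.\<close>

definition is_tensor_hom ::
  "('a::cstar_algebra \<Rightarrow> 'b::cstar_algebra \<Rightarrow> 'c::cstar_algebra) \<Rightarrow>
   ('d::cstar_algebra \<Rightarrow> 'e::cstar_algebra \<Rightarrow> 'f::cstar_algebra) \<Rightarrow>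
   ('a \<Rightarrow> 'd) \<Rightarrow> ('b \<Rightarrow> 'e) \<Rightarrow> ('c \<Rightarrow> 'f) \<Rightarrow> bool" where
  "is_tensor_hom t t' f g F \<longleftrightarrow> star_hom F \<and> (\<forall>a b. F (t a b) = t' (f a) (g b))"


section \<open>Compact quantum groups\<close>

text \<open>\<open>'a\<close> is the algebra \<open>A\<close>, \<open>'b\<close> is \<open>A \<otimes> A\<close> via \<open>t\<close>, and \<open>'c\<close> is the triple tensor product,
  both as \<open>(A \<otimes> A) \<otimes> A\<close> via \<open>tl\<close> and as \<open>A \<otimes> (A \<otimes> A)\<close> via \<open>tr\<close>, identified by \<open>assoc\<close>.
  The sets in the density conditions are closed under complex scaling.\<close>

locale compact_quantum_group =
  fixes t :: "'a::cstar_algebra \<Rightarrow> 'a \<Rightarrow> 'b::cstar_algebra"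
    and tl :: "'b \<Rightarrow> 'a \<Rightarrow> 'c::cstar_algebra"
    and tr :: "'a \<Rightarrow> 'b \<Rightarrow> 'c"
    and \<Phi> :: "'a \<Rightarrow> 'b"
  assumes tensor: "min_tensor t"
    and tensor_left: "min_tensor tl"
    and tensor_right: "min_tensor tr"
    and assoc: "\<And>a b c. tl (t a b) c = tr a (t b c)"
    and star_hom_comult: "star_hom \<Phi>"
    and coassociative: "\<exists>F\<^sub>1 F\<^sub>2. is_tensor_hom t tl \<Phi> id F\<^sub>1 \<and> is_tensor_hom t tr id \<Phi> F\<^sub>2 \<and>
      F\<^sub>1 \<circ> \<Phi> = F\<^sub>2 \<circ> \<Phi>"
    and dense_left: "closure (span {t a 1 * \<Phi> b | a b. True}) = UNIV"
    and dense_right: "closure (span {t 1 a * \<Phi> b | a b. True}) = UNIV"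

definition mat_star :: "'a::star mat \<Rightarrow> 'a mat" where
  "mat_star u = map_mat star (transpose_mat u)"

definition scalar_mat :: "complex mat \<Rightarrow> 'a::cstar_algebra mat" where
  "scalar_mat = map_mat (\<lambda>c. c *\<^sub>C 1)"

definition fd_rep ::
  "('a::cstar_algebra \<Rightarrow> 'a \<Rightarrow> 'b::cstar_algebra) \<Rightarrow> ('a \<Rightarrow> 'b) \<Rightarrow> nat \<Rightarrow> 'a mat \<Rightarrow> bool" where
  "fd_rep t \<Phi> n u \<longleftrightarrow>
     u \<in> carrier_mat n n \<and>
     mat_star u * u = 1\<^sub>m n \<and> u * mat_star u = 1\<^sub>m n \<and>
     (\<forall>i<n. \<forall>j<n. \<Phi> (u $$ (i, j)) = (\<Sum>k<n. t (u $$ (i, k)) (u $$ (k, j))))"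

text \<open>\<open>u\<close> is irreducible if the only invariant subspaces of \<open>\<complex>\<^sup>n\<close> are \<open>0\<close> and \<open>\<complex>\<^sup>n\<close>; a subspace,
  given by its orthogonal projection \<open>e\<close>, is invariant if \<open>(e \<otimes> 1) u (e \<otimes> 1) = u (e \<otimes> 1)\<close>.\<close>

definition irreducible_rep ::
  "('a::cstar_algebra \<Rightarrow> 'a \<Rightarrow> 'b::cstar_algebra) \<Rightarrow> ('a \<Rightarrow> 'b) \<Rightarrow> nat \<Rightarrow> 'a mat \<Rightarrow> bool" where
  "irreducible_rep t \<Phi> n u \<longleftrightarrow>
     fd_rep t \<Phi> n u \<and> n > 0 \<and>
     (\<forall>e \<in> carrier_mat n n. e * e = e \<and> mat_star e = e \<and>
        scalar_mat e * u * scalar_mat e = u * scalar_mat e \<longrightarrow> e = 0\<^sub>m n n \<or> e = 1\<^sub>m n)"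

definition rep_char :: "nat \<Rightarrow> 'a::cstar_algebra mat \<Rightarrow> 'a" where
  "rep_char n u = (\<Sum>i<n. u $$ (i, i))"


section \<open>Automorphism groups\<close>

definition Aut ::
  "('a::cstar_algebra \<Rightarrow> 'a \<Rightarrow> 'b::cstar_algebra) \<Rightarrow> ('a \<Rightarrow> 'b) \<Rightarrow> ('a \<Rightarrow> 'a) set" where
  "Aut t \<Phi> = {\<alpha>. bij \<alpha> \<and> star_hom \<alpha> \<and> (\<exists>F. is_tensor_hom t t \<alpha> \<alpha> F \<and> F \<circ> \<Phi> = \<Phi> \<circ> \<alpha>)}"

definition Aut_chi ::
  "('a::cstar_algebra \<Rightarrow> 'a \<Rightarrow> 'b::cstar_algebra) \<Rightarrow> ('a \<Rightarrow> 'b) \<Rightarrow> ('a \<Rightarrow> 'a) set" where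
  "Aut_chi t \<Phi> = {\<alpha> \<in> Aut t \<Phi>. \<forall>n v. irreducible_rep t \<Phi> n v \<longrightarrow> \<alpha> (rep_char n v) = rep_char n v}"

definition Aut_group ::
  "('a::cstar_algebra \<Rightarrow> 'a \<Rightarrow> 'b::cstar_algebra) \<Rightarrow> ('a \<Rightarrow> 'b) \<Rightarrow> ('a \<Rightarrow> 'a) monoid" where
  "Aut_group t \<Phi> = \<lparr>carrier = Aut t \<Phi>, monoid.mult = (\<circ>), one = id\<rparr>"

text \<open>The elements of \<open>Out_chi\<close> are right cosets of \<open>Aut_chi\<close>, which are also the left cosets,
  \<open>Aut_chi\<close> being normal.\<close>

definition Out_chi ::
  "('a::cstar_algebra \<Rightarrow> 'a \<Rightarrow> 'b::cstar_algebra) \<Rightarrow> ('a \<Rightarrow> 'b) \<Rightarrow> ('a \<Rightarrow> 'a) set monoid" where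
  "Out_chi t \<Phi> = Aut_group t \<Phi> Mod Aut_chi t \<Phi>"


section \<open>Topologies\<close>

definition Aut_nbhd_id ::
  "('a::cstar_algebra \<Rightarrow> 'a \<Rightarrow> 'b::cstar_algebra) \<Rightarrow> ('a \<Rightarrow> 'b) \<Rightarrow> 'a set \<Rightarrow> real \<Rightarrow> ('a \<Rightarrow> 'a) set" where
  "Aut_nbhd_id t \<Phi> S \<epsilon> = {\<alpha> \<in> Aut t \<Phi>. \<forall>a\<in>S. norm (a - \<alpha> a) < \<epsilon>}"

text \<open>Basic neighbourhoods of \<open>\<beta>\<close> are the translates by \<open>\<beta>\<close> of those of the identity.\<close>

definition Aut_topology ::
  "('a::cstar_algebra \<Rightarrow> 'a \<Rightarrow> 'b::cstar_algebra) \<Rightarrow> ('a \<Rightarrow> 'b) \<Rightarrow> ('a \<Rightarrow> 'a) topology" where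
  "Aut_topology t \<Phi> = topology (\<lambda>U. U \<subseteq> Aut t \<Phi> \<and>
     (\<forall>\<beta>\<in>U. \<exists>S \<epsilon>. finite S \<and> \<epsilon> > 0 \<and> (\<lambda>\<alpha>. \<beta> \<circ> \<alpha>) ` Aut_nbhd_id t \<Phi> S \<epsilon> \<subseteq> U))"

lemma openin_Aut_topology:
  "openin (Aut_topology t \<Phi>) U \<longleftrightarrow> U \<subseteq> Aut t \<Phi> \<and>
     (\<forall>\<beta>\<in>U. \<exists>S \<epsilon>. finite S \<and> \<epsilon> > 0 \<and> (\<lambda>\<alpha>. \<beta> \<circ> \<alpha>) ` Aut_nbhd_id t \<Phi> S \<epsilon> \<subseteq> U)"
proof -
  have "istopology (\<lambda>U. U \<subseteq> Aut t \<Phi> \<and>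
     (\<forall>\<beta>\<in>U. \<exists>S \<epsilon>. finite S \<and> \<epsilon> > 0 \<and> (\<lambda>\<alpha>. \<beta> \<circ> \<alpha>) ` Aut_nbhd_id t \<Phi> S \<epsilon> \<subseteq> U))"
    unfolding istopology_def
  proof (intro conjI allI impI ballI)
    fix U V \<beta>
    assume U: "U \<subseteq> Aut t \<Phi> \<and>
        (\<forall>\<beta>\<in>U. \<exists>S \<epsilon>. finite S \<and> \<epsilon> > 0 \<and> (\<lambda>\<alpha>. \<beta> \<circ> \<alpha>) ` Aut_nbhd_id t \<Phi> S \<epsilon> \<subseteq> U)"
      and V: "V \<subseteq> Aut t \<Phi> \<and>
        (\<forall>\<beta>\<in>V. \<exists>S \<epsilon>. finite S \<and> \<epsilon> > 0 \<and> (\<lambda>\<alpha>. \<beta> \<circ> \<alpha>) ` Aut_nbhd_id t \<Phi> S \<epsilon> \<subseteq> V)"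
      and \<beta>: "\<beta> \<in> U \<inter> V"
    obtain S \<epsilon> where S: "finite S" "\<epsilon> > 0" "(\<lambda>\<alpha>. \<beta> \<circ> \<alpha>) ` Aut_nbhd_id t \<Phi> S \<epsilon> \<subseteq> U"
      using U \<beta> by blast
    obtain T \<delta> where T: "finite T" "\<delta> > 0" "(\<lambda>\<alpha>. \<beta> \<circ> \<alpha>) ` Aut_nbhd_id t \<Phi> T \<delta> \<subseteq> V"
      using V \<beta> by blast
    have "Aut_nbhd_id t \<Phi> (S \<union> T) (min \<epsilon> \<delta>) \<subseteq> Aut_nbhd_id t \<Phi> S \<epsilon> \<inter> Aut_nbhd_id t \<Phi> T \<delta>"
      by (auto simp: Aut_nbhd_id_def)
    then have "(\<lambda>\<alpha>. \<beta> \<circ> \<alpha>) ` Aut_nbhd_id t \<Phi> (S \<union> T) (min \<epsilon> \<delta>) \<subseteq> U \<inter> V"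
      using S(3) T(3) by blast
    then show "\<exists>S \<epsilon>. finite S \<and> \<epsilon> > 0 \<and> (\<lambda>\<alpha>. \<beta> \<circ> \<alpha>) ` Aut_nbhd_id t \<Phi> S \<epsilon> \<subseteq> U \<inter> V"
      using S T by (intro exI[of _ "S \<union> T"] exI[of _ "min \<epsilon> \<delta>"]) auto
  next
    fix \<K> \<beta>
    assume *: "\<forall>K\<in>\<K>. K \<subseteq> Aut t \<Phi> \<and>
        (\<forall>\<beta>\<in>K. \<exists>S \<epsilon>. finite S \<and> \<epsilon> > 0 \<and> (\<lambda>\<alpha>. \<beta> \<circ> \<alpha>) ` Aut_nbhd_id t \<Phi> S \<epsilon> \<subseteq> K)"
      and "\<beta> \<in> \<Union>\<K>"
    then obtain K where K: "K \<in> \<K>" "\<beta> \<in> K"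
      by (elim UnionE)
    have "\<forall>\<beta>\<in>K. \<exists>S \<epsilon>. finite S \<and> \<epsilon> > 0 \<and> (\<lambda>\<alpha>. \<beta> \<circ> \<alpha>) ` Aut_nbhd_id t \<Phi> S \<epsilon> \<subseteq> K"
      using *[rule_format, OF K(1)] by (rule conjunct2)
    from bspec[OF this K(2)] obtain S \<epsilon> where S: "finite S" "\<epsilon> > 0"
        "(\<lambda>\<alpha>. \<beta> \<circ> \<alpha>) ` Aut_nbhd_id t \<Phi> S \<epsilon> \<subseteq> K"
      by (elim exE conjE)
    have "(\<lambda>\<alpha>. \<beta> \<circ> \<alpha>) ` Aut_nbhd_id t \<Phi> S \<epsilon> \<subseteq> \<Union>\<K>"
      using S(3) Union_upper[OF K(1)] by (rule subset_trans)
    with S(1,2) show "\<exists>S \<epsilon>. finite S \<and> \<epsilon> > 0 \<and> (\<lambda>\<alpha>. \<beta> \<circ> \<alpha>) ` Aut_nbhd_id t \<Phi> S \<epsilon> \<subseteq> \<Union>\<K>"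
      by (intro exI conjI)
  qed (simp_all add: Sup_least le_infI1)
  then show ?thesis
    by (simp add: Aut_topology_def topology_inverse')
qed

definition quotient_topology :: "'x topology \<Rightarrow> ('x \<Rightarrow> 'y) \<Rightarrow> 'y topology" where
  "quotient_topology X q =
     topology (\<lambda>V. V \<subseteq> q ` topspace X \<and> openin X {x \<in> topspace X. q x \<in> V})"

lemma openin_quotient_topology:
  "openin (quotient_topology X q) V \<longleftrightarrow>
     V \<subseteq> q ` topspace X \<and> openin X {x \<in> topspace X. q x \<in> V}"
proof -
  have "istopology (\<lambda>V. V \<subseteq> q ` topspace X \<and> openin X {x \<in> topspace X. q x \<in> V})"
    unfolding istopology_def
  proof (intro conjI allI impI)
    fix U V
    assume "U \<subseteq> q ` topspace X \<and> openin X {x \<in> topspace X. q x \<in> U}"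
      and "V \<subseteq> q ` topspace X \<and> openin X {x \<in> topspace X. q x \<in> V}"
    then have "openin X ({x \<in> topspace X. q x \<in> U} \<inter> {x \<in> topspace X. q x \<in> V})"
      by blast
    moreover have "{x \<in> topspace X. q x \<in> U} \<inter> {x \<in> topspace X. q x \<in> V} =
        {x \<in> topspace X. q x \<in> U \<inter> V}"
      by blast
    ultimately show "openin X {x \<in> topspace X. q x \<in> U \<inter> V}"
      by simp
  next
    fix \<K>
    assume "\<forall>K\<in>\<K>. K \<subseteq> q ` topspace X \<and> openin X {x \<in> topspace X. q x \<in> K}"
    then have "openin X (\<Union>K\<in>\<K>. {x \<in> topspace X. q x \<in> K})"
      by blast
    moreover have "(\<Union>K\<in>\<K>. {x \<in> topspace X. q x \<in> K}) = {x \<in> topspace X. q x \<in> \<Union>\<K>}"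
      by blast
    ultimately show "openin X {x \<in> topspace X. q x \<in> \<Union>\<K>}"
      by simp
  qed blast+
  then show ?thesis
    by (simp add: quotient_topology_def topology_inverse')
qed

lemma topspace_quotient_topology: "topspace (quotient_topology X q) = q ` topspace X"
proof (rule antisym)
  show "topspace (quotient_topology X q) \<subseteq> q ` topspace X"
    by (rule openin_quotient_topology[THEN iffD1, OF openin_topspace, THEN conjunct1])
  have "{x \<in> topspace X. q x \<in> q ` topspace X} = topspace X"
    by blast
  then have "openin (quotient_topology X q) (q ` topspace X)"
    by (simp add: openin_quotient_topology)
  then show "q ` topspace X \<subseteq> topspace (quotient_topology X q)"
    by (rule openin_subset)
qed

lemma quotient_map_quotient_topology: "quotient_map X (quotient_topology X q) q"
  by (auto simp: quotient_map_def topspace_quotient_topology openin_quotient_topology)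

definition Out_chi_topology ::
  "('a::cstar_algebra \<Rightarrow> 'a \<Rightarrow> 'b::cstar_algebra) \<Rightarrow> ('a \<Rightarrow> 'b) \<Rightarrow> ('a \<Rightarrow> 'a) set topology" where
  "Out_chi_topology t \<Phi> =
     quotient_topology (Aut_topology t \<Phi>) (\<lambda>\<alpha>. Aut_chi t \<Phi> #>\<^bsub>Aut_group t \<Phi>\<^esub> \<alpha>)"

lemma topspace_Aut_topology: "topspace (Aut_topology t \<Phi>) = Aut t \<Phi>"
proof (rule antisym)
  show "topspace (Aut_topology t \<Phi>) \<subseteq> Aut t \<Phi>"
    by (rule openin_Aut_topology[THEN iffD1, OF openin_topspace, THEN conjunct1])
  have "\<beta> \<circ> \<alpha> \<in> Aut t \<Phi>" if \<alpha>: "\<alpha> \<in> Aut t \<Phi>" and \<beta>: "\<beta> \<in> Aut t \<Phi>" for \<alpha> \<beta>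
  proof -
    obtain F where F: "is_tensor_hom t t \<alpha> \<alpha> F" "F \<circ> \<Phi> = \<Phi> \<circ> \<alpha>"
      using \<alpha> unfolding Aut_def mem_Collect_eq by blast
    obtain G where G: "is_tensor_hom t t \<beta> \<beta> G" "G \<circ> \<Phi> = \<Phi> \<circ> \<beta>"
      using \<beta> unfolding Aut_def mem_Collect_eq by blast
    have "is_tensor_hom t t (\<beta> \<circ> \<alpha>) (\<beta> \<circ> \<alpha>) (G \<circ> F)"
      using F(1) G(1) by (simp add: is_tensor_hom_def star_hom_def)
    moreover have "(G \<circ> F) \<circ> \<Phi> = \<Phi> \<circ> (\<beta> \<circ> \<alpha>)"
      using F(2) G(2) by (simp add: fun_eq_iff)
    moreover have "bij (\<beta> \<circ> \<alpha>)" "star_hom (\<beta> \<circ> \<alpha>)"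
      using \<alpha> \<beta> by (simp_all add: Aut_def star_hom_def bij_comp)
    ultimately show ?thesis
      unfolding Aut_def mem_Collect_eq by (intro conjI exI)
  qed
  then have "openin (Aut_topology t \<Phi>) (Aut t \<Phi>)"
    by (auto simp: openin_Aut_topology Aut_nbhd_id_def intro!: exI[of _ "{}"] exI[of _ "1::real"])
  then show "Aut t \<Phi> \<subseteq> topspace (Aut_topology t \<Phi>)"
    by (rule openin_subset)
qed

lemma topspace_Out_chi_topology: "topspace (Out_chi_topology t \<Phi>) = carrier (Out_chi t \<Phi>)"
  by (auto simp: Out_chi_topology_def topspace_quotient_topology topspace_Aut_topology
      Out_chi_def FactGroup_def RCOSETS_def Aut_group_def)

definition totally_disconnected_space :: "'x topology \<Rightarrow> bool" where
  "totally_disconnected_space X \<longleftrightarrow>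
     (\<forall>x \<in> topspace X. connected_component_of_set X x = {x})"

end

theory Submission
  imports Defs "Jordan_Normal_Form.Char_Poly"
begin

text \<open>
  Let \<open>h\<close> be the Haar state. By Schur's lemma the averages \<open>(id \<otimes> h)(u\<^sup>* (x \<otimes> 1) v)\<close> give
  \<open>h(\<chi>\<^sub>u\<^sup>* \<chi>\<^sub>v) = 0\<close> for irreducible \<open>u\<close>, \<open>v\<close> with distinct characters and
  \<open>h(\<chi>\<^sub>u\<^sup>* \<chi>\<^sub>u) = 1\<close>, so a character different from \<open>\<chi>\<^sub>u\<close> has distance at least
  \<open>1 / \<parallel>\<chi>\<^sub>u\<parallel>\<close> from it. An automorphism maps characters to characters, hence fixes \<open>\<chi>\<^sub>v\<close> as
  soon as it moves it little: for every irreducible \<open>v\<close> the set of \<open>\<gamma>\<close> with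
  \<open>\<gamma>(\<chi>\<^sub>v) = \<alpha>(\<chi>\<^sub>v)\<close> is clopen. Such sets are unions
  of cosets of the subgroup fixing all characters and separate any two of these cosets.

  The Haar state is found as a common fixed point: every state \<open>\<omega>\<close> has a state \<open>h\<close> with
  \<open>\<omega> * h = h * \<omega> = h\<close>, a limit of averages of convolution powers, and then \<open>h * \<rho> = h\<close> for every
  convex component \<open>\<rho>\<close> of \<open>\<omega>\<close>; so any finitely many states have a common such \<open>h\<close>, and compactness of
  the state space finishes.
\<close>

section \<open>C*-algebras\<close>

text \<open>All analysis is drawn from the representations hidden in \<open>min_tensor\<close>: the
  functionals a \<mapsto> <f, \<pi>(a) g> separate points, recover the norm and bound the slice
  maps. The Haar state is used in the form (h \<otimes> id) \<Phi>(a) = h(a) 1, which follows from h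
  * \<rho> = h for all states \<rho>, because states separate points. The constant in the separation
  comes from 1 = h(star x (x - y)) \<le> norm x norm (x - y) for distinct characters x and y;
  representations of one dimension suffice, since v and its image under an automorphism have the
  same size.

  The main obstacle is the inverse in \<open>Aut\<close>. Membership asks for a homomorphism
  \<alpha> \<otimes> \<alpha> of A \<otimes> A, and for the inverse of \<alpha> this map must be
  shown to be onto. That rests on injective star-homomorphisms being isometric, and this in turn on
  square roots, made by an iteration whose iterates every homomorphism carries along. Inverses
  matter because automorphisms agreeing on all characters must be shown to lie in one coset.\<close>

lemma scaleC_one [simp]: "1 *\<^sub>C (x::'a::cstar_algebra) = x"
  using scaleR_scaleC[of 1 x] by simp

lemma scaleC_zero_left [simp]: "0 *\<^sub>C (x::'a::cstar_algebra) = 0"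
  using norm_scaleC[of 0 x] by simp

lemma scaleC_zero_right [simp]: "c *\<^sub>C (0::'a::cstar_algebra) = 0"
  using norm_scaleC[of c "0::'a"] by simp

lemma bounded_linear_scaleC: "bounded_linear (\<lambda>x::'a::cstar_algebra. c *\<^sub>C x)"
  by (rule bounded_linear_intro[where K = "cmod c"])
    (simp_all add: scaleC_add_right scaleR_scaleC scaleC_scaleC norm_scaleC mult.commute)

lemma scaleC_diff_right: "c *\<^sub>C (x - y::'a::cstar_algebra) = c *\<^sub>C x - c *\<^sub>C y"
  by (rule linear_diff[OF bounded_linear.linear[OF bounded_linear_scaleC]])

lemma scaleC_sum_right: "c *\<^sub>C (\<Sum>i\<in>I. f i) = (\<Sum>i\<in>I. c *\<^sub>C (f i::'a::cstar_algebra))"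
  by (rule linear_sum[OF bounded_linear.linear[OF bounded_linear_scaleC]])

lemma scaleC_minus_left: "(- c) *\<^sub>C (x::'a::cstar_algebra) = - (c *\<^sub>C x)"
  using scaleC_add_left[of "-c" c x] by (simp add: eq_neg_iff_add_eq_0)

lemma scaleC_diff_left: "(c - d) *\<^sub>C (x::'a::cstar_algebra) = c *\<^sub>C x - d *\<^sub>C x"
  using scaleC_add_left[of c "-d" x] by (simp add: scaleC_minus_left)

lemma scaleC_sum_left: "(\<Sum>i\<in>I. f i) *\<^sub>C (x::'a::cstar_algebra) = (\<Sum>i\<in>I. f i *\<^sub>C x)"
  by (induction I rule: infinite_finite_induct) (auto simp: scaleC_add_left)

lemma scaleC_of_real: "complex_of_real r *\<^sub>C (x::'a::cstar_algebra) = r *\<^sub>R x"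
  by (simp add: scaleR_scaleC)

lemma star_zero [simp]: "star (0::'a::cstar_algebra) = 0"
  using star_add[of "0::'a" 0] by simp

lemma star_one [simp]: "star (1::'a::cstar_algebra) = 1"
  using star_mult[of "star 1::'a" 1] by (simp add: star_star)

text \<open>The C*-identity gives (norm y)^2 \<le> norm (star y) norm y; applied to x and to star x
  it yields both inequalities.\<close>

lemma norm_star [simp]: "norm (star x) = norm (x::'a::cstar_algebra)"
proof -
  have le: "norm y \<le> norm (star y)" for y :: 'a
  proof (cases "y = 0")
    case False
    have "norm y * norm y \<le> norm (star y) * norm y"
      using norm_mult_ineq[of "star y" y] by (simp add: norm_star_mult_self power2_eq_square)
    with False show ?thesis by simp
  qed simp
  show ?thesis using le[of x] le[of "star x"] by (simp add: star_star)
qed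

lemma bounded_linear_star: "bounded_linear (star :: 'a::cstar_algebra \<Rightarrow> 'a)"
  by (rule bounded_linear_intro[where K = 1]) (simp_all add: star_add scaleR_scaleC star_scaleC)

lemma star_diff: "star (x - y) = star x - star (y::'a::cstar_algebra)"
  by (rule linear_diff[OF bounded_linear.linear[OF bounded_linear_star]])

lemma star_sum: "star (\<Sum>i\<in>I. f i) = (\<Sum>i\<in>I. star (f i::'a::cstar_algebra))"
  by (rule linear_sum[OF bounded_linear.linear[OF bounded_linear_star]])

lemma star_scaleR: "star (r *\<^sub>R x) = r *\<^sub>R star (x::'a::cstar_algebra)"
  by (simp add: scaleR_scaleC star_scaleC)

text \<open>\<open>bounded_linear\<close> is linearity over the reals only, so complex homogeneity
  is added. With codomain \<open>complex\<close>, itself a C*-algebra, these are the bounded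
  functionals.\<close>

definition bclinear :: "('a::cstar_algebra \<Rightarrow> 'b::cstar_algebra) \<Rightarrow> bool" where
  "bclinear f \<longleftrightarrow> bounded_linear f \<and> (\<forall>c x. f (c *\<^sub>C x) = c *\<^sub>C f x)"

lemma bclinearD:
  assumes "bclinear f"
  shows "bounded_linear f" "f (x + y) = f x + f y" "f (x - y) = f x - f y" "f (- x) = - f x"
    "f (c *\<^sub>C x) = c *\<^sub>C f x" "f (r *\<^sub>R x) = r *\<^sub>R f x" "f 0 = 0"
    "f (\<Sum>i\<in>I. g i) = (\<Sum>i\<in>I. f (g i))"
proof -
  show b: "bounded_linear f" using assms by (simp add: bclinear_def)
  note l = bounded_linear.linear[OF b]
  show "f (x + y) = f x + f y" "f (x - y) = f x - f y" "f (- x) = - f x"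
    "f (r *\<^sub>R x) = r *\<^sub>R f x" "f 0 = 0" "f (\<Sum>i\<in>I. g i) = (\<Sum>i\<in>I. f (g i))"
    using linear_add[OF l] linear_diff[OF l] linear_neg[OF l] linear_0[OF l] linear_sum[OF l]
      linear_cmul[OF l] by auto
  show "f (c *\<^sub>C x) = c *\<^sub>C f x" using assms by (simp add: bclinear_def)
qed

lemma bclinear_scaleC_complex:
  assumes "bclinear (f :: 'a::cstar_algebra \<Rightarrow> complex)"
  shows "f (c *\<^sub>C x) = c * f x"
  using bclinearD(5)[OF assms] by (simp add: scaleC_complex_def)

lemma bclinearI:
  assumes "\<And>x y. f (x + y) = f x + f y" "\<And>c x. f (c *\<^sub>C x) = c *\<^sub>C f x"
    "\<And>x. norm (f x) \<le> K * norm x"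
  shows "bclinear f"
  unfolding bclinear_def
  using assms by (auto intro!: bounded_linear_intro[where K = K] simp: scaleR_scaleC mult.commute)

lemma bclinear_compose: "bclinear f \<Longrightarrow> bclinear g \<Longrightarrow> bclinear (\<lambda>x. f (g x))"
  unfolding bclinear_def using bounded_linear_compose by auto

lemma bclinear_add: "bclinear f \<Longrightarrow> bclinear g \<Longrightarrow> bclinear (\<lambda>x. f x + g x)"
  unfolding bclinear_def using bounded_linear_add by (auto simp: scaleC_add_right)

lemma bclinear_scaleC: "bclinear f \<Longrightarrow> bclinear (\<lambda>x. c *\<^sub>C f x)"
  unfolding bclinear_def using bounded_linear_compose[OF bounded_linear_scaleC]
  by (auto simp: scaleC_scaleC mult.commute)

lemma bclinear_zero: "bclinear (\<lambda>x. 0)"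
  unfolding bclinear_def by auto

lemma bclinear_sum: "(\<And>i. i \<in> I \<Longrightarrow> bclinear (f i)) \<Longrightarrow> bclinear (\<lambda>x. \<Sum>i\<in>I. f i x)"
  by (induction I rule: infinite_finite_induct) (auto intro: bclinear_add bclinear_zero)

lemma bclinear_mult_left: "bclinear (\<lambda>x. a * x)"
  by (rule bclinearI[where K = "norm a"]) (auto simp: distrib_left mult_scaleC_right norm_mult_ineq)

lemma bounded_linear_eq_on_dense_span:
  assumes "bounded_linear f" "bounded_linear g" "closure (span S) = UNIV" "\<And>x. x \<in> S \<Longrightarrow> f x = g x"
  shows "f = g"
proof -
  have span: "f x = g x" if "x \<in> span S" for x
    using linear_eq_on_span[OF assms(1,2)[THEN bounded_linear.linear] assms(4)] that by blast
  have "closed {x. f x = g x}"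
    by (intro closed_Collect_eq linear_continuous_on assms)
  moreover have "span S \<subseteq> {x. f x = g x}" using span by auto
  ultimately have "closure (span S) \<subseteq> {x. f x = g x}" by (rule closure_minimal[rotated])
  then show ?thesis using assms(3) by auto
qed

lemma bclinear_eq_on_dense_span:
  assumes "bclinear f" "bclinear g" "closure (span S) = UNIV" "\<And>x. x \<in> S \<Longrightarrow> f x = g x"
  shows "f = g"
  using bounded_linear_eq_on_dense_span[of f g S] assms by (simp add: bclinear_def)

text \<open>The iteration \<open>y \<mapsto> (x + y\<^sup>2) / 2\<close> has polynomials in \<open>x\<close> with nonnegative coefficients as
  iterates, so that the scalar case \<open>x = 1\<close> majorises all \<open>x\<close> with \<open>norm x \<le> 1\<close>. Its limit \<open>y\<close>
  satisfies \<open>(1 - y)\<^sup>2 = 1 - x\<close>.\<close>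

primrec sqrt_iter :: "'a::real_normed_algebra_1 \<Rightarrow> nat \<Rightarrow> 'a" where
  "sqrt_iter x 0 = 0"
| "sqrt_iter x (Suc n) = (1/2) *\<^sub>R (x + sqrt_iter x n * sqrt_iter x n)"

lemma sqrt_iter_one_bounds: "0 \<le> sqrt_iter (1::real) n \<and> sqrt_iter (1::real) n \<le> 1"
proof (induction n)
  case (Suc n)
  then have "sqrt_iter (1::real) n * sqrt_iter 1 n \<le> 1 * 1" by (intro mult_mono) auto
  then show ?case by auto
qed simp

lemma sqrt_iter_norm_bounds:
  fixes x :: "'a::real_normed_algebra_1"
  assumes "norm x \<le> 1"
  shows "norm (sqrt_iter x n) \<le> sqrt_iter (1::real) n \<and>
    norm (sqrt_iter x (Suc n) - sqrt_iter x n) \<le> sqrt_iter (1::real) (Suc n) - sqrt_iter 1 n"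
proof (induction n)
  case 0
  then show ?case using assms by simp
next
  case (Suc n)
  let ?y = "sqrt_iter x n" and ?z = "sqrt_iter x (Suc n)"
  let ?s = "sqrt_iter (1::real) n" and ?r = "sqrt_iter (1::real) (Suc n)"
  have z: "norm ?z \<le> ?r"
    using Suc norm_triangle_ineq[of ?y "?z - ?y"] by (simp del: sqrt_iter.simps)
  have mono: "0 \<le> ?r - ?s"
    using Suc by (meson norm_ge_zero order_trans)
  \<comment> \<open>This splitting of z^2 - y^2 is valid without commutativity, and each factor is
    majorised by its scalar counterpart.\<close>
  have eq: "sqrt_iter x (Suc (Suc n)) - ?z = (1/2) *\<^sub>R (?z * (?z - ?y) + (?z - ?y) * ?y)"
    by (simp add: algebra_simps)
  have "norm (?z * (?z - ?y) + (?z - ?y) * ?y) \<le> norm (?z * (?z - ?y)) + norm ((?z - ?y) * ?y)"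
    by (rule norm_triangle_ineq)
  also have "\<dots> \<le> norm ?z * norm (?z - ?y) + norm (?z - ?y) * norm ?y"
    by (intro add_mono norm_mult_ineq)
  also have "\<dots> \<le> ?r * (?r - ?s) + (?r - ?s) * ?s"
    using Suc z mono sqrt_iter_one_bounds[of n] sqrt_iter_one_bounds[of "Suc n"]
    by (intro add_mono mult_mono) (simp_all del: sqrt_iter.simps)
  finally have "norm (sqrt_iter x (Suc (Suc n)) - ?z) \<le> (1/2) * (?r * (?r - ?s) + (?r - ?s) * ?s)"
    unfolding eq by simp
  also have "\<dots> = sqrt_iter (1::real) (Suc (Suc n)) - ?r"
    by (simp add: algebra_simps)
  finally show ?case using z by blast
qed

lemma sqrt_iter_diff:
  fixes x :: "'a::real_normed_algebra_1"
  assumes "norm x \<le> 1" "m \<le> n"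
  shows "norm (sqrt_iter x n - sqrt_iter x m) \<le> sqrt_iter (1::real) n - sqrt_iter 1 m"
  using assms(2)
proof (induction n rule: dec_induct)
  case (step n)
  have "norm (sqrt_iter x (Suc n) - sqrt_iter x m) \<le>
     norm (sqrt_iter x (Suc n) - sqrt_iter x n) + norm (sqrt_iter x n - sqrt_iter x m)"
    using norm_triangle_ineq[of "sqrt_iter x (Suc n) - sqrt_iter x n" "sqrt_iter x n - sqrt_iter x m"]
    by simp
  then show ?case using step.IH sqrt_iter_norm_bounds[OF assms(1), of n] by linarith
qed simp

text \<open>For x = 1 the iterates increase and stay below 1, so they are Cauchy; their increments
  dominate those for \<open>x\<close>.\<close>

lemma sqrt_iter_convergent:
  fixes x :: "'a::{real_normed_algebra_1,banach}"
  assumes "norm x \<le> 1"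
  shows "convergent (sqrt_iter x)"
proof -
  have "incseq (sqrt_iter (1::real))"
    using sqrt_iter_norm_bounds[of "1::real"] by (intro incseq_SucI) (smt (verit) norm_ge_zero norm_one)
  then have "convergent (sqrt_iter (1::real))"
    using sqrt_iter_one_bounds incseq_convergent[of "sqrt_iter (1::real)" 1]
    unfolding convergent_def by metis
  then have C: "Cauchy (sqrt_iter (1::real))" by (rule convergent_Cauchy)
  have "Cauchy (sqrt_iter x)"
    unfolding Cauchy_altdef2
  proof (intro allI impI)
    fix e :: real assume "e > 0"
    then obtain N where N: "\<And>n. n \<ge> N \<Longrightarrow> dist (sqrt_iter (1::real) n) (sqrt_iter 1 N) < e"
      using C unfolding Cauchy_altdef2 by meson
    show "\<exists>N. \<forall>n\<ge>N. dist (sqrt_iter x n) (sqrt_iter x N) < e"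
    proof (intro exI allI impI)
      fix n assume "N \<le> n"
      then show "dist (sqrt_iter x n) (sqrt_iter x N) < e"
        using N[of n] sqrt_iter_diff[OF assms, of N n] by (simp add: dist_norm)
    qed
  qed
  then show ?thesis by (simp add: Cauchy_convergent_iff)
qed

definition sqrt_lim :: "'a::{real_normed_algebra_1,banach} \<Rightarrow> 'a" where
  "sqrt_lim x = lim (sqrt_iter x)"

lemma sqrt_lim_tendsto:
  "norm x \<le> 1 \<Longrightarrow> sqrt_iter x \<longlonglongrightarrow> sqrt_lim x"
  unfolding sqrt_lim_def using sqrt_iter_convergent convergent_LIMSEQ_iff by blast

lemma norm_sqrt_lim: "norm x \<le> 1 \<Longrightarrow> norm (sqrt_lim x) \<le> 1"
  by (rule tendsto_upperbound[OF tendsto_norm[OF sqrt_lim_tendsto]])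
    (auto intro!: always_eventually order_trans[OF conjunct1[OF sqrt_iter_norm_bounds]]
      simp: sqrt_iter_one_bounds)

lemma sqrt_lim_eq:
  assumes "norm x \<le> 1"
  shows "sqrt_lim x = (1/2) *\<^sub>R (x + sqrt_lim x * sqrt_lim x)"
proof -
  have "(\<lambda>n. sqrt_iter x (Suc n)) \<longlonglongrightarrow> (1/2) *\<^sub>R (x + sqrt_lim x * sqrt_lim x)"
    by (auto intro!: tendsto_intros sqrt_lim_tendsto assms)
  moreover have "(\<lambda>n. sqrt_iter x (Suc n)) \<longlonglongrightarrow> sqrt_lim x"
    using sqrt_lim_tendsto[OF assms] by (rule LIMSEQ_Suc)
  ultimately show ?thesis using LIMSEQ_unique by blast
qed

lemma sqrt_lim_square:
  assumes "norm x \<le> 1"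
  shows "(1 - sqrt_lim x) * (1 - sqrt_lim x) = 1 - x"
proof -
  have "2 *\<^sub>R sqrt_lim x = x + sqrt_lim x * sqrt_lim x"
    by (subst sqrt_lim_eq[OF assms]) (simp add: algebra_simps)
  then show ?thesis by (simp add: algebra_simps scaleR_2)
qed

lemma star_sqrt_lim:
  fixes x :: "'a::cstar_algebra"
  assumes "norm x \<le> 1" "star x = x"
  shows "star (sqrt_lim x) = sqrt_lim x"
proof -
  have "star (sqrt_iter x n) = sqrt_iter x n" for n
    by (induction n) (auto simp: assms star_add star_scaleR star_mult)
  then show ?thesis
    using bounded_linear.tendsto[OF bounded_linear_star sqrt_lim_tendsto[OF assms(1)]]
      sqrt_lim_tendsto[OF assms(1)] LIMSEQ_unique by fastforce
qed

lemma sqrt_lim_commute: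
  assumes "norm x \<le> 1" "x * k = k * x"
  shows "sqrt_lim x * k = k * sqrt_lim x"
proof -
  have it: "sqrt_iter x n * k = k * sqrt_iter x n" for n
    by (induction n) (auto simp: algebra_simps assms(2), metis mult.assoc)
  have "(\<lambda>n. sqrt_iter x n * k) \<longlonglongrightarrow> sqrt_lim x * k"
    by (intro tendsto_intros sqrt_lim_tendsto assms)
  moreover have "(\<lambda>n. k * sqrt_iter x n) \<longlonglongrightarrow> k * sqrt_lim x"
    by (intro tendsto_intros sqrt_lim_tendsto assms)
  ultimately show ?thesis using LIMSEQ_unique it by auto
qed

text \<open>Since x = 2k - k^2, \<open>k\<close> commutes with x and hence with the limit y.
  Subtracting the two quadratic equations gives 2(y - k) = (y - k)(y + k), and norm y + norm k < 2
  leaves only y = k.\<close>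

lemma sqrt_lim_unique:
  assumes "norm x \<le> 1" "norm k < 1" "(1 - k) * (1 - k) = 1 - x"
  shows "sqrt_lim x = k"
proof -
  let ?y = "sqrt_lim x"
  have k: "k + k = x + k * k" using assms(3) by (simp add: algebra_simps)
  have y: "?y + ?y = x + ?y * ?y"
    using sqrt_lim_square[OF assms(1)] by (simp add: algebra_simps)
  have xeq: "x = k + k - k * k" using k by simp
  have "x * k = k * x" unfolding xeq by (simp add: algebra_simps)
  then have comm: "?y * k = k * ?y" by (rule sqrt_lim_commute[OF assms(1)])
  have "(?y - k) + (?y - k) = (?y - k) * (?y + k)"
    using k y comm by (simp add: algebra_simps)
  then have "2 * norm (?y - k) = norm ((?y - k) * (?y + k))"
    by (metis norm_scaleR scaleR_2 abs_numeral)
  also have "\<dots> \<le> norm (?y - k) * (norm ?y + norm k)"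
    by (rule order_trans[OF norm_mult_ineq]) (simp add: mult_left_mono norm_triangle_ineq)
  finally have "norm (?y - k) * (2 - norm ?y - norm k) \<le> 0" by (simp add: algebra_simps)
  moreover have "2 - norm ?y - norm k > 0" using norm_sqrt_lim[OF assms(1)] assms(2) by linarith
  ultimately have "norm (?y - k) \<le> 0" by (metis mult_le_0_iff not_le norm_ge_zero)
  then show ?thesis by simp
qed

lemma star_homD:
  assumes "star_hom f"
  shows "f (x + y) = f x + f y" "f (c *\<^sub>C x) = c *\<^sub>C f x" "f (x * y) = f x * f y"
    "f (star x) = star (f x)" "f 1 = 1" "f (r *\<^sub>R x) = r *\<^sub>R f x" "f 0 = 0" "f (- x) = - f x"
    "f (x - y) = f x - f y" "f (\<Sum>i\<in>I. g i) = (\<Sum>i\<in>I. f (g i))"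
proof -
  show a: "f (x + y) = f x + f y" and c: "f (c *\<^sub>C x) = c *\<^sub>C f x" and "f (x * y) = f x * f y"
    "f (star x) = star (f x)" "f 1 = 1" for x y c using assms unfolding star_hom_def by blast+
  show "f (r *\<^sub>R x) = r *\<^sub>R f x" for r x by (simp add: scaleR_scaleC c)
  then have l: "linear f" using a by (simp add: linear_iff)
  show "f 0 = 0" "f (- x) = - f x" "f (x - y) = f x - f y" "f (\<Sum>i\<in>I. g i) = (\<Sum>i\<in>I. f (g i))"
    using linear_0[OF l] linear_neg[OF l] linear_diff[OF l] linear_sum[OF l] by auto
qed

lemma star_hom_sqrt_iter: "star_hom f \<Longrightarrow> f (sqrt_iter x n) = sqrt_iter (f x) n"
  by (induction n) (simp_all add: star_homD)

section \<open>Faithful representations\<close>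

text \<open>The expression is the value at f + z g of a semidefinite form with entries a, b, c.
  Isolating this step lets it serve inner products, the form of 1 - star a a, and states.\<close>

lemma cauchy_schwarz_scalar:
  fixes b :: complex
  assumes "\<And>z::complex. 0 \<le> a + 2 * Re (z * b) + (cmod z)\<^sup>2 * c" "c \<ge> 0"
  shows "(cmod b)\<^sup>2 \<le> a * c"
proof (cases "c = 0")
  case True
  have "b = 0"
  proof (rule ccontr)
    assume "b \<noteq> 0"
    \<comment> \<open>For c = 0 the expression is affine in z; this choice brings it to a -
      2(\<bar>a\<bar> + 1) < 0.\<close>
    let ?t = "(\<bar>a\<bar> + 1) / (cmod b)\<^sup>2"
    have "Re (complex_of_real (- ?t) * cnj b * b) = - ?t * (cmod b)\<^sup>2"
      by (simp only: mult.assoc mult.commute[of "cnj b"] complex_norm_square[symmetric])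
        (simp only: of_real_mult[symmetric] Re_complex_of_real)
    also have "\<dots> = - (\<bar>a\<bar> + 1)" using \<open>b \<noteq> 0\<close> by simp
    finally show False using assms(1)[of "complex_of_real (- ?t) * cnj b"] True by simp
  qed
  then show ?thesis using True by simp
next
  case False
  then have c: "c > 0" using assms by simp
  \<comment> \<open>The minimiser of the quadratic expression.\<close>
  let ?z = "complex_of_real (- 1 / c) * cnj b"
  have "Re (?z * b) = (- 1 / c) * (cmod b)\<^sup>2"
    by (simp only: mult.assoc mult.commute[of "cnj b"] complex_norm_square[symmetric])
      (simp only: of_real_mult[symmetric] Re_complex_of_real)
  then have "2 * Re (?z * b) = - 2 * ((cmod b)\<^sup>2 / c)" by (simp only:) simp
  moreover have "(cmod ?z)\<^sup>2 * c = (cmod b)\<^sup>2 / c"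
    using c by (simp add: norm_mult norm_divide power2_eq_square field_simps)
  ultimately have "0 \<le> a - (cmod b)\<^sup>2 / c" using assms(1)[of ?z] by linarith
  then show ?thesis using c by (simp add: field_simps)
qed

section \<open>The Hilbert space of square-summable functions and its tensor products\<close>

lemma ell2_summable_inner:
  assumes "f \<in> ell2" "g \<in> ell2"
  shows "(\<lambda>i. cnj (f i) * g i) summable_on UNIV"
proof (rule abs_summable_summable, rule abs_summable_product)
  show "(\<lambda>i. norm (cnj (f i) * cnj (f i))) summable_on UNIV"
    using assms(1) by (simp add: ell2_def norm_mult power2_eq_square)
  show "(\<lambda>i. norm (g i * g i)) summable_on UNIV"
    using assms(2) by (simp add: ell2_def norm_mult power2_eq_square)
qed

lemma ell2_add:
  assumes "f \<in> ell2" "g \<in> ell2"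
  shows "(\<lambda>i. f i + g i) \<in> ell2"
proof -
  have "(\<lambda>i. (cmod (f i))\<^sup>2 + (cmod (g i))\<^sup>2 + 2 * Re (cnj (f i) * g i)) summable_on UNIV"
    using assms
    by (intro summable_on_add summable_on_cmult_right summable_on_Re ell2_summable_inner)
      (auto simp: ell2_def)
  moreover have "(cmod (a + b))\<^sup>2 = (cmod a)\<^sup>2 + (cmod b)\<^sup>2 + 2 * Re (cnj a * b)" for a b
    unfolding cmod_power2 by (simp add: power2_eq_square algebra_simps)
  ultimately show ?thesis by (simp add: ell2_def)
qed

lemma ell2_scale: "f \<in> ell2 \<Longrightarrow> (\<lambda>i. c * f i) \<in> ell2"
  by (simp add: ell2_def norm_mult power_mult_distrib summable_on_cmult_right)

lemma ell2_zero: "(\<lambda>i. 0) \<in> ell2"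
  by (simp add: ell2_def)

lemma ell2_inner_add_right:
  "f \<in> ell2 \<Longrightarrow> g \<in> ell2 \<Longrightarrow> h \<in> ell2 \<Longrightarrow>
    ell2_inner f (\<lambda>i. g i + h i) = ell2_inner f g + ell2_inner f h"
  by (simp add: ell2_inner_def distrib_left infsum_add ell2_summable_inner)

lemma ell2_inner_scale_right: "ell2_inner f (\<lambda>i. c * g i) = c * ell2_inner f g"
  by (simp add: ell2_inner_def infsum_cmult_right'[symmetric] mult.left_commute)

lemma ell2_inner_commute: "ell2_inner g f = cnj (ell2_inner f g)"
  by (simp add: ell2_inner_def infsum_cnj[symmetric] mult.commute del: infsum_cnj)

lemma ell2_inner_add_left:
  "f \<in> ell2 \<Longrightarrow> g \<in> ell2 \<Longrightarrow> h \<in> ell2 \<Longrightarrow>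
    ell2_inner (\<lambda>i. g i + h i) f = ell2_inner g f + ell2_inner h f"
  by (simp add: ell2_inner_commute[of _ f] ell2_inner_add_right)

lemma ell2_inner_scale_left: "ell2_inner (\<lambda>i. c * g i) f = cnj c * ell2_inner g f"
  by (simp add: ell2_inner_commute[of _ f] ell2_inner_scale_right)

lemma ell2_norm_nonneg [simp]: "0 \<le> ell2_norm f"
  by (simp add: ell2_norm_def infsum_nonneg)

lemma ell2_inner_self: "ell2_inner f f = complex_of_real ((ell2_norm f)\<^sup>2)"
proof -
  have "ell2_inner f f = (\<Sum>\<^sub>\<infinity>i. complex_of_real ((cmod (f i))\<^sup>2))"
    unfolding ell2_inner_def by (simp only: complex_norm_square mult.commute)
  also have "\<dots> = complex_of_real (\<Sum>\<^sub>\<infinity>i. (cmod (f i))\<^sup>2)"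
  proof (cases "(\<lambda>i. (cmod (f i))\<^sup>2) summable_on UNIV")
    case True
    then show ?thesis by (intro infsumI has_sum_of_real has_sum_infsum)
  next
    \<comment> \<open>Outside \<open>ell2\<close> both infinite sums take their default value
      0.\<close>
    case False
    then have "\<not> (\<lambda>i. complex_of_real ((cmod (f i))\<^sup>2)) summable_on UNIV"
      using summable_on_Re[of "\<lambda>i. complex_of_real ((cmod (f i))\<^sup>2)" UNIV] by auto
    with False show ?thesis by (simp add: infsum_not_exists del: of_real_power)
  qed
  finally show ?thesis by (simp add: ell2_norm_def infsum_nonneg)
qed

lemma ell2_cauchy_schwarz:
  assumes "f \<in> ell2" "g \<in> ell2"
  shows "cmod (ell2_inner f g) \<le> ell2_norm f * ell2_norm g"
proof -
  have "(cmod (ell2_inner f g))\<^sup>2 \<le> (ell2_norm f)\<^sup>2 * (ell2_norm g)\<^sup>2"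
  proof (rule cauchy_schwarz_scalar)
    fix z
    let ?h = "\<lambda>i. f i + z * g i"
    note zg = ell2_scale[OF assms(2), of z]
    have "ell2_inner ?h ?h = ell2_inner f f + z * ell2_inner f g + cnj z * cnj (ell2_inner f g)
        + (z * cnj z) * ell2_inner g g"
      using assms zg
      by (simp add: ell2_inner_add_left ell2_inner_add_right ell2_add ell2_inner_scale_left
          ell2_inner_scale_right ell2_inner_commute[of g f] algebra_simps)
    then have "complex_of_real ((ell2_norm ?h)\<^sup>2) = complex_of_real ((ell2_norm f)\<^sup>2)
        + (z * ell2_inner f g + cnj (z * ell2_inner f g))
        + complex_of_real ((cmod z)\<^sup>2 * (ell2_norm g)\<^sup>2)"
      unfolding ell2_inner_self
      by (simp only: of_real_mult complex_norm_square[of z] complex_cnj_mult complex_cnj_add add.assoc)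
    also have "\<dots> = complex_of_real ((ell2_norm f)\<^sup>2 + 2 * Re (z * ell2_inner f g)
        + (cmod z)\<^sup>2 * (ell2_norm g)\<^sup>2)"
      by (simp only: complex_add_cnj of_real_add)
    finally have "(ell2_norm ?h)\<^sup>2 = (ell2_norm f)\<^sup>2 + 2 * Re (z * ell2_inner f g)
        + (cmod z)\<^sup>2 * (ell2_norm g)\<^sup>2"
      by (simp only: of_real_eq_iff)
    then show "0 \<le> (ell2_norm f)\<^sup>2 + 2 * Re (z * ell2_inner f g) + (cmod z)\<^sup>2 * (ell2_norm g)\<^sup>2"
      by (metis zero_le_power2)
  qed simp
  then show ?thesis
    by (simp add: power_mult_distrib[symmetric] abs_le_square_iff[symmetric] abs_mult)
qed

lemma ell2_norm_scale: "ell2_norm (\<lambda>i. c * f i) = cmod c * ell2_norm f"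
proof -
  have "ell2_norm (\<lambda>i. c * f i) = sqrt ((cmod c)\<^sup>2 * (\<Sum>\<^sub>\<infinity>i. (cmod (f i))\<^sup>2))"
    by (simp add: ell2_norm_def norm_mult power_mult_distrib infsum_cmult_right')
  then show ?thesis by (simp add: ell2_norm_def real_sqrt_mult)
qed

lemma ell2_norm_eq_0:
  assumes "f \<in> ell2" "ell2_norm f = 0"
  shows "f = (\<lambda>i. 0)"
proof
  fix i
  have "(cmod (f i))\<^sup>2 \<le> (\<Sum>\<^sub>\<infinity>i. (cmod (f i))\<^sup>2)"
    using finite_sum_le_infsum[of "\<lambda>i. (cmod (f i))\<^sup>2" UNIV "{i}"] assms(1) by (simp add: ell2_def)
  then show "f i = 0" using assms(2) by (simp add: ell2_norm_def)
qed

definition ell2_basis :: "'i \<Rightarrow> 'i \<Rightarrow> complex" where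
  "ell2_basis k = (\<lambda>i. if i = k then 1 else 0)"

lemma has_sum_single: "((\<lambda>i. if i = k then c else (0::'b::{comm_monoid_add,topological_space})) has_sum c) UNIV"
  by (rule has_sum_finite_neutralI[of "{k}"]) auto

lemma ell2_basis: "ell2_basis k \<in> ell2"
proof -
  have "(\<lambda>i. (cmod (ell2_basis k i))\<^sup>2) = (\<lambda>i. if i = k then 1 else 0)"
    by (auto simp: ell2_basis_def)
  then show ?thesis
    using has_sum_imp_summable[OF has_sum_single[of k "1::real"]] by (simp add: ell2_def)
qed

lemma ell2_inner_basis: "ell2_inner (ell2_basis k) f = f k"
proof -
  have "(\<lambda>i. cnj (ell2_basis k i) * f i) = (\<lambda>i. if i = k then f k else 0)"
    by (auto simp: ell2_basis_def)
  then show ?thesis using infsumI[OF has_sum_single[of k "f k"]] by (simp add: ell2_inner_def)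
qed

lemma infsum_product_complex:
  fixes a :: "'i \<Rightarrow> complex" and b :: "'j \<Rightarrow> complex"
  assumes "a summable_on UNIV" "b summable_on UNIV"
  shows "(\<lambda>(i, j). a i * b j) summable_on UNIV"
    and "(\<Sum>\<^sub>\<infinity>(i, j). a i * b j) = (\<Sum>\<^sub>\<infinity>i. a i) * (\<Sum>\<^sub>\<infinity>j. b j)"
proof -
  have na: "(\<lambda>i. norm (a i)) summable_on UNIV" and nb: "(\<lambda>i. norm (b i)) summable_on UNIV"
    using assms by (simp_all add: summable_on_iff_abs_summable_on_complex)
  have "(\<lambda>p. norm (case p of (i, j) \<Rightarrow> a i * b j)) summable_on (SIGMA i:UNIV. UNIV)"
    unfolding Infinite_Sum.abs_summable_on_Sigma_iff
    using na nb by (simp add: norm_mult infsum_cmult_right' infsum_nonneg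
        summable_on_cmult_right summable_on_cmult_left)
  then show s: "(\<lambda>(i, j). a i * b j) summable_on UNIV"
    by (simp add: abs_summable_summable)
  have "(\<Sum>\<^sub>\<infinity>(i, j). a i * b j) = (\<Sum>\<^sub>\<infinity>i. \<Sum>\<^sub>\<infinity>j. a i * b j)"
    using infsum_Sigma_banach[of "\<lambda>(i, j). a i * b j" UNIV "\<lambda>_. UNIV"] s by simp
  then show "(\<Sum>\<^sub>\<infinity>(i, j). a i * b j) = (\<Sum>\<^sub>\<infinity>i. a i) * (\<Sum>\<^sub>\<infinity>j. b j)"
    by (simp add: infsum_cmult_right' infsum_cmult_left')
qed

lemma ell2_tensor:
  assumes "f \<in> ell2" "g \<in> ell2"
  shows "ell2_tensor f g \<in> ell2"
proof -
  have "(\<lambda>i. complex_of_real ((cmod (f i))\<^sup>2)) summable_on UNIV"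
    "(\<lambda>i. complex_of_real ((cmod (g i))\<^sup>2)) summable_on UNIV"
    using assms by (auto simp: ell2_def simp del: of_real_power intro!: summable_on_of_real)
  from infsum_product_complex(1)[OF this]
  have "(\<lambda>p. Re (case p of (i, j) \<Rightarrow> complex_of_real ((cmod (f i))\<^sup>2) * complex_of_real ((cmod (g j))\<^sup>2)))
      summable_on UNIV"
    by (rule summable_on_Re)
  then show ?thesis
    by (auto simp: ell2_def ell2_tensor_def case_prod_unfold norm_mult power_mult_distrib
        simp flip: of_real_mult of_real_power)
qed

lemma ell2_inner_tensor:
  assumes "f \<in> ell2" "g \<in> ell2" "f' \<in> ell2" "g' \<in> ell2"
  shows "ell2_inner (ell2_tensor f g) (ell2_tensor f' g') = ell2_inner f f' * ell2_inner g g'"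
  unfolding ell2_inner_def
    infsum_product_complex(2)[OF ell2_summable_inner[OF assms(1,3)] ell2_summable_inner[OF assms(2,4)], symmetric]
  by (simp add: ell2_tensor_def case_prod_unfold mult_ac)

lemma ell2_norm_tensor:
  assumes "f \<in> ell2" "g \<in> ell2"
  shows "ell2_norm (ell2_tensor f g) = ell2_norm f * ell2_norm g"
proof -
  have "complex_of_real ((ell2_norm (ell2_tensor f g))\<^sup>2) = complex_of_real ((ell2_norm f * ell2_norm g)\<^sup>2)"
    using ell2_inner_tensor[OF assms assms] by (simp add: ell2_inner_self power_mult_distrib)
  then show ?thesis by (simp only: of_real_eq_iff) (simp add: power2_eq_iff_nonneg)
qed

lemma ell2_basis_tensor: "ell2_tensor (ell2_basis i) (ell2_basis j) = ell2_basis (i, j)"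
  by (auto simp: ell2_tensor_def ell2_basis_def)

section \<open>Vector functionals and norm estimates in a faithful representation\<close>

locale rep =
  fixes \<pi> :: "'a::cstar_algebra \<Rightarrow> ('i \<Rightarrow> complex) \<Rightarrow> ('i \<Rightarrow> complex)"
  assumes faithful: "faithful_rep \<pi>"
begin

lemmas rep_facts = faithful[unfolded faithful_rep_def]
lemmas rep_bounded = rep_facts[THEN conjunct1, THEN spec, unfolded ell2_bounded_operator_def]
lemmas ell2_rep = rep_bounded[THEN conjunct1, THEN bspec]
lemmas rep_add_vector = rep_bounded[THEN conjunct2, THEN conjunct1, THEN bspec, THEN bspec]
lemmas rep_scale_vector = rep_bounded[THEN conjunct2, THEN conjunct2, THEN conjunct1, THEN spec, THEN bspec]
lemmas rep_op_bound = rep_bounded[THEN conjunct2, THEN conjunct2, THEN conjunct2]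
lemmas rep_add = rep_facts[THEN conjunct2, THEN conjunct1, THEN spec, THEN spec, THEN bspec]
lemmas rep_scaleC =
  rep_facts[THEN conjunct2, THEN conjunct2, THEN conjunct1, THEN spec, THEN spec, THEN bspec]
lemmas rep_mult =
  rep_facts[THEN conjunct2, THEN conjunct2, THEN conjunct2, THEN conjunct1, THEN spec, THEN spec, THEN bspec]
lemmas rep_one =
  rep_facts[THEN conjunct2, THEN conjunct2, THEN conjunct2, THEN conjunct2, THEN conjunct1, THEN bspec]
lemmas rep_star =
  rep_facts[THEN conjunct2, THEN conjunct2, THEN conjunct2, THEN conjunct2, THEN conjunct2,
    THEN conjunct1, THEN spec, THEN bspec, THEN bspec]
lemmas rep_onorm =
  rep_facts[THEN conjunct2, THEN conjunct2, THEN conjunct2, THEN conjunct2, THEN conjunct2,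
    THEN conjunct2, THEN spec]

text \<open>The supremum \<open>ell2_onorm\<close> bounds its terms only because the operator is
  bounded, which makes the set of values bounded above; the rest is scaling to a unit
  vector.\<close>

lemma rep_norm_le:
  assumes f: "f \<in> ell2"
  shows "ell2_norm (\<pi> a f) \<le> norm a * ell2_norm f"
proof (cases "ell2_norm f = 0")
  case True
  have "\<pi> a (\<lambda>i. 0) = (\<lambda>i. 0)" using rep_scale_vector[OF f, of a 0] by simp
  then show ?thesis using ell2_norm_eq_0[OF f True] by (simp add: ell2_norm_def)
next
  case False
  then have pos: "ell2_norm f > 0" by (simp add: order_less_le)
  obtain K where K: "\<And>f. f \<in> ell2 \<Longrightarrow> ell2_norm (\<pi> a f) \<le> K * ell2_norm f"
    using rep_op_bound[of a] by blast
  let ?c = "complex_of_real (1 / ell2_norm f)"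
  let ?g = "\<lambda>i. ?c * f i"
  have g: "?g \<in> ell2" "ell2_norm ?g = 1"
    using pos by (auto intro: ell2_scale[OF f] simp: ell2_norm_scale norm_divide simp del: of_real_divide)
  have "ell2_norm (\<pi> a ?g) \<le> ell2_onorm (\<pi> a)"
    unfolding ell2_onorm_def
  proof (rule cSUP_upper)
    show "bdd_above ((\<lambda>f. ell2_norm (\<pi> a f)) ` {f \<in> ell2. ell2_norm f \<le> 1})"
    proof (rule bdd_aboveI2)
      fix f :: "'i \<Rightarrow> complex" assume "f \<in> {f \<in> ell2. ell2_norm f \<le> 1}"
      then have f: "f \<in> ell2" "ell2_norm f \<le> 1" by auto
      have "K * ell2_norm f \<le> \<bar>K\<bar> * 1"
        using f by (intro mult_mono) auto
      then show "ell2_norm (\<pi> a f) \<le> \<bar>K\<bar>" using K[OF f(1)] by linarith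
    qed
  qed (use g in auto)
  then have "(1 / ell2_norm f) * ell2_norm (\<pi> a f) \<le> norm a"
    using pos unfolding rep_onorm rep_scale_vector[OF f] ell2_norm_scale by (simp add: norm_divide)
  then show ?thesis using pos by (simp add: field_simps)
qed

text \<open>The vector functional a \<mapsto> <f, \<pi>(a) g>. These functionals separate points and
  recover the norm, the role usually given to Hahn-Banach.\<close>

definition vf :: "('i \<Rightarrow> complex) \<Rightarrow> ('i \<Rightarrow> complex) \<Rightarrow> 'a \<Rightarrow> complex" where
  "vf f g a = ell2_inner f (\<pi> a g)"

lemma cmod_vf_le: "f \<in> ell2 \<Longrightarrow> g \<in> ell2 \<Longrightarrow> cmod (vf f g a) \<le> ell2_norm f * ell2_norm g * norm a"
  unfolding vf_def
  using ell2_cauchy_schwarz[of f "\<pi> a g"] mult_left_mono[OF rep_norm_le[of g a] ell2_norm_nonneg[of f]]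
  by (simp add: ell2_rep mult_ac)

lemma bclinear_vf: "f \<in> ell2 \<Longrightarrow> g \<in> ell2 \<Longrightarrow> bclinear (vf f g)"
  by (rule bclinearI[where K = "ell2_norm f * ell2_norm g"])
    (auto simp: cmod_vf_le, auto simp: vf_def rep_add rep_scaleC ell2_inner_add_right ell2_rep
      ell2_inner_scale_right scaleC_complex_def)

lemma vf_star: "f \<in> ell2 \<Longrightarrow> g \<in> ell2 \<Longrightarrow> vf f g (star a) = cnj (vf g f a)"
  unfolding vf_def by (metis ell2_inner_commute rep_star)

lemma vf_star_mult: "f \<in> ell2 \<Longrightarrow> g \<in> ell2 \<Longrightarrow> vf f g (star a * b) = ell2_inner (\<pi> a f) (\<pi> b g)"
  unfolding vf_def using rep_star[of f "\<pi> b g" "star a"] by (simp add: rep_mult ell2_rep star_star)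

lemma vf_one: "g \<in> ell2 \<Longrightarrow> vf f g 1 = ell2_inner f g"
  unfolding vf_def by (simp add: rep_one)

text \<open>Testing with f = \<pi>(a) g turns the bound into (norm \<pi>(a) g)^2 \<le> K norm g norm
  \<pi>(a) g.\<close>

lemma norm_le_if_vf_le:
  assumes "\<And>f g. f \<in> ell2 \<Longrightarrow> g \<in> ell2 \<Longrightarrow> cmod (vf f g a) \<le> K * ell2_norm f * ell2_norm g"
    and K: "K \<ge> 0"
  shows "norm a \<le> K"
proof -
  have "ell2_norm (\<pi> a g) \<le> K" if g: "g \<in> ell2" "ell2_norm g \<le> 1" for g
  proof (cases "ell2_norm (\<pi> a g) = 0")
    case False
    have "cmod (vf (\<pi> a g) g a) = (ell2_norm (\<pi> a g))\<^sup>2"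
      by (simp add: vf_def ell2_inner_self norm_power)
    then have "ell2_norm (\<pi> a g) * ell2_norm (\<pi> a g) \<le> (K * ell2_norm g) * ell2_norm (\<pi> a g)"
      using assms(1)[of "\<pi> a g" g] g by (simp add: ell2_rep power2_eq_square mult_ac)
    then have "ell2_norm (\<pi> a g) \<le> K * ell2_norm g"
      by (rule mult_right_le_imp_le) (use False ell2_norm_nonneg[of "\<pi> a g"] in linarith)
    also have "\<dots> \<le> K" using mult_left_mono[OF g(2) K] by simp
    finally show ?thesis .
  qed (use K in simp)
  then have "ell2_onorm (\<pi> a) \<le> K"
    unfolding ell2_onorm_def
    by (intro cSUP_least) (auto intro!: exI[of _ "\<lambda>i. 0"] simp: ell2_zero ell2_norm_def)
  then show ?thesis by (simp add: rep_onorm)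
qed

lemma eq_0_if_vf_eq_0:
  assumes "\<And>f g. f \<in> ell2 \<Longrightarrow> g \<in> ell2 \<Longrightarrow> vf f g a = 0"
  shows "a = 0"
  using norm_le_if_vf_le[of a 0] assms by simp

lemma functionals_separate:
  assumes "\<And>\<phi> :: 'a \<Rightarrow> complex. bclinear \<phi> \<Longrightarrow> \<phi> a = \<phi> b"
  shows "a = b"
proof -
  have "a - b = 0"
    by (rule eq_0_if_vf_eq_0) (simp add: bclinearD(3)[OF bclinear_vf] assms[OF bclinear_vf])
  then show ?thesis by simp
qed

text \<open>The step from basis vectors to all vectors goes through the adjoint: the l-th coordinate
  of \<pi>(star a) f is conjugate to <f, \<pi>(a) e> for the l-th basis vector e, which is
  0.\<close>

lemma eq_0_if_basis_eq_0:
  assumes "\<And>k l. vf (ell2_basis k) (ell2_basis l) a = 0"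
  shows "a = 0"
proof -
  have a: "\<pi> a (ell2_basis l) = (\<lambda>i. 0)" for l
    using assms by (auto simp: vf_def ell2_inner_basis)
  have "\<pi> (star a) f l = 0" if "f \<in> ell2" for f l
    using vf_star[OF ell2_basis[of l] that, of a] a[of l]
    unfolding vf_def ell2_inner_basis by (simp add: ell2_inner_def)
  then have "vf f g (star a) = 0" if "f \<in> ell2" "g \<in> ell2" for f g
    using that by (simp add: vf_def ell2_inner_def)
  then have "star a = 0" by (rule eq_0_if_vf_eq_0)
  then show ?thesis using star_star[of a] by simp
qed

text \<open>The quadratic form q of T = 1 - star a a lies between 0 and (norm h)^2, and
  Cauchy-Schwarz for q bounds the off-diagonal values <f, T g>.\<close>

lemma norm_one_minus_star_mult_self:
  fixes a :: 'a
  assumes "norm a \<le> 1"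
  shows "norm (1 - star a * a) \<le> 1"
proof (rule norm_le_if_vf_le)
  let ?T = "1 - star a * a"
  fix f g :: "'i \<Rightarrow> complex" assume f: "f \<in> ell2" and g: "g \<in> ell2"
  define q where "q h = (ell2_norm h)\<^sup>2 - (ell2_norm (\<pi> a h))\<^sup>2" for h
  have q0: "0 \<le> q h" and q1: "q h \<le> (ell2_norm h)\<^sup>2" if "h \<in> ell2" for h
  proof -
    have "ell2_norm (\<pi> a h) \<le> 1 * ell2_norm h"
      using rep_norm_le[OF that, of a] mult_right_mono[OF assms, of "ell2_norm h"] by simp
    then show "0 \<le> q h" unfolding q_def by (simp add: power_mono)
  qed (simp add: q_def)
  have vq: "vf h h ?T = complex_of_real (q h)" if "h \<in> ell2" for h
    using that by (simp add: bclinearD(3)[OF bclinear_vf] vf_one vf_star_mult ell2_inner_self q_def)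
  have "(cmod (vf f g ?T))\<^sup>2 \<le> q f * q g"
  proof (rule cauchy_schwarz_scalar)
    fix z
    let ?h = "\<lambda>i. f i + z * g i"
    note zg = ell2_scale[OF g, of z]
    have h: "?h \<in> ell2" by (rule ell2_add[OF f zg])
    have "vf ?h ?h ?T = vf f f ?T + z * vf f g ?T + cnj z * vf g f ?T + (z * cnj z) * vf g g ?T"
      using f g zg unfolding vf_def
      by (simp add: rep_add_vector rep_scale_vector ell2_inner_add_left ell2_inner_add_right ell2_add
          ell2_inner_scale_left ell2_inner_scale_right ell2_rep ell2_scale algebra_simps)
    moreover have "vf g f ?T = cnj (vf f g ?T)"
      using vf_star[OF g f, of ?T] by (simp add: star_diff star_mult star_star)
    ultimately have "complex_of_real (q ?h) = complex_of_real (q f)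
        + (z * vf f g ?T + cnj (z * vf f g ?T)) + complex_of_real ((cmod z)\<^sup>2 * q g)"
      by (simp only: vq f g h of_real_mult complex_norm_square[of z] complex_cnj_mult add.assoc)
    also have "\<dots> = complex_of_real (q f + 2 * Re (z * vf f g ?T) + (cmod z)\<^sup>2 * q g)"
      by (simp only: complex_add_cnj of_real_add)
    finally show "0 \<le> q f + 2 * Re (z * vf f g ?T) + (cmod z)\<^sup>2 * q g"
      using q0[OF h] by (simp only: of_real_eq_iff)
  qed (rule q0[OF g])
  also have "\<dots> \<le> (ell2_norm f)\<^sup>2 * (ell2_norm g)\<^sup>2"
    using q0 q1 f g by (intro mult_mono) auto
  finally show "cmod (vf f g ?T) \<le> 1 * ell2_norm f * ell2_norm g"
    by (simp add: power_mult_distrib[symmetric] abs_le_square_iff[symmetric] abs_mult)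
qed simp

lemma norm_le_1_if_sum_squares_eq_1:
  fixes p q :: 'a
  assumes "star p * p + star q * q = 1"
  shows "norm p \<le> 1"
proof -
  have "ell2_norm (\<pi> p g) \<le> ell2_norm g" if g: "g \<in> ell2" for g
  proof -
    have "vf g g (star p * p) + vf g g (star q * q) = vf g g 1"
      using g by (simp add: bclinearD(2)[OF bclinear_vf, symmetric] assms)
    then have "complex_of_real ((ell2_norm (\<pi> p g))\<^sup>2 + (ell2_norm (\<pi> q g))\<^sup>2)
        = complex_of_real ((ell2_norm g)\<^sup>2)"
      using g by (simp add: vf_star_mult vf_one ell2_inner_self)
    then have "(ell2_norm (\<pi> p g))\<^sup>2 \<le> (ell2_norm g)\<^sup>2"
      by (simp only: of_real_eq_iff) (metis le_add_same_cancel1 zero_le_power2)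
    then show ?thesis by simp
  qed
  then have "cmod (vf f g p) \<le> 1 * ell2_norm f * ell2_norm g" if "f \<in> ell2" "g \<in> ell2" for f g
    unfolding vf_def using that
    by (auto intro!: order_trans[OF ell2_cauchy_schwarz] mult_left_mono simp: ell2_rep)
  then show ?thesis by (rule norm_le_if_vf_le[OF _ zero_le_one])
qed

text \<open>With w = s - star a a the hypothesis says norm (1 - w) \<le> 1, which forces w to be
  positive: evaluating at g gives (1 - s)(norm g)^2 + (norm \<pi>(a) g)^2 \<le> (norm g)^2.\<close>

lemma norm_sq_le_if_shift_contractive:
  fixes a :: 'a
  assumes "norm ((1 - s) *\<^sub>R 1 + star a * a) \<le> 1" "s \<ge> 0"
  shows "(norm a)\<^sup>2 \<le> s"
proof -
  have "ell2_norm (\<pi> a g) \<le> sqrt s * ell2_norm g" if g: "g \<in> ell2" for g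
  proof -
    have "vf g g ((1 - s) *\<^sub>R 1 + star a * a) = complex_of_real ((1 - s) * (ell2_norm g)\<^sup>2 + (ell2_norm (\<pi> a g))\<^sup>2)"
      using g by (simp add: bclinearD(2,6)[OF bclinear_vf] vf_one vf_star_mult ell2_inner_self
          scaleR_conv_of_real[where 'a = complex])
    moreover have "cmod (vf g g ((1 - s) *\<^sub>R 1 + star a * a)) \<le> ell2_norm g * ell2_norm g * 1"
      by (rule order_trans[OF cmod_vf_le[OF g g]]) (intro mult_left_mono assms, simp)
    ultimately have "(1 - s) * (ell2_norm g)\<^sup>2 + (ell2_norm (\<pi> a g))\<^sup>2 \<le> (ell2_norm g)\<^sup>2"
      by (simp only: norm_of_real) (simp add: power2_eq_square)
    then have "(ell2_norm (\<pi> a g))\<^sup>2 \<le> (sqrt s * ell2_norm g)\<^sup>2"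
      using assms(2) by (simp add: power_mult_distrib algebra_simps)
    then show ?thesis using assms(2) by (simp add: abs_le_square_iff[symmetric])
  qed
  then have "cmod (vf f g a) \<le> sqrt s * ell2_norm f * ell2_norm g" if "f \<in> ell2" "g \<in> ell2" for f g
    unfolding vf_def using that
    by (auto intro!: order_trans[OF ell2_cauchy_schwarz] simp: ell2_rep mult.assoc mult.left_commute[of "sqrt s"] mult_left_mono)
  then have "norm a \<le> sqrt s" by (rule norm_le_if_vf_le[OF _ real_sqrt_ge_zero[OF assms(2)]])
  then show ?thesis using assms(2) by (metis norm_ge_zero power_mono real_sqrt_pow2)
qed

text \<open>If \<open>norm a < 1\<close> is self-adjoint then \<open>1 - a\<^sup>2 = c\<^sup>2\<close> with \<open>c\<close> self-adjoint, an identity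
  that \<open>F\<close> preserves.\<close>

lemma star_hom_contractive:
  fixes F :: "'d::cstar_algebra \<Rightarrow> 'a"
  assumes F: "star_hom F"
  shows "norm (F x) \<le> norm x"
proof -
  have sa: "norm (F a) \<le> 1" if a: "star a = a" "norm a \<le> 1" for a
  proof -
    have n: "norm (a * a) \<le> 1"
      using order_trans[OF norm_mult_ineq mult_mono[OF a(2) a(2)]] by simp
    define c where "c = 1 - sqrt_lim (a * a)"
    have c: "star c = c" "c * c = 1 - a * a"
      unfolding c_def using star_sqrt_lim[OF n] sqrt_lim_square[OF n]
      by (simp_all add: star_diff star_mult a)
    have "F a * F a + F c * F c = F (a * a + c * c)"
      by (simp add: star_homD[OF F])
    then have "star (F a) * F a + star (F c) * F c = 1"
      by (simp add: c a star_homD[OF F] flip: star_homD(4)[OF F])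
    then show ?thesis by (rule norm_le_1_if_sum_squares_eq_1)
  qed
  have sa': "norm (F a) \<le> norm a" if a: "star a = a" for a
  proof (cases "norm a = 0")
    case False
    have "norm (F ((1 / norm a) *\<^sub>R a)) \<le> 1"
      using False a by (intro sa) (simp_all add: star_scaleR)
    then show ?thesis using False by (simp add: star_homD[OF F] field_simps)
  qed (simp add: star_homD[OF F])
  \<comment> \<open>The C*-identity reduces the general case to the self-adjoint star x x.\<close>
  have "(norm (F x))\<^sup>2 = norm (F (star x * x))"
    by (simp add: star_homD[OF F] norm_star_mult_self)
  also have "\<dots> \<le> (norm x)\<^sup>2"
    using sa'[of "star x * x"] by (simp add: star_mult star_star norm_star_mult_self)
  finally show ?thesis by simp
qed

lemma bclinear_star_hom:
  fixes F :: "'d::cstar_algebra \<Rightarrow> 'a"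
  shows "star_hom F \<Longrightarrow> bclinear F"
  by (rule bclinearI[where K = 1]) (simp_all add: star_homD star_hom_contractive)

end

text \<open>If \<open>norm (F a)\<^sup>2 < s < norm a\<^sup>2 = 1\<close>, then \<open>w = s - a\<^sup>* a\<close> has positive image, so \<open>F\<close>
  maps \<open>\<bar>w\<bar> - w\<close> to \<open>0\<close>; injectivity makes \<open>w\<close> positive, that is \<open>norm a\<^sup>2 \<le> s\<close>.\<close>

lemma star_hom_isometric:
  fixes F :: "'d::cstar_algebra \<Rightarrow> 'e::cstar_algebra"
    and \<pi> :: "'d \<Rightarrow> ('i \<Rightarrow> complex) \<Rightarrow> ('i \<Rightarrow> complex)"
    and \<sigma> :: "'e \<Rightarrow> ('j \<Rightarrow> complex) \<Rightarrow> ('j \<Rightarrow> complex)"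
  assumes "faithful_rep \<pi>" "faithful_rep \<sigma>" and F: "star_hom F" and inj: "inj F"
  shows "norm (F x) = norm x"
proof -
  interpret D: rep \<pi> by standard fact
  interpret E: rep \<sigma> by standard fact
  have F_bl: "bounded_linear F" using E.bclinear_star_hom[OF F] by (rule bclinearD)
  have unit: "norm (F a) \<ge> 1" if a: "norm a = 1" for a
  proof (rule ccontr)
    assume "\<not> 1 \<le> norm (F a)"
    then have lt: "(norm (F a))\<^sup>2 < 1" by (simp add: power_less_one_iff)
    then obtain s where s: "(norm (F a))\<^sup>2 < s" "s < 1" using dense by blast
    then have s0: "s > 0" by (meson le_less_trans zero_le_power2)
    define w where "w = s *\<^sub>R 1 - star a * a"
    have sw: "star w = w" by (simp add: w_def star_diff star_scaleR star_mult star_star)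
    have nw: "norm w \<le> 1"
    proof -
      \<comment> \<open>A convex combination of the contractions 1 - star a a and - star a
        a.\<close>
      have "w = s *\<^sub>R (1 - star a * a) + (1 - s) *\<^sub>R (- (star a * a))"
        by (simp add: w_def algebra_simps)
      also have "norm \<dots> \<le> s * 1 + (1 - s) * 1"
        using s s0 D.norm_one_minus_star_mult_self[of a] a
        by (intro order_trans[OF norm_triangle_ineq] add_mono)
          (simp_all add: norm_star_mult_self mult_left_le)
      finally show ?thesis by simp
    qed
    \<comment> \<open>Thus 1 - \<open>sqrt_lim x\<close> is the absolute value of w. On the image
      side norm (1 - F w) < 1, so uniqueness identifies F w as its own absolute value.\<close>
    define x where "x = 1 - w * w"
    have nx: "norm x \<le> 1"
      using D.norm_one_minus_star_mult_self[OF nw] by (simp add: x_def sw)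
    have nFx: "norm (F x) \<le> 1"
      using E.star_hom_contractive[OF F, of x] nx by simp
    have "1 - F w = (1 - s) *\<^sub>R 1 + star (F a) * F a"
      by (simp add: w_def star_homD[OF F] algebra_simps)
    also have "norm \<dots> \<le> (1 - s) + (norm (F a))\<^sup>2"
      using s norm_triangle_ineq[of "(1 - s) *\<^sub>R 1" "star (F a) * F a"] by (simp add: norm_star_mult_self)
    finally have k: "norm (1 - F w) < 1" using s by linarith
    have lim: "sqrt_lim (F x) = 1 - F w"
      by (rule sqrt_lim_unique[OF nFx k]) (simp add: x_def star_homD[OF F])
    have "(\<lambda>n. sqrt_iter (F x) n) \<longlonglongrightarrow> F (sqrt_lim x)"
      using bounded_linear.tendsto[OF F_bl sqrt_lim_tendsto[OF nx]] by (simp add: star_hom_sqrt_iter[OF F])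
    then have "F (sqrt_lim x) = 1 - F w"
      using sqrt_lim_tendsto[OF nFx] lim LIMSEQ_unique by metis
    also have "\<dots> = F (1 - w)" by (simp add: star_homD[OF F])
    finally have "sqrt_lim x = 1 - w" using inj by (simp add: inj_eq)
    then have "norm (1 - w) \<le> 1" using norm_sqrt_lim[OF nx] by simp
    then have "(norm a)\<^sup>2 \<le> s"
      by (intro D.norm_sq_le_if_shift_contractive) (use s0 in \<open>simp_all add: w_def algebra_simps\<close>)
    then show False using a s by simp
  qed
  have "norm (F x) \<ge> norm x"
  proof (cases "norm x = 0")
    case False
    have "norm (F ((1 / norm x) *\<^sub>R x)) \<ge> 1"
      using False by (intro unit) simp
    then show ?thesis using False by (simp add: star_homD[OF F] field_simps)
  qed simp
  then show ?thesis using E.star_hom_contractive[OF F, of x] by simp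
qed

section \<open>States\<close>

text \<open>Unital and of norm at most 1, rather than positive: these conditions visibly pass to
  pointwise limits and to tensor products. Positivity is recovered in
  \<open>state_nonneg\<close>.\<close>

definition state :: "('a::cstar_algebra \<Rightarrow> complex) \<Rightarrow> bool" where
  "state \<phi> \<longleftrightarrow> bclinear \<phi> \<and> \<phi> 1 = 1 \<and> (\<forall>x. cmod (\<phi> x) \<le> norm x)"

lemma stateD:
  assumes "state \<phi>"
  shows "bclinear \<phi>" "\<phi> 1 = 1" "cmod (\<phi> x) \<le> norm x"
  using assms by (auto simp: state_def)

text \<open>Put b = a + i s. Then (norm b)^2 \<le> (norm a)^2 + s^2, whereas (Im (\<phi> b))^2
  contains the mixed term 2 s Im (\<phi> a); \<open>s\<close> is chosen to make that term (norm a)^2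
  + 1, which is too large.\<close>

lemma state_real:
  assumes "state \<phi>" "star a = a"
  shows "Im (\<phi> a) = 0"
proof (rule ccontr)
  assume nz: "Im (\<phi> a) \<noteq> 0"
  define s where "s = ((norm a)\<^sup>2 + 1) / (2 * Im (\<phi> a))"
  define b where "b = a + (\<i> * s) *\<^sub>C 1"
  have b: "star b * b = a * a + s\<^sup>2 *\<^sub>R 1"
    by (simp add: b_def star_add star_scaleC assms(2) algebra_simps mult_scaleC_left
        mult_scaleC_right scaleC_scaleC scaleC_minus_left scaleC_diff_right scaleR_scaleC power2_eq_square)
  have "(Im (\<phi> a) + s)\<^sup>2 = (Im (\<phi> b))\<^sup>2"
    using stateD(2)[OF assms(1)]
    by (simp add: b_def bclinearD(2)[OF stateD(1)[OF assms(1)]]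
        bclinear_scaleC_complex[OF stateD(1)[OF assms(1)]])
  also have "\<dots> \<le> (cmod (\<phi> b))\<^sup>2"
    using abs_Im_le_cmod[of "\<phi> b"] by (simp add: abs_le_square_iff[symmetric])
  also have "\<dots> \<le> (norm b)\<^sup>2"
    by (intro power_mono stateD(3)[OF assms(1)]) simp
  also have "\<dots> \<le> norm (a * a) + norm (s\<^sup>2 *\<^sub>R (1::'a))"
    unfolding norm_star_mult_self[symmetric] b by (rule norm_triangle_ineq)
  also have "\<dots> \<le> (norm a)\<^sup>2 + s\<^sup>2"
    using norm_mult_ineq[of a a] by (simp add: power2_eq_square)
  finally have "(Im (\<phi> a))\<^sup>2 + 2 * Im (\<phi> a) * s \<le> (norm a)\<^sup>2"
    by (simp add: power2_sum)
  moreover have "2 * Im (\<phi> a) * s = (norm a)\<^sup>2 + 1" using nz by (simp add: s_def)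
  ultimately show False using zero_le_power2[of "Im (\<phi> a)"] by linarith
qed

lemma state_star:
  assumes "state \<phi>"
  shows "\<phi> (star a) = cnj (\<phi> a)"
proof (rule complex_eqI)
  note b = stateD(1)[OF assms]
  have "Im (\<phi> (\<i> *\<^sub>C a + star (\<i> *\<^sub>C a))) = 0"
    by (rule state_real[OF assms]) (simp add: star_add star_star add.commute)
  then show "Re (\<phi> (star a)) = Re (cnj (\<phi> a))"
    by (simp add: star_scaleC bclinearD(2)[OF b] bclinear_scaleC_complex[OF b])
  have "Im (\<phi> (a + star a)) = 0"
    by (rule state_real[OF assms]) (simp add: star_add star_star add.commute)
  then show "Im (\<phi> (star a)) = Im (cnj (\<phi> a))"
    by (simp add: bclinearD(2)[OF b])
qed

context rep
begin

text \<open>For norm a = 1, 1 - star a a is a contraction, so \<phi>(star a a) lies within distance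
  1 of 1.\<close>

lemma state_nonneg:
  fixes a :: 'a
  assumes "state \<phi>"
  shows "0 \<le> Re (\<phi> (star a * a))"
proof (cases "a = 0")
  case True
  then show ?thesis using bclinearD(7)[OF stateD(1)[OF assms]] by simp
next
  case False
  note b = stateD(1)[OF assms]
  let ?a = "(1 / norm a) *\<^sub>R a"
  have "cmod (\<phi> (1 - star ?a * ?a)) \<le> 1"
    using False by (intro order_trans[OF stateD(3)[OF assms] norm_one_minus_star_mult_self[of ?a]]) simp
  then have "cmod (1 - \<phi> (star ?a * ?a)) \<le> 1"
    using stateD(2)[OF assms] by (simp add: bclinearD(3)[OF b])
  then have "0 \<le> Re (\<phi> (star ?a * ?a))"
    using complex_Re_le_cmod[of "1 - \<phi> (star ?a * ?a)"] by simp
  moreover have "star ?a * ?a = (1 / (norm a)\<^sup>2) *\<^sub>R (star a * a)"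
    by (simp add: star_scaleR power2_eq_square)
  ultimately have "0 \<le> (1 / (norm a)\<^sup>2) * Re (\<phi> (star a * a))"
    by (simp only: bclinearD(6)[OF b] scaleR_complex.sel)
  then show ?thesis using False by (simp add: zero_le_divide_iff)
qed

text \<open>Cauchy-Schwarz for the form (d, x) \<mapsto> \<phi>(star d x), with d = star c.\<close>

lemma state_null:
  fixes c x :: 'a
  assumes "state \<phi>" "Re (\<phi> (star x * x)) = 0"
  shows "\<phi> (c * x) = 0"
proof -
  note b = stateD(1)[OF assms(1)]
  define d where "d = star c"
  have "(cmod (\<phi> (star d * x)))\<^sup>2 \<le> Re (\<phi> (star d * d)) * 0"
  proof (rule cauchy_schwarz_scalar)
    fix z
    have "star (d + z *\<^sub>C x) * (d + z *\<^sub>C x) =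
        star d * d + (z *\<^sub>C (star d * x) + star (z *\<^sub>C (star d * x))) + (z * cnj z) *\<^sub>C (star x * x)"
      by (simp add: star_add star_mult star_star star_scaleC algebra_simps mult_scaleC_left
          mult_scaleC_right scaleC_scaleC scaleC_add_right)
    then have "\<phi> (star (d + z *\<^sub>C x) * (d + z *\<^sub>C x)) = \<phi> (star d * d)
        + (z * \<phi> (star d * x) + cnj (z * \<phi> (star d * x))) + complex_of_real ((cmod z)\<^sup>2) * \<phi> (star x * x)"
      by (simp only: bclinearD(2)[OF b] bclinear_scaleC_complex[OF b] state_star[OF assms(1)]
          complex_norm_square)
    then have "Re (\<phi> (star (d + z *\<^sub>C x) * (d + z *\<^sub>C x))) = Re (\<phi> (star d * d)) + 2 * Re (z * \<phi> (star d * x))"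
      using assms(2) by simp
    then show "0 \<le> Re (\<phi> (star d * d)) + 2 * Re (z * \<phi> (star d * x)) + (cmod z)\<^sup>2 * 0"
      using state_nonneg[OF assms(1)] by (metis add.right_neutral mult_zero_right)
  qed simp
  then show ?thesis by (simp add: d_def star_star)
qed

end

section \<open>Slice maps of the minimal tensor product\<close>

lemma bclinear_sum_list:
  "bclinear f \<Longrightarrow> f (\<Sum>x\<leftarrow>xs. g x) = (\<Sum>x\<leftarrow>xs. f (g x))"
  by (induction xs) (simp_all add: bclinearD)

text \<open>E is the map whose graph is the closure of G, the pairs of sums of t and of s over one
  and the same finite list. The bound on lists makes the closed graph single-valued, so it is never
  necessary to define a map on the span and check independence of the representation.\<close>

lemma bclinear_extension:
  fixes t :: "'a::cstar_algebra \<Rightarrow> 'b::cstar_algebra \<Rightarrow> 'c::cstar_algebra"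
    and s :: "'a \<Rightarrow> 'b \<Rightarrow> 'd::cstar_algebra"
  assumes dense: "closure (span {t a b | a b. True}) = UNIV"
    and t: "\<And>c a b. t (c *\<^sub>C a) b = c *\<^sub>C t a b"
    and s: "\<And>c a b. s (c *\<^sub>C a) b = c *\<^sub>C s a b"
    and bound: "\<And>xs. norm (\<Sum>(a, b)\<leftarrow>xs. s a b) \<le> K * norm (\<Sum>(a, b)\<leftarrow>xs. t a b)"
  shows "\<exists>E. bclinear E \<and> (\<forall>a b. E (t a b) = s a b) \<and> (\<forall>X. norm (E X) \<le> K * norm X)"
proof -
  define G where "G = {((\<Sum>(a, b)\<leftarrow>xs. t a b), (\<Sum>(a, b)\<leftarrow>xs. s a b)) | xs. True}"
  have G_add: "p + q \<in> G" if pq: "p \<in> G" "q \<in> G" for p q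
  proof -
    obtain xs ys where "p = ((\<Sum>(a, b)\<leftarrow>xs. t a b), (\<Sum>(a, b)\<leftarrow>xs. s a b))"
      "q = ((\<Sum>(a, b)\<leftarrow>ys. t a b), (\<Sum>(a, b)\<leftarrow>ys. s a b))"
      using pq unfolding G_def by blast
    then show ?thesis unfolding G_def by (auto intro!: exI[of _ "xs @ ys"])
  qed
  have G_scale: "(c *\<^sub>C X, c *\<^sub>C Y) \<in> G" if XY: "(X, Y) \<in> G" for c X Y
  proof -
    obtain xs where "X = (\<Sum>(a, b)\<leftarrow>xs. t a b)" "Y = (\<Sum>(a, b)\<leftarrow>xs. s a b)"
      using XY unfolding G_def by blast
    moreover have "c *\<^sub>C (\<Sum>(a, b)\<leftarrow>xs. t a b) = (\<Sum>(a, b)\<leftarrow>map (\<lambda>(a, b). (c *\<^sub>C a, b)) xs. t a b)"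
      "c *\<^sub>C (\<Sum>(a, b)\<leftarrow>xs. s a b) = (\<Sum>(a, b)\<leftarrow>map (\<lambda>(a, b). (c *\<^sub>C a, b)) xs. s a b)"
      by (induction xs) (auto simp: scaleC_add_right t s)
    ultimately show ?thesis unfolding G_def by blast
  qed
  have G_scaleR: "r *\<^sub>R p \<in> G" if "p \<in> G" for r p
    using G_scale[of "fst p" "snd p" "complex_of_real r"] that
    by (simp add: scaleC_of_real scaleR_prod_def)
  have G_t: "(t a b, s a b) \<in> G" for a b
    unfolding G_def by (auto intro!: exI[of _ "[(a, b)]"])
  have G_diff: "p - q \<in> G" if "p \<in> G" "q \<in> G" for p q
    using G_add[OF that(1) G_scaleR[OF that(2), of "-1"]] by simp
  have G_bound: "norm (snd p) \<le> K * norm (fst p)" if "p \<in> G" for p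
    using that bound unfolding G_def by auto
  have cl_add: "(X + X', Y + Y') \<in> closure G" if XY: "(X, Y) \<in> closure G" "(X', Y') \<in> closure G" for X Y X' Y'
  proof -
    obtain x y where "\<And>n. x n \<in> G" "x \<longlonglongrightarrow> (X, Y)" "\<And>n. y n \<in> G" "y \<longlonglongrightarrow> (X', Y')"
      using XY unfolding closure_sequential by blast
    then show ?thesis unfolding closure_sequential
      using G_add tendsto_add[of x "(X, Y)" sequentially y "(X', Y')"] by (intro exI[of _ "\<lambda>n. x n + y n"]) simp
  qed
  have cl_scale: "(c *\<^sub>C X, c *\<^sub>C Y) \<in> closure G" if XY: "(X, Y) \<in> closure G" for c X Y
  proof -
    obtain x where x: "\<And>n. x n \<in> G" "x \<longlonglongrightarrow> (X, Y)"
      using XY unfolding closure_sequential by blast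
    have "(\<lambda>n. (c *\<^sub>C fst (x n), c *\<^sub>C snd (x n))) \<longlonglongrightarrow> (c *\<^sub>C X, c *\<^sub>C Y)"
      using tendsto_fst[OF x(2)] tendsto_snd[OF x(2)]
      by (intro tendsto_Pair bounded_linear.tendsto[OF bounded_linear_scaleC]) auto
    then show ?thesis unfolding closure_sequential
      using G_scale x(1) by (intro exI[of _ "\<lambda>n. (c *\<^sub>C fst (x n), c *\<^sub>C snd (x n))"]) auto
  qed
  have cl_bound: "norm Y \<le> K * norm X" if "(X, Y) \<in> closure G" for X Y
  proof -
    have "closed {p :: 'c \<times> 'd. norm (snd p) \<le> K * norm (fst p)}"
      by (intro closed_Collect_le continuous_intros)
    then have "closure G \<subseteq> {p. norm (snd p) \<le> K * norm (fst p)}"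
      using G_bound by (intro closure_minimal) auto
    then show ?thesis using that by auto
  qed
  have ex: "\<exists>Y. (X, Y) \<in> closure G" for X
  proof -
    have "subspace (fst ` G)"
    proof (rule subspaceI)
      show "0 \<in> fst ` G" using G_scaleR[OF G_t, of 0 undefined undefined] by (force simp: zero_prod_def)
      show "x + y \<in> fst ` G" if "x \<in> fst ` G" "y \<in> fst ` G" for x y
        using that G_add by (metis (no_types, lifting) fst_add imageE imageI)
      show "r *\<^sub>R x \<in> fst ` G" if "x \<in> fst ` G" for r x
        using that G_scaleR by (metis (no_types, lifting) fst_scaleR imageE imageI)
    qed
    moreover have "{t a b | a b. True} \<subseteq> fst ` G" using G_t by force
    ultimately have "span {t a b | a b. True} \<subseteq> fst ` G" by (intro span_minimal)
    then have "closure (span {t a b | a b. True}) \<subseteq> closure (fst ` G)" by (rule closure_mono)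
    then have "X \<in> closure (fst ` G)" using dense by auto
    then obtain x where x: "\<And>n. x n \<in> fst ` G" "x \<longlonglongrightarrow> X" unfolding closure_sequential by blast
    then have "\<forall>n. \<exists>p. p \<in> G \<and> fst p = x n" by (metis imageE)
    then obtain p where p: "\<And>n. p n \<in> G" "\<And>n. fst (p n) = x n" by metis
    \<comment> \<open>K carries no sign, and the Cauchy estimate divides by the constant; hence
      \<bar>K\<bar> + 1.\<close>
    have K: "dist (snd (p m)) (snd (p n)) \<le> (\<bar>K\<bar> + 1) * dist (x m) (x n)" for m n
    proof -
      have "dist (snd (p m)) (snd (p n)) \<le> K * dist (x m) (x n)"
        using G_bound[OF G_diff[OF p(1)[of m] p(1)[of n]]] by (simp add: p(2) dist_norm)
      also have "\<dots> \<le> (\<bar>K\<bar> + 1) * dist (x m) (x n)" by (intro mult_right_mono) auto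
      finally show ?thesis .
    qed
    have "Cauchy (\<lambda>n. snd (p n))"
    proof (rule metric_CauchyI)
      fix e :: real assume "e > 0"
      then have "e / (\<bar>K\<bar> + 1) > 0" by simp
      then obtain M where M: "\<And>m n. m \<ge> M \<Longrightarrow> n \<ge> M \<Longrightarrow> dist (x m) (x n) < e / (\<bar>K\<bar> + 1)"
        using LIMSEQ_imp_Cauchy[OF x(2)] unfolding Cauchy_def by meson
      have "dist (snd (p m)) (snd (p n)) < e" if "m \<ge> M" "n \<ge> M" for m n
      proof -
        have "(\<bar>K\<bar> + 1) * dist (x m) (x n) < (\<bar>K\<bar> + 1) * (e / (\<bar>K\<bar> + 1))"
          using M[OF that] by (intro mult_strict_left_mono) auto
        then show ?thesis using K[of m n] by simp
      qed
      then show "\<exists>M. \<forall>m\<ge>M. \<forall>n\<ge>M. dist (snd (p m)) (snd (p n)) < e" by blast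
    qed
    then obtain Y where Y: "(\<lambda>n. snd (p n)) \<longlonglongrightarrow> Y"
      using Cauchy_convergent_iff convergent_def by blast
    have "(\<lambda>n. (x n, snd (p n))) \<longlonglongrightarrow> (X, Y)" using x(2) Y by (rule tendsto_Pair)
    moreover have "(x n, snd (p n)) \<in> G" for n using p[of n] by (metis prod.collapse)
    ultimately show ?thesis unfolding closure_sequential
      by (intro exI[of _ Y] exI[of _ "\<lambda>n. (x n, snd (p n))"]) auto
  qed
  have uniq: "Y = Y'" if "(X, Y) \<in> closure G" "(X, Y') \<in> closure G" for X Y Y'
  proof -
    have "(X + (-1) *\<^sub>C X, Y + (-1) *\<^sub>C Y') \<in> closure G"
      by (rule cl_add[OF that(1) cl_scale[OF that(2)]])
    then have "norm (Y - Y') \<le> K * norm (0::'c)"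
      using cl_bound[of "X + (-1) *\<^sub>C X" "Y + (-1) *\<^sub>C Y'"] by (simp add: scaleC_minus_left)
    then show ?thesis by simp
  qed
  obtain E where E: "\<And>X. (X, E X) \<in> closure G" using ex by metis
  have "bclinear E"
  proof (rule bclinearI)
    show "E (x + y) = E x + E y" for x y by (rule uniq[OF E cl_add[OF E E]])
    show "E (c *\<^sub>C x) = c *\<^sub>C E x" for c x by (rule uniq[OF E cl_scale[OF E]])
    show "norm (E x) \<le> K * norm x" for x by (rule cl_bound[OF E])
  qed
  moreover have "E (t a b) = s a b" for a b
    using uniq[OF E] G_t closure_subset by blast
  ultimately show ?thesis using cl_bound[OF E] by blast
qed

locale tensor =
  A: rep \<pi>\<^sub>1 + B: rep \<pi>\<^sub>2 + C: rep \<rho>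
  for \<pi>\<^sub>1 :: "'a::cstar_algebra \<Rightarrow> ('i \<Rightarrow> complex) \<Rightarrow> ('i \<Rightarrow> complex)"
    and \<pi>\<^sub>2 :: "'b::cstar_algebra \<Rightarrow> ('j \<Rightarrow> complex) \<Rightarrow> ('j \<Rightarrow> complex)"
    and \<rho> :: "'c::cstar_algebra \<Rightarrow> ('i \<times> 'j \<Rightarrow> complex) \<Rightarrow> ('i \<times> 'j \<Rightarrow> complex)" +
  fixes t :: "'a \<Rightarrow> 'b \<Rightarrow> 'c"
  assumes dense: "closure (span {t a b | a b. True}) = UNIV"
    and rep_t: "f \<in> ell2 \<Longrightarrow> g \<in> ell2 \<Longrightarrow>
      \<rho> (t a b) (ell2_tensor f g) = ell2_tensor (\<pi>\<^sub>1 a f) (\<pi>\<^sub>2 b g)"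
begin

lemma vf_tensor:
  assumes "f \<in> ell2" "g \<in> ell2" "f' \<in> ell2" "g' \<in> ell2"
  shows "C.vf (ell2_tensor f g) (ell2_tensor f' g') (t a b) = A.vf f f' a * B.vf g g' b"
  using assms unfolding C.vf_def A.vf_def B.vf_def
  by (simp add: rep_t ell2_inner_tensor A.ell2_rep B.ell2_rep)

text \<open>Basis vectors over the product index set are elementary tensors, so coefficients at
  elementary tensors decide equality. All algebraic laws of \<open>t\<close> follow from
  this.\<close>

lemma tensor_eqI:
  assumes "\<And>f g f' g'. f \<in> ell2 \<Longrightarrow> g \<in> ell2 \<Longrightarrow> f' \<in> ell2 \<Longrightarrow> g' \<in> ell2 \<Longrightarrow>
    C.vf (ell2_tensor f g) (ell2_tensor f' g') X = C.vf (ell2_tensor f g) (ell2_tensor f' g') Y"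
  shows "X = Y"
proof -
  have "X - Y = 0"
  proof (rule C.eq_0_if_basis_eq_0)
    fix k l :: "'i \<times> 'j"
    obtain i j i' j' where k: "k = (i, j)" "l = (i', j')" by (metis prod.collapse)
    show "C.vf (ell2_basis k) (ell2_basis l) (X - Y) = 0"
      using assms[of "ell2_basis i" "ell2_basis j" "ell2_basis i'" "ell2_basis j'"]
      by (simp add: k ell2_basis_tensor ell2_basis bclinearD(3)[OF C.bclinear_vf])
  qed
  then show ?thesis by simp
qed

lemma t_add_left: "t (a + a') b = t a b + t a' b"
  by (rule tensor_eqI) (simp add: vf_tensor ell2_tensor bclinearD(2)[OF C.bclinear_vf]
      bclinearD(2)[OF A.bclinear_vf] distrib_right)

lemma t_add_right: "t a (b + b') = t a b + t a b'"
  by (rule tensor_eqI) (simp add: vf_tensor ell2_tensor bclinearD(2)[OF C.bclinear_vf]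
      bclinearD(2)[OF B.bclinear_vf] distrib_left)

lemma t_scaleC_left: "t (c *\<^sub>C a) b = c *\<^sub>C t a b"
  by (rule tensor_eqI) (simp add: vf_tensor ell2_tensor bclinear_scaleC_complex[OF C.bclinear_vf]
      bclinear_scaleC_complex[OF A.bclinear_vf])

lemma t_scaleC_right: "t a (c *\<^sub>C b) = c *\<^sub>C t a b"
  by (rule tensor_eqI) (simp add: vf_tensor ell2_tensor bclinear_scaleC_complex[OF C.bclinear_vf]
      bclinear_scaleC_complex[OF B.bclinear_vf])

lemma t_mult: "t a b * t a' b' = t (a * a') (b * b')"
  by (rule tensor_eqI) (simp add: C.vf_def ell2_tensor rep_t C.rep_mult A.rep_mult B.rep_mult
      A.ell2_rep B.ell2_rep)

lemma t_one: "t 1 1 = 1"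
  by (rule tensor_eqI) (simp add: C.vf_def ell2_tensor rep_t C.rep_one A.rep_one B.rep_one)

lemma t_star: "star (t a b) = t (star a) (star b)"
  by (rule tensor_eqI) (simp add: C.vf_star A.vf_star B.vf_star ell2_tensor vf_tensor)

text \<open>a \<mapsto> a \<otimes> 1 and b \<mapsto> 1 \<otimes> b are unital star-homomorphisms,
  hence contractive, and a \<otimes> b is the product of their values.\<close>

lemma norm_t_le: "norm (t a b) \<le> norm a * norm b"
proof -
  have "star_hom (\<lambda>a. t a 1)" "star_hom (\<lambda>b. t 1 b)"
    by (simp_all add: star_hom_def t_add_left t_add_right t_scaleC_left t_scaleC_right t_mult t_one t_star)
  then have "norm (t a 1) \<le> norm a" "norm (t 1 b) \<le> norm b"
    using C.star_hom_contractive[of "\<lambda>a. t a 1"] C.star_hom_contractive[of "\<lambda>b. t 1 b"] by auto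
  then have "norm (t a 1 * t 1 b) \<le> norm a * norm b"
    by (intro order_trans[OF norm_mult_ineq] mult_mono) auto
  then show ?thesis by (simp add: t_mult)
qed

text \<open>A vector functional on the second leg turns the slice into \<phi>(Z), where Z is the
  slice of X by that functional. The vector coefficients of Z are coefficients of X at elementary
  tensors, so norm Z is controlled by norm X; this handles functionals \<phi> that are not vector
  functionals themselves.\<close>

lemma left_slice_bound:
  assumes \<phi>: "bclinear \<phi>" "\<And>a. cmod (\<phi> a) \<le> K * norm a" and K: "K \<ge> 0"
  shows "norm (\<Sum>(a, b)\<leftarrow>xs. \<phi> a *\<^sub>C b) \<le> K * norm (\<Sum>(a, b)\<leftarrow>xs. t a b)"
proof (rule B.norm_le_if_vf_le)
  let ?X = "\<Sum>(a, b)\<leftarrow>xs. t a b"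
  fix g g' :: "'j \<Rightarrow> complex" assume g: "g \<in> ell2" "g' \<in> ell2"
  define Z where "Z = (\<Sum>(a, b)\<leftarrow>xs. B.vf g g' b *\<^sub>C a)"
  have "norm Z \<le> ell2_norm g * ell2_norm g' * norm ?X"
  proof (rule A.norm_le_if_vf_le)
    fix f f' :: "'i \<Rightarrow> complex" assume f: "f \<in> ell2" "f' \<in> ell2"
    have "A.vf f f' Z = C.vf (ell2_tensor f g) (ell2_tensor f' g') ?X"
      using f g unfolding Z_def
      by (simp add: bclinear_sum_list[OF A.bclinear_vf] bclinear_sum_list[OF C.bclinear_vf] ell2_tensor
          case_prod_unfold vf_tensor bclinear_scaleC_complex[OF A.bclinear_vf] mult.commute)
    then show "cmod (A.vf f f' Z) \<le> ell2_norm g * ell2_norm g' * norm ?X * ell2_norm f * ell2_norm f'"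
      using C.cmod_vf_le[OF ell2_tensor[OF f(1) g(1)] ell2_tensor[OF f(2) g(2)], of ?X] f g
      by (simp add: ell2_norm_tensor mult_ac)
  qed simp
  moreover have "B.vf g g' (\<Sum>(a, b)\<leftarrow>xs. \<phi> a *\<^sub>C b) = \<phi> Z"
    using g \<phi>(1) unfolding Z_def
    by (simp add: bclinear_sum_list[OF B.bclinear_vf] bclinear_sum_list case_prod_unfold
        bclinear_scaleC_complex[OF B.bclinear_vf] bclinear_scaleC_complex mult.commute)
  moreover have "cmod (\<phi> Z) \<le> K * norm Z" by (rule \<phi>(2))
  moreover have "K * norm Z \<le> K * (ell2_norm g * ell2_norm g' * norm ?X)"
    by (rule mult_left_mono) fact+
  ultimately show "cmod (B.vf g g' (\<Sum>(a, b)\<leftarrow>xs. \<phi> a *\<^sub>C b)) \<le> K * norm ?X * ell2_norm g * ell2_norm g'"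
    by (simp add: mult_ac)
qed (use K in simp)

text \<open>The same exchange of legs, with the left bound applied to a vector functional.\<close>

lemma right_slice_bound:
  assumes \<psi>: "bclinear \<psi>" "\<And>b. cmod (\<psi> b) \<le> L * norm b" and L: "L \<ge> 0"
  shows "norm (\<Sum>(a, b)\<leftarrow>xs. \<psi> b *\<^sub>C a) \<le> L * norm (\<Sum>(a, b)\<leftarrow>xs. t a b)"
proof (rule A.norm_le_if_vf_le)
  let ?X = "\<Sum>(a, b)\<leftarrow>xs. t a b"
  fix f f' :: "'i \<Rightarrow> complex" assume f: "f \<in> ell2" "f' \<in> ell2"
  let ?Y = "\<Sum>(a, b)\<leftarrow>xs. A.vf f f' a *\<^sub>C b"
  have "norm ?Y \<le> ell2_norm f * ell2_norm f' * norm ?X"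
    by (rule left_slice_bound) (use f in \<open>auto intro: A.bclinear_vf A.cmod_vf_le\<close>)
  moreover have "A.vf f f' (\<Sum>(a, b)\<leftarrow>xs. \<psi> b *\<^sub>C a) = \<psi> ?Y"
    using f \<psi>(1)
    by (simp add: bclinear_sum_list[OF A.bclinear_vf] bclinear_sum_list case_prod_unfold
        bclinear_scaleC_complex[OF A.bclinear_vf] bclinear_scaleC_complex mult.commute)
  moreover have "cmod (\<psi> ?Y) \<le> L * norm ?Y" by (rule \<psi>(2))
  moreover have "L * norm ?Y \<le> L * (ell2_norm f * ell2_norm f' * norm ?X)"
    by (rule mult_left_mono) fact+
  ultimately show "cmod (A.vf f f' (\<Sum>(a, b)\<leftarrow>xs. \<psi> b *\<^sub>C a)) \<le> L * norm ?X * ell2_norm f * ell2_norm f'"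
    by (simp add: mult_ac)
qed (use L in simp)

lemma left_slice_exists:
  assumes \<phi>: "bclinear \<phi>" "\<And>a. cmod (\<phi> a) \<le> K * norm a" and K: "K \<ge> 0"
  shows "\<exists>E. bclinear E \<and> (\<forall>a b. E (t a b) = \<phi> a *\<^sub>C b) \<and> (\<forall>X. norm (E X) \<le> K * norm X)"
  by (rule bclinear_extension[OF dense])
    (auto simp: t_scaleC_left bclinear_scaleC_complex[OF \<phi>(1)] scaleC_scaleC
      intro: left_slice_bound[OF \<phi> K])

lemma right_slice_exists:
  assumes \<psi>: "bclinear \<psi>" "\<And>b. cmod (\<psi> b) \<le> L * norm b" and L: "L \<ge> 0"
  shows "\<exists>E. bclinear E \<and> (\<forall>a b. E (t a b) = \<psi> b *\<^sub>C a) \<and> (\<forall>X. norm (E X) \<le> L * norm X)"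
  by (rule bclinear_extension[OF dense])
    (auto simp: t_scaleC_left scaleC_scaleC mult.commute intro: right_slice_bound[OF \<psi> L])

end

lemma min_tensor_imp_tensor:
  fixes t :: "'a::cstar_algebra \<Rightarrow> 'b::cstar_algebra \<Rightarrow> 'c::cstar_algebra"
  assumes "min_tensor t"
  obtains \<pi>\<^sub>1 :: "'a \<Rightarrow> ('a \<Rightarrow> complex) \<Rightarrow> ('a \<Rightarrow> complex)"
    and \<pi>\<^sub>2 :: "'b \<Rightarrow> ('b \<Rightarrow> complex) \<Rightarrow> ('b \<Rightarrow> complex)" and \<rho> where "tensor \<pi>\<^sub>1 \<pi>\<^sub>2 \<rho> t"
  using assms unfolding min_tensor_def tensor_def rep_def tensor_axioms_def by (elim conjE exE) metis

text \<open>The slice map \<phi> \<otimes> id; \<open>rslice\<close> is id \<otimes> \<psi> and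
  \<open>tens\<close> is \<phi> \<otimes> \<psi>. The choice is determined, since elementary tensors
  span a dense subspace.\<close>

definition lslice :: "('a::cstar_algebra \<Rightarrow> 'b::cstar_algebra \<Rightarrow> 'c::cstar_algebra) \<Rightarrow> ('a \<Rightarrow> complex) \<Rightarrow> 'c \<Rightarrow> 'b"
  where "lslice t \<phi> = (SOME E. bclinear E \<and> (\<forall>a b. E (t a b) = \<phi> a *\<^sub>C b))"

definition rslice :: "('a::cstar_algebra \<Rightarrow> 'b::cstar_algebra \<Rightarrow> 'c::cstar_algebra) \<Rightarrow> ('b \<Rightarrow> complex) \<Rightarrow> 'c \<Rightarrow> 'a"
  where "rslice t \<psi> = (SOME E. bclinear E \<and> (\<forall>a b. E (t a b) = \<psi> b *\<^sub>C a))"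

definition tens :: "('a::cstar_algebra \<Rightarrow> 'b::cstar_algebra \<Rightarrow> 'c::cstar_algebra) \<Rightarrow>
    ('a \<Rightarrow> complex) \<Rightarrow> ('b \<Rightarrow> complex) \<Rightarrow> 'c \<Rightarrow> complex"
  where "tens t \<phi> \<psi> X = \<psi> (lslice t \<phi> X)"

lemma bclinear_bound:
  assumes "bclinear f"
  obtains K where "K \<ge> 0" "\<And>x. norm (f x) \<le> K * norm x"
  using bounded_linear.nonneg_bounded[OF bclinearD(1)[OF assms]] by (metis mult.commute)

context
  fixes t :: "'a::cstar_algebra \<Rightarrow> 'b::cstar_algebra \<Rightarrow> 'c::cstar_algebra"
  assumes t: "min_tensor t"
begin

lemma tensor_ext:
  assumes "bclinear \<Psi>" "bclinear \<Psi>'" "\<And>a b. \<Psi> (t a b) = \<Psi>' (t a b)"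
  shows "\<Psi> = \<Psi>'"
  by (rule bclinear_eq_on_dense_span[OF assms(1,2), where S = "{t a b | a b. True}"])
    (use t assms(3) in \<open>auto simp: min_tensor_def\<close>)

lemma lslice:
  assumes "bclinear \<phi>"
  shows "bclinear (lslice t \<phi>)" "lslice t \<phi> (t a b) = \<phi> a *\<^sub>C b"
proof -
  obtain \<pi>\<^sub>1 :: "'a \<Rightarrow> ('a \<Rightarrow> complex) \<Rightarrow> ('a \<Rightarrow> complex)"
    and \<pi>\<^sub>2 :: "'b \<Rightarrow> ('b \<Rightarrow> complex) \<Rightarrow> ('b \<Rightarrow> complex)" and \<rho> where "tensor \<pi>\<^sub>1 \<pi>\<^sub>2 \<rho> t"
    using t by (rule min_tensor_imp_tensor)
  then interpret tensor \<pi>\<^sub>1 \<pi>\<^sub>2 \<rho> t .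
  obtain K where "K \<ge> 0" "\<And>x. cmod (\<phi> x) \<le> K * norm x" using bclinear_bound[OF assms] by blast
  then have "\<exists>E. bclinear E \<and> (\<forall>a b. E (t a b) = \<phi> a *\<^sub>C b)"
    using left_slice_exists[OF assms] by blast
  from someI_ex[OF this] show "bclinear (lslice t \<phi>)" "lslice t \<phi> (t a b) = \<phi> a *\<^sub>C b"
    unfolding lslice_def by blast+
qed

lemma rslice:
  assumes "bclinear \<psi>"
  shows "bclinear (rslice t \<psi>)" "rslice t \<psi> (t a b) = \<psi> b *\<^sub>C a"
proof -
  obtain \<pi>\<^sub>1 :: "'a \<Rightarrow> ('a \<Rightarrow> complex) \<Rightarrow> ('a \<Rightarrow> complex)"
    and \<pi>\<^sub>2 :: "'b \<Rightarrow> ('b \<Rightarrow> complex) \<Rightarrow> ('b \<Rightarrow> complex)" and \<rho> where "tensor \<pi>\<^sub>1 \<pi>\<^sub>2 \<rho> t"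
    using t by (rule min_tensor_imp_tensor)
  then interpret tensor \<pi>\<^sub>1 \<pi>\<^sub>2 \<rho> t .
  obtain K where "K \<ge> 0" "\<And>x. cmod (\<psi> x) \<le> K * norm x" using bclinear_bound[OF assms] by blast
  then have "\<exists>E. bclinear E \<and> (\<forall>a b. E (t a b) = \<psi> b *\<^sub>C a)"
    using right_slice_exists[OF assms] by blast
  from someI_ex[OF this] show "bclinear (rslice t \<psi>)" "rslice t \<psi> (t a b) = \<psi> b *\<^sub>C a"
    unfolding rslice_def by blast+
qed

lemma bclinear_tens: "bclinear \<phi> \<Longrightarrow> bclinear \<psi> \<Longrightarrow> bclinear (tens t \<phi> \<psi>)"
  using bclinear_compose[OF _ lslice(1), of \<psi> \<phi>] by (simp add: tens_def[abs_def])

lemma tens_t: "bclinear \<phi> \<Longrightarrow> bclinear \<psi> \<Longrightarrow> tens t \<phi> \<psi> (t a b) = \<phi> a * \<psi> b"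
  by (simp add: tens_def lslice bclinear_scaleC_complex)

lemma tens_unique:
  assumes "bclinear \<phi>" "bclinear \<psi>" "bclinear \<Psi>" "\<And>a b. \<Psi> (t a b) = \<phi> a * \<psi> b"
  shows "\<Psi> = tens t \<phi> \<psi>"
  by (rule tensor_ext[OF assms(3) bclinear_tens[OF assms(1,2)]]) (simp add: assms tens_t)

lemma tens_eq_rslice: "bclinear \<phi> \<Longrightarrow> bclinear \<psi> \<Longrightarrow> tens t \<phi> \<psi> X = \<phi> (rslice t \<psi> X)"
  using tens_unique[of \<phi> \<psi> "\<lambda>X. \<phi> (rslice t \<psi> X)"] bclinear_compose[OF _ rslice(1), of \<phi> \<psi>]
  by (simp add: rslice bclinear_scaleC_complex mult.commute fun_eq_iff)

text \<open>Linearity in the first functional becomes plain once the second leg is sliced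
  first.\<close>

lemma tens_sum_left:
  assumes "\<And>i. i \<in> I \<Longrightarrow> bclinear (\<phi> i)" "bclinear \<psi>"
  shows "tens t (\<lambda>a. c * (\<Sum>i\<in>I. \<phi> i a)) \<psi> X = c * (\<Sum>i\<in>I. tens t (\<phi> i) \<psi> X)"
proof -
  have "bclinear (\<lambda>a. c *\<^sub>C (\<Sum>i\<in>I. \<phi> i a))"
    by (intro bclinear_scaleC bclinear_sum assms(1))
  then show ?thesis using assms by (simp add: tens_eq_rslice scaleC_complex_def)
qed

text \<open>Coefficients at elementary tensors are product functionals.\<close>

lemma tens_separate:
  assumes "\<And>\<phi> \<psi>. bclinear \<phi> \<Longrightarrow> bclinear \<psi> \<Longrightarrow> tens t \<phi> \<psi> X = tens t \<phi> \<psi> Y"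
  shows "X = Y"
proof -
  obtain \<pi>\<^sub>1 :: "'a \<Rightarrow> ('a \<Rightarrow> complex) \<Rightarrow> ('a \<Rightarrow> complex)"
    and \<pi>\<^sub>2 :: "'b \<Rightarrow> ('b \<Rightarrow> complex) \<Rightarrow> ('b \<Rightarrow> complex)" and \<rho> where "tensor \<pi>\<^sub>1 \<pi>\<^sub>2 \<rho> t"
    using t by (rule min_tensor_imp_tensor)
  then interpret tensor \<pi>\<^sub>1 \<pi>\<^sub>2 \<rho> t .
  show ?thesis
  proof (rule tensor_eqI)
    fix f f' :: "'a \<Rightarrow> complex" and g g' :: "'b \<Rightarrow> complex"
    assume fg: "f \<in> ell2" "g \<in> ell2" "f' \<in> ell2" "g' \<in> ell2"
    have "C.vf (ell2_tensor f g) (ell2_tensor f' g') = tens t (A.vf f f') (B.vf g g')"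
      using fg by (intro tens_unique A.bclinear_vf B.bclinear_vf C.bclinear_vf ell2_tensor vf_tensor)
    then show "C.vf (ell2_tensor f g) (ell2_tensor f' g') X = C.vf (ell2_tensor f g) (ell2_tensor f' g') Y"
      using assms[of "A.vf f f'" "B.vf g g'"] fg by (simp add: A.bclinear_vf B.bclinear_vf)
  qed
qed

text \<open>The choice in \<open>lslice\<close> records no bound, but by density it agrees with the
  extension of norm at most 1.\<close>

lemma lslice_norm:
  assumes "state \<phi>"
  shows "norm (lslice t \<phi> X) \<le> norm X"
proof -
  obtain \<pi>\<^sub>1 :: "'a \<Rightarrow> ('a \<Rightarrow> complex) \<Rightarrow> ('a \<Rightarrow> complex)"
    and \<pi>\<^sub>2 :: "'b \<Rightarrow> ('b \<Rightarrow> complex) \<Rightarrow> ('b \<Rightarrow> complex)" and \<rho> where "tensor \<pi>\<^sub>1 \<pi>\<^sub>2 \<rho> t"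
    using t by (rule min_tensor_imp_tensor)
  then interpret tensor \<pi>\<^sub>1 \<pi>\<^sub>2 \<rho> t .
  obtain E where E: "bclinear E" "\<And>a b. E (t a b) = \<phi> a *\<^sub>C b" "\<And>X. norm (E X) \<le> 1 * norm X"
    using left_slice_exists[of \<phi> 1] stateD[OF assms] by auto
  have "lslice t \<phi> = E"
    using E by (intro tensor_ext) (simp_all add: lslice stateD(1)[OF assms])
  then show ?thesis using E(3) by simp
qed

lemma state_tens:
  assumes "state \<phi>" "state \<psi>"
  shows "state (tens t \<phi> \<psi>)"
proof -
  obtain \<pi>\<^sub>1 :: "'a \<Rightarrow> ('a \<Rightarrow> complex) \<Rightarrow> ('a \<Rightarrow> complex)"
    and \<pi>\<^sub>2 :: "'b \<Rightarrow> ('b \<Rightarrow> complex) \<Rightarrow> ('b \<Rightarrow> complex)" and \<rho> where "tensor \<pi>\<^sub>1 \<pi>\<^sub>2 \<rho> t"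
    using t by (rule min_tensor_imp_tensor)
  then interpret tensor \<pi>\<^sub>1 \<pi>\<^sub>2 \<rho> t .
  have "tens t \<phi> \<psi> 1 = 1"
    using tens_t[of \<phi> \<psi> 1 1] assms by (simp add: t_one stateD)
  moreover have "cmod (tens t \<phi> \<psi> X) \<le> norm X" for X
    unfolding tens_def using stateD(3)[OF assms(2)] lslice_norm[OF assms(1)] by (rule order_trans)
  ultimately show ?thesis using assms bclinear_tens by (simp add: state_def)
qed

end

section \<open>The Haar state\<close>

context rep
begin

lemma state_vf:
  assumes "f \<in> ell2" "ell2_norm f = 1"
  shows "state (vf f f)"
  using assms bclinear_vf cmod_vf_le[OF assms(1) assms(1)] by (simp add: state_def vf_one ell2_inner_self)

lemma eq_0_if_states_eq_0:
  fixes a :: 'a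
  assumes "\<And>\<phi>. state \<phi> \<Longrightarrow> \<phi> a = 0"
  shows "a = 0"
proof (rule eq_0_if_vf_eq_0)
  have diag: "vf f f a = 0" if f: "f \<in> ell2" for f
  proof (cases "ell2_norm f = 0")
    case True
    then show ?thesis using cmod_vf_le[OF f f, of a] by simp
  next
    case False
    let ?c = "complex_of_real (1 / ell2_norm f)"
    have "vf (\<lambda>i. ?c * f i) (\<lambda>i. ?c * f i) a = 0"
    proof (rule assms[OF state_vf])
      show "ell2_norm (\<lambda>i. ?c * f i) = 1"
        unfolding ell2_norm_scale using False by (simp add: norm_divide)
    qed (rule ell2_scale[OF f])
    then show ?thesis
      unfolding vf_def rep_scale_vector[OF f] ell2_inner_scale_left ell2_inner_scale_right
      using False by simp
  qed
  fix f g :: "'i \<Rightarrow> complex" assume f: "f \<in> ell2" and g: "g \<in> ell2"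
  \<comment> \<open>Polarisation: h = g and h = i g give the sum and the difference of the two mixed
    terms.\<close>
  have sum: "vf f h a + vf h f a = 0" if h: "h \<in> ell2" for h
    using diag[OF ell2_add[OF f h]] diag[OF f] diag[OF h] f h
    by (simp add: vf_def rep_add_vector ell2_inner_add_left ell2_inner_add_right ell2_rep ell2_add)
  have "\<i> * (vf f g a - vf g f a) = 0"
    using sum[OF ell2_scale[OF g, of \<i>]] g
    by (simp add: vf_def rep_scale_vector ell2_inner_scale_left ell2_inner_scale_right algebra_simps)
  then show "vf f g a = 0" using sum[OF g] by simp
qed

end

lemma ell2_norm_basis: "ell2_norm (ell2_basis k) = 1"
proof -
  have "complex_of_real ((ell2_norm (ell2_basis k))\<^sup>2) = 1"
    unfolding ell2_inner_self[symmetric] ell2_inner_basis by (simp add: ell2_basis_def)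
  then have "(ell2_norm (ell2_basis k))\<^sup>2 = 1" by (simp only: of_real_eq_1_iff)
  then show ?thesis using ell2_norm_nonneg[of "ell2_basis k"] by (auto simp: power2_eq_1_iff)
qed

section \<open>Compactness and convexity of the state space\<close>

lemma continuous_on_eval: "continuous_on UNIV (\<lambda>\<phi> :: 'a \<Rightarrow> complex. \<phi> x)"
  by (rule continuous_on_product_coordinates)

text \<open>Banach-Alaoglu: in the pointwise topology the states form a closed subset of a product
  of discs of radius norm a, which is compact by Tychonoff.\<close>

lemma compact_states: "compact {\<phi> :: 'a::cstar_algebra \<Rightarrow> complex. state \<phi>}"
proof -
  let ?P = "PiE UNIV (\<lambda>a :: 'a. cball (0::complex) (norm a))"
  have "compactin (product_topology (\<lambda>_. euclidean) UNIV) ?P"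
    unfolding compactin_PiE by simp
  then have P: "compact ?P" by (simp add: euclidean_product_topology)
  have eq: "{\<phi> :: 'a \<Rightarrow> complex. state \<phi>} =
     {\<phi>. (\<forall>x y. \<phi> (x + y) = \<phi> x + \<phi> y) \<and> (\<forall>c x. \<phi> (c *\<^sub>C x) = c * \<phi> x) \<and> \<phi> 1 = 1 \<and>
       (\<forall>x. cmod (\<phi> x) \<le> norm x)}" (is "_ = ?S")
  proof (intro equalityI subsetI)
    fix \<phi> :: "'a \<Rightarrow> complex" assume "\<phi> \<in> {\<phi>. state \<phi>}"
    then show "\<phi> \<in> ?S"
      by (auto simp: state_def bclinearD(2) bclinear_scaleC_complex)
  next
    fix \<phi> :: "'a \<Rightarrow> complex" assume "\<phi> \<in> ?S"
    then show "\<phi> \<in> {\<phi>. state \<phi>}"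
      by (auto simp: state_def scaleC_complex_def intro!: bclinearI[where K = 1])
  qed
  have "closed ?S"
    by (intro closed_Collect_conj closed_Collect_all closed_Collect_eq closed_Collect_le
        continuous_intros continuous_on_eval)
  then have "compact (?P \<inter> ?S)" by (rule compact_Int_closed[OF P])
  moreover have "?P \<inter> ?S = ?S" by auto
  ultimately show ?thesis unfolding eq by simp
qed

lemma state_average:
  assumes "finite I" "I \<noteq> {}" "\<And>i. i \<in> I \<Longrightarrow> state (\<phi> i)"
  shows "state (\<lambda>a. complex_of_real (1 / card I) * (\<Sum>i\<in>I. \<phi> i a))"
  unfolding state_def
proof (intro conjI allI)
  have c: "real (card I) > 0" using assms by (simp add: card_gt_0_iff)
  have "bclinear (\<lambda>a. complex_of_real (1 / card I) *\<^sub>C (\<Sum>i\<in>I. \<phi> i a))"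
    by (intro bclinear_scaleC bclinear_sum stateD(1) assms(3))
  then show "bclinear (\<lambda>a. complex_of_real (1 / card I) * (\<Sum>i\<in>I. \<phi> i a))"
    by (simp add: scaleC_complex_def)
  show "complex_of_real (1 / card I) * (\<Sum>i\<in>I. \<phi> i 1) = 1"
    using c by (simp add: stateD(2)[OF assms(3)])
  fix x
  have "cmod (\<Sum>i\<in>I. \<phi> i x) \<le> card I * norm x"
    by (rule sum_norm_bound) (rule stateD(3)[OF assms(3)])
  then have "(1 / card I) * cmod (\<Sum>i\<in>I. \<phi> i x) \<le> (1 / card I) * (card I * norm x)"
    using c by (intro mult_left_mono) auto
  then show "cmod (complex_of_real (1 / card I) * (\<Sum>i\<in>I. \<phi> i x)) \<le> norm x"
    using c by (simp add: norm_mult norm_divide)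
qed

context compact_quantum_group
begin

section \<open>Convolution of functionals\<close>

lemma rep_A: "\<exists>\<pi> :: 'a \<Rightarrow> ('a \<Rightarrow> complex) \<Rightarrow> ('a \<Rightarrow> complex). rep \<pi>"
  and rep_B: "\<exists>\<rho> :: 'b \<Rightarrow> ('a \<times> 'a \<Rightarrow> complex) \<Rightarrow> ('a \<times> 'a \<Rightarrow> complex). rep \<rho>"
  using min_tensor_imp_tensor[OF tensor] unfolding tensor_def by metis+

lemma rep_C: "\<exists>\<rho> :: 'c \<Rightarrow> ('b \<times> 'a \<Rightarrow> complex) \<Rightarrow> ('b \<times> 'a \<Rightarrow> complex). rep \<rho>"
  using min_tensor_imp_tensor[OF tensor_left] unfolding tensor_def by metis

lemma bclinear_comult: "bclinear \<Phi>"
  using rep_B rep.bclinear_star_hom[OF _ star_hom_comult] by blast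

lemma separate:
  assumes "\<And>\<phi> :: 'a \<Rightarrow> complex. bclinear \<phi> \<Longrightarrow> \<phi> x = \<phi> y"
  shows "x = y"
proof -
  obtain \<pi> :: "'a \<Rightarrow> ('a \<Rightarrow> complex) \<Rightarrow> ('a \<Rightarrow> complex)" where "rep \<pi>" using rep_A by blast
  then show ?thesis using assms by (rule rep.functionals_separate)
qed

lemma t_mult: "t a b * t a' b' = t (a * a') (b * b')"
  and t_star: "star (t a b) = t (star a) (star b)"
  using min_tensor_imp_tensor[OF tensor] tensor.t_mult tensor.t_star by metis+

definition conv :: "('a \<Rightarrow> complex) \<Rightarrow> ('a \<Rightarrow> complex) \<Rightarrow> 'a \<Rightarrow> complex" where
  "conv \<phi> \<psi> a = tens t \<phi> \<psi> (\<Phi> a)"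

lemma conv_lslice: "conv \<phi> \<psi> a = \<psi> (lslice t \<phi> (\<Phi> a))"
  by (simp add: conv_def tens_def)

lemma conv_rslice: "bclinear \<phi> \<Longrightarrow> bclinear \<psi> \<Longrightarrow> conv \<phi> \<psi> a = \<phi> (rslice t \<psi> (\<Phi> a))"
  by (simp add: conv_def tens_eq_rslice[OF tensor])

lemma bclinear_conv: "bclinear \<phi> \<Longrightarrow> bclinear \<psi> \<Longrightarrow> bclinear (conv \<phi> \<psi>)"
  unfolding conv_def[abs_def] by (intro bclinear_compose[OF bclinear_tens[OF tensor] bclinear_comult])

lemma state_conv:
  assumes "state \<phi>" "state \<psi>"
  shows "state (conv \<phi> \<psi>)"
  unfolding state_def
proof (intro conjI allI)
  note s = state_tens[OF tensor assms]
  show "bclinear (conv \<phi> \<psi>)" using assms by (intro bclinear_conv stateD)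
  show "conv \<phi> \<psi> 1 = 1" unfolding conv_def using stateD(2)[OF s] star_homD(5)[OF star_hom_comult] by simp
  obtain \<rho> :: "'b \<Rightarrow> ('a \<times> 'a \<Rightarrow> complex) \<Rightarrow> ('a \<times> 'a \<Rightarrow> complex)" where \<rho>: "rep \<rho>"
    using rep_B by blast
  show "cmod (conv \<phi> \<psi> x) \<le> norm x" for x
    unfolding conv_def using stateD(3)[OF s] rep.star_hom_contractive[OF \<rho> star_hom_comult] by (rule order_trans)
qed

text \<open>Both sides are \<phi> \<otimes> \<psi> \<otimes> \<theta> on the triple tensor product,
  bracketed in the two possible ways and composed with the two sides of coassociativity.\<close>

lemma conv_assoc:
  assumes [simp]: "bclinear \<phi>" "bclinear \<psi>" "bclinear \<theta>"
  shows "conv (conv \<phi> \<psi>) \<theta> = conv \<phi> (conv \<psi> \<theta>)"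
proof -
  obtain F\<^sub>1 F\<^sub>2 where F: "is_tensor_hom t tl \<Phi> id F\<^sub>1" "is_tensor_hom t tr id \<Phi> F\<^sub>2" "F\<^sub>1 \<circ> \<Phi> = F\<^sub>2 \<circ> \<Phi>"
    using coassociative by blast
  obtain \<rho> :: "'c \<Rightarrow> ('b \<times> 'a \<Rightarrow> complex) \<Rightarrow> ('b \<times> 'a \<Rightarrow> complex)" where \<rho>: "rep \<rho>"
    using rep_C by blast
  have bF: "bclinear F\<^sub>1" "bclinear F\<^sub>2"
    using F rep.bclinear_star_hom[OF \<rho>] by (auto simp: is_tensor_hom_def)
  define \<Psi>\<^sub>1 where "\<Psi>\<^sub>1 = tens tl (tens t \<phi> \<psi>) \<theta>"
  define \<Psi>\<^sub>2 where "\<Psi>\<^sub>2 = tens tr \<phi> (tens t \<psi> \<theta>)"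
  have b[simp]: "bclinear (tens t \<phi> \<psi>)" "bclinear (tens t \<psi> \<theta>)" by (simp_all add: bclinear_tens[OF tensor])
  have b\<Psi>: "bclinear \<Psi>\<^sub>1" "bclinear \<Psi>\<^sub>2"
    by (simp_all add: \<Psi>\<^sub>1_def \<Psi>\<^sub>2_def bclinear_tens[OF tensor_left] bclinear_tens[OF tensor_right])
  \<comment> \<open>Density is used twice: \<open>assoc\<close> settles X = a \<otimes> b, which
    extends to every X, and then to the whole triple product.\<close>
  have "\<Psi>\<^sub>1 (tl X c) = \<Psi>\<^sub>2 (tl X c)" for X c
  proof -
    have tl: "bclinear (\<lambda>X. tl X c)"
    proof -
      obtain \<pi>\<^sub>1 :: "'b \<Rightarrow> ('b \<Rightarrow> complex) \<Rightarrow> ('b \<Rightarrow> complex)"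
        and \<pi>\<^sub>2 :: "'a \<Rightarrow> ('a \<Rightarrow> complex) \<Rightarrow> ('a \<Rightarrow> complex)" and \<rho> where "tensor \<pi>\<^sub>1 \<pi>\<^sub>2 \<rho> tl"
        using tensor_left by (rule min_tensor_imp_tensor)
      then interpret T: tensor \<pi>\<^sub>1 \<pi>\<^sub>2 \<rho> tl .
      show ?thesis
        by (rule bclinearI[where K = "norm c"])
          (simp_all add: T.t_add_left T.t_scaleC_left T.norm_t_le mult.commute[of "norm c"])
    qed
    have "(\<lambda>X. \<Psi>\<^sub>1 (tl X c)) = (\<lambda>X. \<Psi>\<^sub>2 (tl X c))"
    proof (rule tensor_ext[OF tensor])
      show "bclinear (\<lambda>X. \<Psi>\<^sub>1 (tl X c))" "bclinear (\<lambda>X. \<Psi>\<^sub>2 (tl X c))"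
        using b\<Psi> tl by (auto intro: bclinear_compose)
      fix a b
      have "\<Psi>\<^sub>1 (tl (t a b) c) = \<phi> a * \<psi> b * \<theta> c"
        by (simp add: \<Psi>\<^sub>1_def tens_t[OF tensor_left] tens_t[OF tensor])
      moreover have "\<Psi>\<^sub>2 (tl (t a b) c) = \<phi> a * (\<psi> b * \<theta> c)"
        by (simp add: assoc \<Psi>\<^sub>2_def tens_t[OF tensor_right] tens_t[OF tensor])
      ultimately show "\<Psi>\<^sub>1 (tl (t a b) c) = \<Psi>\<^sub>2 (tl (t a b) c)" by simp
    qed
    then show ?thesis by metis
  qed
  then have eq: "\<Psi>\<^sub>1 = \<Psi>\<^sub>2" by (rule tensor_ext[OF tensor_left b\<Psi>])
  have 1: "(\<lambda>X. \<Psi>\<^sub>1 (F\<^sub>1 X)) = tens t (conv \<phi> \<psi>) \<theta>"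
    using F(1) by (intro tens_unique[OF tensor] bclinear_conv bclinear_compose[OF b\<Psi>(1) bF(1)])
      (simp_all add: is_tensor_hom_def \<Psi>\<^sub>1_def tens_t[OF tensor_left] conv_def)
  have 2: "(\<lambda>X. \<Psi>\<^sub>2 (F\<^sub>2 X)) = tens t \<phi> (conv \<psi> \<theta>)"
    using F(2) by (intro tens_unique[OF tensor] bclinear_conv bclinear_compose[OF b\<Psi>(2) bF(2)])
      (simp_all add: is_tensor_hom_def \<Psi>\<^sub>2_def tens_t[OF tensor_right] conv_def)
  show ?thesis
  proof
    fix a
    have "conv (conv \<phi> \<psi>) \<theta> a = \<Psi>\<^sub>1 (F\<^sub>1 (\<Phi> a))" using fun_cong[OF 1] by (simp add: conv_def[of "conv \<phi> \<psi>"])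
    also have "\<dots> = \<Psi>\<^sub>2 (F\<^sub>2 (\<Phi> a))" using fun_cong[OF F(3)] eq by simp
    also have "\<dots> = conv \<phi> (conv \<psi> \<theta>) a" using fun_cong[OF 2] by (simp add: conv_def[of \<phi>])
    finally show "conv (conv \<phi> \<psi>) \<theta> a = conv \<phi> (conv \<psi> \<theta>) a" .
  qed
qed

text \<open>Associativity of convolution, tested against all functionals \<theta>. It will let (h
  \<otimes> id) \<Phi>(a) absorb a further slice.\<close>

lemma lslice_comult_lslice:
  assumes "bclinear \<phi>" "bclinear \<psi>"
  shows "lslice t \<psi> (\<Phi> (lslice t \<phi> (\<Phi> a))) = lslice t (conv \<phi> \<psi>) (\<Phi> a)"
proof (rule separate)
  fix \<theta> :: "'a \<Rightarrow> complex" assume "bclinear \<theta>"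
  then have "conv \<phi> (conv \<psi> \<theta>) a = conv (conv \<phi> \<psi>) \<theta> a"
    using assms by (simp add: conv_assoc)
  then show "\<theta> (lslice t \<psi> (\<Phi> (lslice t \<phi> (\<Phi> a)))) = \<theta> (lslice t (conv \<phi> \<psi>) (\<Phi> a))"
    by (simp add: conv_lslice)
qed

lemma lslice_mult_left:
  assumes "bclinear \<phi>"
  shows "lslice t \<phi> (t 1 d * X) = d * lslice t \<phi> X"
proof -
  have "(\<lambda>X. lslice t \<phi> (t 1 d * X)) = (\<lambda>X. d * lslice t \<phi> X)"
    by (rule tensor_ext[OF tensor])
      (simp_all add: bclinear_compose[OF lslice(1)[OF tensor assms] bclinear_mult_left]
        bclinear_compose[OF bclinear_mult_left lslice(1)[OF tensor assms]]
        t_mult lslice(2)[OF tensor assms] mult_scaleC_right)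
  then show ?thesis by metis
qed

lemma exists_invariant_state:
  assumes \<omega>: "state \<omega>"
  shows "\<exists>h. state h \<and> conv \<omega> h = h \<and> conv h \<omega> = h"
proof -
  \<comment> \<open>Convolution by \<omega> becomes evaluation at the fixed elements L a and R a, so
    that invariance is a closed condition for pointwise convergence.\<close>
  define L where "L a = lslice t \<omega> (\<Phi> a)" for a
  define R where "R a = rslice t \<omega> (\<Phi> a)" for a
  have L: "conv \<omega> \<phi> a = \<phi> (L a)" for \<phi> a by (simp add: L_def conv_lslice)
  have R: "state \<phi> \<Longrightarrow> conv \<phi> \<omega> a = \<phi> (R a)" for \<phi> a
    by (simp add: R_def conv_rslice stateD \<omega>)
  \<comment> \<open>The bound 2/(n + 1) is what telescoping gives for the average of n + 1
    convolution powers.\<close>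
  define T where "T n = {\<phi>. (\<forall>a. cmod (\<phi> (L a) - \<phi> a) \<le> (2 / real (Suc n)) * norm a) \<and>
      (\<forall>a. cmod (\<phi> (R a) - \<phi> a) \<le> (2 / real (Suc n)) * norm a)}" for n
  \<comment> \<open>This is the power n + 1: a power 0 would be the counit, which need not exist on
    A.\<close>
  define p where "p n = ((conv \<omega>) ^^ n) \<omega>" for n
  have p_Suc: "p (Suc n) = conv \<omega> (p n)" for n by (simp add: p_def)
  have p_state: "state (p n)" for n
    by (induction n) (simp_all add: p_def \<omega> state_conv)
  have p_comm: "conv (p n) \<omega> = p (Suc n)" for n
  proof (induction n)
    case (Suc n)
    then show ?case
      using conv_assoc[of \<omega> "p n" \<omega>] p_state \<omega> by (simp add: p_Suc stateD)
  qed (simp add: p_def)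
  define h where "h n = (\<lambda>a. complex_of_real (1 / card {..n}) * (\<Sum>i\<in>{..n}. p i a))" for n :: nat
  have h_state: "state (h n)" for n
    unfolding h_def by (rule state_average) (auto intro: p_state)
  have h_T: "h n \<in> T n" for n
  proof -
    have LR: "p i (L a) = p (Suc i) a" "p i (R a) = p (Suc i) a" for i a
      using L[of "p i" a] R[OF p_state, of i a] by (simp_all add: p_Suc p_comm[symmetric])
        (simp add: p_comm p_Suc)
    have tel: "(\<Sum>i\<le>n. p (Suc i) a) - (\<Sum>i\<le>n. p i a) = p (Suc n) a - p 0 a" for a
      by (induction n) (simp_all add: algebra_simps)
    have "cmod (complex_of_real (1 / card {..n}) * ((\<Sum>i\<le>n. p (Suc i) a) - (\<Sum>i\<le>n. p i a)))
        \<le> (2 / real (Suc n)) * norm a" for a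
    proof -
      have "cmod (p (Suc n) a - p 0 a) \<le> norm a + norm a"
        using norm_triangle_ineq4[of "p (Suc n) a" "p 0 a"] stateD(3)[OF p_state, of "Suc n" a]
          stateD(3)[OF p_state, of 0 a] by linarith
      then have "(1 / real (Suc n)) * cmod (p (Suc n) a - p 0 a) \<le> (1 / real (Suc n)) * (norm a + norm a)"
        by (intro mult_left_mono) auto
      then show ?thesis unfolding tel norm_mult norm_of_real by simp
    qed
    then show ?thesis unfolding T_def h_def by (simp add: LR right_diff_distrib)
  qed
  have T_mono: "T n \<subseteq> T m" if "m \<le> n" for m n
  proof -
    have "(2 / real (Suc n)) * norm a \<le> (2 / real (Suc m)) * norm a" for a :: 'a
      using that by (intro mult_right_mono frac_le) auto
    then show ?thesis unfolding T_def by (blast intro: order_trans)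
  qed
  have "{\<phi>. state \<phi>} \<inter> (\<Inter>n\<in>UNIV. T n) \<noteq> {}"
  proof (rule compact_imp_fip_image[OF compact_states])
    show "closed (T n)" for n
      unfolding T_def
      by (intro closed_Collect_conj closed_Collect_all closed_Collect_le continuous_intros continuous_on_eval)
    fix I :: "nat set" assume "finite I"
    \<comment> \<open>The sets T n decrease, so the average with the largest index lies in all of
      them; inserting 0 covers empty I.\<close>
    then have "h (Max (insert 0 I)) \<in> T n" if "n \<in> I" for n
      using T_mono[of n "Max (insert 0 I)"] h_T that by auto
    then show "{\<phi>. state \<phi>} \<inter> (\<Inter>n\<in>I. T n) \<noteq> {}"
      using h_state by blast
  qed
  then obtain k where k: "state k" "\<And>n. k \<in> T n" by blast
  have zero: "x = 0" if x: "\<And>n. norm x \<le> (2 / real (Suc n)) * c" for x :: complex and c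
  proof -
    have "(\<lambda>n. (2 / real (Suc n)) * c) \<longlonglongrightarrow> 0 * c"
      using LIMSEQ_Suc[OF lim_const_over_n[of "2::real"]] by (intro tendsto_mult) auto
    then have "norm x \<le> 0 * c" by (rule LIMSEQ_le_const) (use x in blast)
    then show ?thesis by simp
  qed
  have "k (L a) - k a = 0" for a
    by (rule zero[of _ "norm a"]) (use k(2) in \<open>simp add: T_def\<close>)
  moreover have "k (R a) - k a = 0" for a
    by (rule zero[of _ "norm a"]) (use k(2) in \<open>simp add: T_def\<close>)
  ultimately have "conv \<omega> k = k" "conv k \<omega> = k" using L R[OF k(1)] by auto
  then show ?thesis using k(1) by blast
qed

text \<open>Put \<open>b = (h \<otimes> id) \<Phi>(a)\<close>. Invariance of \<open>h\<close> makes \<open>X = \<Phi>(b) - 1 \<otimes> b\<close> null for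
  \<open>\<omega> \<otimes> h\<close>, hence for \<open>\<rho>\<^sub>i \<otimes> h\<close>; by Cauchy--Schwarz \<open>(\<rho>\<^sub>i \<otimes> h)((1 \<otimes> d) X) = 0\<close>, and density of
  the \<open>(1 \<otimes> d) \<Phi>(a)\<close> removes \<open>d\<close> and \<open>a\<close>.\<close>

lemma invariant_absorbs_summands:
  assumes I: "finite I" "I \<noteq> {}" "\<And>i. i \<in> I \<Longrightarrow> state (\<rho> i)"
    and \<omega>: "\<omega> = (\<lambda>a. complex_of_real (1 / card I) * (\<Sum>i\<in>I. \<rho> i a))"
    and h: "state h" "conv \<omega> h = h" "conv h \<omega> = h" and i: "i \<in> I"
  shows "conv h (\<rho> i) = h"
proof -
  have \<omega>_state: "state \<omega>" unfolding \<omega> by (rule state_average[OF I])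
  note b_h = stateD(1)[OF h(1)] and b_\<omega> = stateD(1)[OF \<omega>_state] and b_\<rho> = stateD(1)[OF I(3)]
  have key: "tens t (conv h (\<rho> i)) h (t 1 d * \<Phi> a) = tens t h h (t 1 d * \<Phi> a)" for a d
  proof -
    define b where "b = lslice t h (\<Phi> a)"
    define X where "X = \<Phi> b - t 1 b"
    define \<Omega> where "\<Omega> = tens t \<omega> h"
    define r where "r = h (star b * b)"
    have \<Omega>: "state \<Omega>" unfolding \<Omega>_def by (rule state_tens[OF tensor \<omega>_state h(1)])
    \<comment> \<open>Slicing \<Phi>(b) by \<omega> is slicing \<Phi>(a) by h * \<omega> =
      h.\<close>
    have Lb: "lslice t \<omega> (\<Phi> b) = b"
      unfolding b_def by (simp add: lslice_comult_lslice b_h b_\<omega> h(3))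
    have cross: "\<Omega> (t 1 (star b) * \<Phi> b) = r"
      by (simp add: \<Omega>_def tens_def lslice_mult_left b_\<omega> Lb r_def)
    have "star X * X = \<Phi> (star b * b) - star (t 1 (star b) * \<Phi> b) - t 1 (star b) * \<Phi> b + t 1 (star b * b)"
      by (simp add: X_def star_diff star_mult star_star t_star star_homD[OF star_hom_comult]
          algebra_simps t_mult)
    moreover have "\<Omega> (\<Phi> (star b * b)) = r" using fun_cong[OF h(2)] by (simp add: \<Omega>_def conv_def r_def)
    moreover have "\<Omega> (t 1 (star b * b)) = r"
      by (simp add: \<Omega>_def tens_t[OF tensor b_\<omega> b_h] stateD(2)[OF \<omega>_state] r_def)
    ultimately have "\<Omega> (star X * X) = r - cnj r"
      by (simp add: bclinearD(2,3)[OF stateD(1)[OF \<Omega>]] state_star[OF \<Omega>] cross)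
    then have "Re (\<Omega> (star X * X)) = 0" by simp
    \<comment> \<open>The average of nonnegative real parts vanishes, so each of them does.\<close>
    moreover have "\<Omega> (star X * X) = complex_of_real (1 / card I) * (\<Sum>i\<in>I. tens t (\<rho> i) h (star X * X))"
      unfolding \<Omega>_def \<omega> by (rule tens_sum_left[OF tensor b_\<rho> b_h])
    ultimately have "(\<Sum>i\<in>I. Re (tens t (\<rho> i) h (star X * X))) = 0"
      using I(1,2) by (simp add: Re_divide_of_real)
    moreover obtain \<sigma> :: "'b \<Rightarrow> ('a \<times> 'a \<Rightarrow> complex) \<Rightarrow> ('a \<times> 'a \<Rightarrow> complex)" where \<sigma>: "rep \<sigma>"
      using rep_B by blast
    moreover have "0 \<le> Re (tens t (\<rho> j) h (star X * X))" if "j \<in> I" for j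
      by (rule rep.state_nonneg[OF \<sigma> state_tens[OF tensor I(3)[OF that] h(1)]])
    ultimately have "Re (tens t (\<rho> i) h (star X * X)) = 0"
      using I(1) i by (simp add: sum_nonneg_eq_0_iff)
    then have "tens t (\<rho> i) h (t 1 d * X) = 0"
      by (rule rep.state_null[OF \<sigma> state_tens[OF tensor I(3)[OF i] h(1)]])
    then have "tens t (\<rho> i) h (t 1 d * \<Phi> b) = tens t (\<rho> i) h (t 1 (d * b))"
      using bclinearD(3)[OF bclinear_tens[OF tensor b_\<rho>[OF i] b_h]]
      by (simp add: X_def right_diff_distrib t_mult)
    then have "h (d * lslice t (\<rho> i) (\<Phi> b)) = h (d * b)"
      by (simp add: tens_t[OF tensor b_\<rho>[OF i] b_h] stateD(2)[OF I(3)[OF i]])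
        (simp add: tens_def lslice_mult_left b_\<rho>[OF i])
    \<comment> \<open>The slice of \<Phi>(b) by \<rho> i is that of \<Phi>(a) by h * \<rho> i, and b
      is the slice by h; so both sides become product functionals at (1 \<otimes> d)
      \<Phi>(a).\<close>
    then show ?thesis
      using b_\<rho>[OF i] b_h by (simp add: tens_def lslice_mult_left bclinear_conv b_def lslice_comult_lslice)
  qed
  have "tens t (conv h (\<rho> i)) h = tens t h h"
    by (rule bclinear_eq_on_dense_span[OF _ _ dense_right])
      (use key in \<open>auto intro!: bclinear_tens[OF tensor] bclinear_conv b_h b_\<rho>[OF i]\<close>)
  then have "tens t (conv h (\<rho> i)) h (t a 1) = tens t h h (t a 1)" for a by simp
  then show ?thesis
    using b_\<rho>[OF i] b_h by (auto simp: tens_t[OF tensor] bclinear_conv stateD(2)[OF h(1)])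
qed

lemma exists_state: "\<exists>\<phi> :: 'a \<Rightarrow> complex. state \<phi>"
proof -
  obtain \<pi> :: "'a \<Rightarrow> ('a \<Rightarrow> complex) \<Rightarrow> ('a \<Rightarrow> complex)" where "rep \<pi>" using rep_A by blast
  from rep.state_vf[OF this ell2_basis ell2_norm_basis, of undefined] show ?thesis by blast
qed

lemma exists_Haar_state: "\<exists>h. state h \<and> (\<forall>a. lslice t h (\<Phi> a) = h a *\<^sub>C 1)"
proof -
  define T where "T \<rho> = {\<phi> :: 'a \<Rightarrow> complex. \<forall>a. \<phi> (rslice t \<rho> (\<Phi> a)) = \<phi> a}" for \<rho>
  have T: "\<phi> \<in> T \<rho> \<longleftrightarrow> conv \<phi> \<rho> = \<phi>" if "state \<phi>" "state \<rho>" for \<phi> \<rho>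
    using that by (auto simp: T_def conv_rslice stateD fun_eq_iff)
  have "{\<phi>. state \<phi>} \<inter> (\<Inter>\<rho>\<in>{\<rho>. state \<rho>}. T \<rho>) \<noteq> {}"
  proof (rule compact_imp_fip_image[OF compact_states])
    show "closed (T \<rho>)" for \<rho>
      unfolding T_def by (intro closed_Collect_all closed_Collect_eq continuous_on_eval)
    fix I :: "('a \<Rightarrow> complex) set" assume I: "finite I" "I \<subseteq> {\<rho>. state \<rho>}"
    obtain \<phi> :: "'a \<Rightarrow> complex" where \<phi>: "state \<phi>" using exists_state by blast
    \<comment> \<open>The extra state keeps the family nonempty, so that it can be averaged.\<close>
    define J where "J = insert \<phi> I"
    have J: "finite J" "J \<noteq> {}" "\<And>\<rho>. \<rho> \<in> J \<Longrightarrow> state \<rho>" using I \<phi> by (auto simp: J_def)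
    obtain h where h: "state h"
      "conv (\<lambda>a. complex_of_real (1 / card J) * (\<Sum>\<rho>\<in>J. \<rho> a)) h = h"
      "conv h (\<lambda>a. complex_of_real (1 / card J) * (\<Sum>\<rho>\<in>J. \<rho> a)) = h"
      using exists_invariant_state[OF state_average[where \<phi> = "\<lambda>\<rho>. \<rho>", OF J]] by blast
    have "conv h \<rho> = h" if "\<rho> \<in> J" for \<rho>
      using invariant_absorbs_summands[where \<rho> = "\<lambda>\<rho>. \<rho>", OF J refl h that] .
    then have "h \<in> T \<rho>" if "\<rho> \<in> I" for \<rho>
      using that T[OF h(1), of \<rho>] I by (auto simp: J_def)
    then show "{\<phi>. state \<phi>} \<inter> (\<Inter>\<rho>\<in>I. T \<rho>) \<noteq> {}" using h(1) by blast
  qed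
  then obtain h where h: "state h" "\<And>\<rho>. state \<rho> \<Longrightarrow> h \<in> T \<rho>" by blast
  obtain \<pi> :: "'a \<Rightarrow> ('a \<Rightarrow> complex) \<Rightarrow> ('a \<Rightarrow> complex)" where \<pi>: "rep \<pi>" using rep_A by blast
  \<comment> \<open>Every state \<rho> takes (h \<otimes> id) \<Phi>(a) to (h * \<rho>)(a) = h(a),
    and states separate points.\<close>
  have "lslice t h (\<Phi> a) - h a *\<^sub>C 1 = 0" for a
  proof (rule rep.eq_0_if_states_eq_0[OF \<pi>])
    fix \<rho> :: "'a \<Rightarrow> complex" assume \<rho>: "state \<rho>"
    have "\<rho> (lslice t h (\<Phi> a)) = h a"
      using T[OF h(1) \<rho>] h(2)[OF \<rho>] conv_lslice[of h \<rho> a] by simp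
    then show "\<rho> (lslice t h (\<Phi> a) - h a *\<^sub>C 1) = 0"
      using stateD(1,2)[OF \<rho>] by (simp add: bclinearD(3) bclinear_scaleC_complex)
  qed
  then show ?thesis using h(1) by auto
qed

end

section \<open>Schur's lemma\<close>

definition is_proj :: "nat \<Rightarrow> (nat \<Rightarrow> nat \<Rightarrow> complex) \<Rightarrow> bool" where
  "is_proj n e \<longleftrightarrow> (\<forall>i<n. \<forall>j<n. (\<Sum>k<n. e i k * e k j) = e i j) \<and> (\<forall>i<n. \<forall>j<n. cnj (e j i) = e i j)"

text \<open>A diagonal entry is the square sum of its row, hence at least its own square, hence at
  most 1.\<close>

lemma is_proj_trace_le:
  assumes "is_proj n e"
  shows "Re (\<Sum>i<n. e i i) \<le> real n"
proof -
  have "Re (e i i) \<le> 1" if i: "i < n" for i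
  proof -
    have "e i i = (\<Sum>k<n. e i k * e k i)" using assms i by (simp add: is_proj_def)
    also have "\<dots> = (\<Sum>k<n. complex_of_real ((cmod (e i k))\<^sup>2))"
    proof (rule sum.cong)
      fix k assume "k \<in> {..<n}"
      then have "e k i = cnj (e i k)" using assms i by (simp add: is_proj_def)
      then show "e i k * e k i = complex_of_real ((cmod (e i k))\<^sup>2)" by (simp only: complex_norm_square)
    qed simp
    finally have eq: "e i i = complex_of_real (\<Sum>k<n. (cmod (e i k))\<^sup>2)" by simp
    then have R: "Re (e i i) = (\<Sum>k<n. (cmod (e i k))\<^sup>2)" by (metis Re_complex_of_real)
    have "(Re (e i i))\<^sup>2 \<le> (cmod (e i i))\<^sup>2" using abs_Re_le_cmod by (simp add: abs_le_square_iff[symmetric])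
    also have "\<dots> \<le> (\<Sum>k<n. (cmod (e i k))\<^sup>2)"
      using i by (intro member_le_sum) auto
    finally have "Re (e i i) * Re (e i i) \<le> 1 * Re (e i i)" using R by (simp add: power2_eq_square)
    then show ?thesis using mult_strict_right_mono[of 1 "Re (e i i)" "Re (e i i)"] by linarith
  qed
  then have "(\<Sum>i<n. Re (e i i)) \<le> (\<Sum>i<n. 1)" by (intro sum_mono) auto
  then show ?thesis by simp
qed

text \<open>A projection \<open>e\<close> with \<open>y e = 0\<close> of maximal trace is the projection onto the kernel of \<open>y\<close>:
  otherwise adding a rank one projection would raise the trace by \<open>1\<close>.\<close>

lemma kernel_projection_exists:
  fixes y :: "nat \<Rightarrow> nat \<Rightarrow> complex"
  shows "\<exists>e. is_proj n e \<and> (\<forall>i<n. \<forall>j<n. (\<Sum>k<n. y i k * e k j) = 0) \<and>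
    (\<forall>w. (\<forall>i<n. (\<Sum>k<n. y i k * w k) = 0) \<longrightarrow> (\<forall>i<n. (\<Sum>k<n. e i k * w k) = w i))"
proof -
  define P where "P e \<longleftrightarrow> is_proj n e \<and> (\<forall>i<n. \<forall>j<n. (\<Sum>k<n. y i k * e k j) = 0)" for e
  define tr where "tr e = Re (\<Sum>i<n. e i i)" for e :: "nat \<Rightarrow> nat \<Rightarrow> complex"
  \<comment> \<open>The trace is not known to be an integer at this point, so its natural lower
    bounds are maximised; raising the trace by 1 still contradicts maximality.\<close>
  define S where "S = {m::nat. \<exists>e. P e \<and> real m \<le> tr e}"
  have "P (\<lambda>_ _. 0)" by (simp add: P_def is_proj_def)
  then have "0 \<in> S" unfolding S_def by (auto intro!: exI[of _ "\<lambda>_ _. 0"] simp: tr_def)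
  have bound: "m \<le> n" if m: "m \<in> S" for m
  proof -
    obtain e where "is_proj n e" "real m \<le> tr e" using m unfolding S_def P_def by blast
    then show ?thesis using is_proj_trace_le[of n e] by (simp add: tr_def)
  qed
  then have fin: "finite S" by (meson finite_nat_set_iff_bounded_le)
  then have "Max S \<in> S" using \<open>0 \<in> S\<close> by (intro Max_in) auto
  then obtain e where e: "P e" "real (Max S) \<le> tr e" unfolding S_def by blast
  have ee: "(\<Sum>k<n. e i k * e k j) = e i j" and adj: "cnj (e j i) = e i j"
    and ye: "(\<Sum>k<n. y i k * e k j) = 0" if "i < n" "j < n" for i j
    using e(1) that by (simp_all add: P_def is_proj_def)
  have "(\<Sum>k<n. e i k * w k) = w i" if w: "\<forall>i<n. (\<Sum>k<n. y i k * w k) = 0" and i: "i < n" for w i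
  proof (rule ccontr)
    assume ne: "(\<Sum>k<n. e i k * w k) \<noteq> w i"
    \<comment> \<open>The component of w orthogonal to the range of e; it lies in the kernel of y
      and spans the rank one projection added in f.\<close>
    define x where "x k = w k - (\<Sum>l<n. e k l * w l)" for k
    define c where "c = (\<Sum>k<n. (cmod (x k))\<^sup>2)"
    have "x i \<noteq> 0" using ne by (simp add: x_def)
    then have c: "c > 0" unfolding c_def using i by (intro sum_pos2[of _ i]) auto
    have cc: "(\<Sum>k<n. cnj (x k) * x k) = complex_of_real c"
      unfolding c_def of_real_sum by (rule sum.cong) (simp_all only: complex_norm_square mult.commute)
    have ex: "(\<Sum>k<n. e i k * x k) = 0" if "i < n" for i
    proof -
      have "(\<Sum>k<n. e i k * (\<Sum>l<n. e k l * w l)) = (\<Sum>l<n. (\<Sum>k<n. e i k * e k l) * w l)"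
        by (simp add: sum_distrib_left sum_distrib_right mult.assoc) (rule sum.swap)
      then show ?thesis using that by (simp add: x_def right_diff_distrib sum_subtractf ee)
    qed
    have yx: "(\<Sum>k<n. y i k * x k) = 0" if "i < n" for i
    proof -
      have "(\<Sum>k<n. y i k * (\<Sum>l<n. e k l * w l)) = (\<Sum>l<n. (\<Sum>k<n. y i k * e k l) * w l)"
        by (simp add: sum_distrib_left sum_distrib_right mult.assoc) (rule sum.swap)
      then show ?thesis using that w by (simp add: x_def right_diff_distrib sum_subtractf ye)
    qed
    have xe: "(\<Sum>k<n. cnj (x k) * e k j) = 0" if "j < n" for j
    proof -
      have "(\<Sum>k<n. cnj (x k) * e k j) = cnj (\<Sum>k<n. e j k * x k)"
        using that adj by (simp add: mult.commute)
      then show ?thesis using ex[OF that] by simp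
    qed
    define f where "f i j = e i j + x i * cnj (x j) / complex_of_real c" for i j
    have "P f"
      unfolding P_def is_proj_def
    proof (intro conjI allI impI)
      fix i j assume ij: "i < n" "j < n"
      have "(\<Sum>k<n. f i k * f k j) = (\<Sum>k<n. e i k * e k j) + (\<Sum>k<n. e i k * x k) * (cnj (x j) / complex_of_real c)
          + x i / complex_of_real c * (\<Sum>k<n. cnj (x k) * e k j)
          + x i * cnj (x j) / (complex_of_real c)\<^sup>2 * (\<Sum>k<n. cnj (x k) * x k)"
        unfolding sum_distrib_left sum_distrib_right sum.distrib[symmetric]
        by (rule sum.cong) (simp_all add: f_def field_simps power2_eq_square add_divide_distrib)
      also have "\<dots> = f i j"
        using c by (simp add: ee[OF ij] ex[OF ij(1)] xe[OF ij(2)] cc f_def power2_eq_square)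
      finally show "(\<Sum>k<n. f i k * f k j) = f i j" .
      show "cnj (f j i) = f i j" using adj[OF ij] by (simp add: f_def mult.commute)
      have "(\<Sum>k<n. y i k * f k j) = (\<Sum>k<n. y i k * e k j) + (\<Sum>k<n. y i k * x k) * (cnj (x j) / complex_of_real c)"
        unfolding sum_distrib_right sum.distrib[symmetric]
        by (rule sum.cong) (simp_all add: f_def algebra_simps)
      then show "(\<Sum>k<n. y i k * f k j) = 0" by (simp add: ye[OF ij] yx[OF ij(1)])
    qed
    moreover have "tr f = tr e + 1"
    proof -
      have "(\<Sum>i<n. f i i) = (\<Sum>i<n. e i i) + (\<Sum>i<n. cnj (x i) * x i) / complex_of_real c"
        by (simp add: f_def sum.distrib sum_divide_distrib mult.commute)
      then show ?thesis using c by (simp add: tr_def cc)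
    qed
    ultimately have "Suc (Max S) \<in> S" using e(2) unfolding S_def by auto
    then show False using Max_ge[OF fin] by fastforce
  qed
  then show ?thesis using e(1) unfolding P_def by blast
qed

lemma injective_imp_inverse:
  fixes y :: "nat \<Rightarrow> nat \<Rightarrow> complex"
  assumes inj: "\<And>w. (\<forall>i<n. (\<Sum>k<n. y i k * w k) = 0) \<Longrightarrow> \<forall>i<n. w i = 0"
  shows "\<exists>z. \<forall>i<n. \<forall>j<n. (\<Sum>k<n. z i k * y k j) = (if i = j then 1 else 0) \<and>
    (\<Sum>k<n. y i k * z k j) = (if i = j then 1 else 0)"
proof -
  define A where "A = mat n n (\<lambda>(i, j). y i j)"
  have A: "A \<in> carrier_mat n n" by (simp add: A_def)
  have "det A \<noteq> 0"
  proof
    assume "det A = 0"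
    then obtain v where v: "v \<in> carrier_vec n" "v \<noteq> 0\<^sub>v n" "A *\<^sub>v v = 0\<^sub>v n"
      using det_0_iff_vec_prod_zero[OF A] by blast
    have "(\<Sum>k<n. y i k * vec_index v k) = 0" if "i < n" for i
    proof -
      have "(\<Sum>k<n. y i k * vec_index v k) = vec_index (A *\<^sub>v v) i"
        using that v(1) by (simp add: A_def scalar_prod_def lessThan_atLeast0)
      then show ?thesis using v(3) that by simp
    qed
    then have "\<forall>i<n. vec_index v i = 0" using inj by blast
    then have "v = 0\<^sub>v n" using v(1) by (intro eq_vecI) auto
    then show False using v(2) by simp
  qed
  then have "A \<in> Units (ring_mat TYPE(complex) n ())" by (rule det_non_zero_imp_unit[OF A])
  then obtain B where B: "B \<in> carrier_mat n n" "B * A = 1\<^sub>m n" "A * B = 1\<^sub>m n"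
    unfolding Units_def ring_mat_def by auto
  have "(\<Sum>k<n. B $$ (i, k) * y k j) = (B * A) $$ (i, j) \<and>
    (\<Sum>k<n. y i k * B $$ (k, j)) = (A * B) $$ (i, j)" if "i < n" "j < n" for i j
    using that B(1) by (simp add: A_def scalar_prod_def lessThan_atLeast0)
  then show ?thesis using B by (intro exI[of _ "\<lambda>i j. B $$ (i, j)"]) simp
qed

lemma eigenvalue_exists:
  fixes y :: "nat \<Rightarrow> nat \<Rightarrow> complex"
  assumes "n > 0"
  shows "\<exists>c w. (\<forall>i<n. (\<Sum>k<n. y i k * w k) = c * w i) \<and> (\<exists>i<n. w i \<noteq> 0)"
proof -
  define A where "A = mat n n (\<lambda>(i, j). y i j)"
  have A: "A \<in> carrier_mat n n" by (simp add: A_def)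
  have "\<not> constant (poly (char_poly A))"
    using degree_monic_char_poly[OF A] assms by (simp add: constant_degree)
  then obtain c where "poly (char_poly A) c = 0"
    using fundamental_theorem_of_algebra by blast
  then have "eigenvalue A c" by (simp add: eigenvalue_root_char_poly[OF A])
  then obtain v where v: "v \<in> carrier_vec n" "v \<noteq> 0\<^sub>v n" "A *\<^sub>v v = c \<cdot>\<^sub>v v"
    using A unfolding eigenvalue_def eigenvector_def by auto
  have "(\<Sum>k<n. y i k * vec_index v k) = c * vec_index v i" if "i < n" for i
  proof -
    have "(\<Sum>k<n. y i k * vec_index v k) = vec_index (A *\<^sub>v v) i"
      using that v(1) by (simp add: A_def scalar_prod_def lessThan_atLeast0)
    then show ?thesis using v that by simp
  qed
  moreover have "\<exists>i<n. vec_index v i \<noteq> 0"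
  proof (rule ccontr)
    assume "\<not> ?thesis"
    then have "v = 0\<^sub>v n" using v(1) by (intro eq_vecI) auto
    then show False using v(2) by simp
  qed
  ultimately show ?thesis by blast
qed

text \<open>The matrix identity y v = u y for a square scalar matrix y.\<close>

definition intertwines :: "nat \<Rightarrow> (nat \<Rightarrow> nat \<Rightarrow> complex) \<Rightarrow> 'a::cstar_algebra mat \<Rightarrow> 'a mat \<Rightarrow> bool" where
  "intertwines n y v u \<longleftrightarrow>
    (\<forall>i<n. \<forall>j<n. (\<Sum>k<n. y i k *\<^sub>C v $$ (k, j)) = (\<Sum>k<n. y k j *\<^sub>C u $$ (i, k)))"

context compact_quantum_group
begin

text \<open>Let e project onto the kernel of y. Then y v e = u y e = 0, so v maps the kernel into
  itself, that is e v e = v e. Irreducibility makes e equal to 1, which means y = 0, or to 0, which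
  means y is injective.\<close>

lemma schur:
  assumes v: "irreducible_rep t \<Phi> n v" and y: "intertwines n y v u"
  shows "(\<forall>i<n. \<forall>j<n. y i j = 0) \<or> (\<forall>w. (\<forall>i<n. (\<Sum>k<n. y i k * w k) = 0) \<longrightarrow> (\<forall>i<n. w i = 0))"
proof -
  have vc: "v \<in> carrier_mat n n" using v by (simp add: irreducible_rep_def fd_rep_def)
  obtain e where e: "is_proj n e" "\<forall>i<n. \<forall>j<n. (\<Sum>k<n. y i k * e k j) = 0"
    and e_ker: "\<And>w. (\<forall>i<n. (\<Sum>k<n. y i k * w k) = 0) \<Longrightarrow> \<forall>i<n. (\<Sum>k<n. e i k * w k) = w i"
    using kernel_projection_exists by blast
  define E where "E = mat n n (\<lambda>(i, j). e i j)"
  have E: "E \<in> carrier_mat n n" by (simp add: E_def)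
  have "E * E = E"
    using e(1) by (intro eq_matI) (simp_all add: E_def is_proj_def scalar_prod_def lessThan_atLeast0)
  moreover have "mat_star E = E"
    using e(1) by (intro eq_matI) (simp_all add: E_def is_proj_def mat_star_def star_complex_def)
  moreover have "scalar_mat E * v * scalar_mat E = v * scalar_mat E"
  proof -
    define s where "s = (scalar_mat E :: 'a mat)"
    have s: "s \<in> carrier_mat n n" "\<And>i j. i < n \<Longrightarrow> j < n \<Longrightarrow> s $$ (i, j) = e i j *\<^sub>C 1"
      by (simp_all add: s_def scalar_mat_def E_def)
    define x where "x k j = (\<Sum>l<n. e l j *\<^sub>C v $$ (k, l))" for k j
    have vs: "(v * s) $$ (k, j) = x k j" if "k < n" "j < n" for k j
      using that vc s by (simp add: x_def scalar_prod_def lessThan_atLeast0 mult_scaleC_right)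
    have "(s * (v * s)) $$ (i, j) = (v * s) $$ (i, j)" if ij: "i < n" "j < n" for i j
    proof (rule separate)
      fix \<phi> :: "'a \<Rightarrow> complex" assume \<phi>: "bclinear \<phi>"
      \<comment> \<open>The columns of v e have entries in A; a functional turns them into scalar
        vectors, to which the kernel property of e applies.\<close>
      have "(\<Sum>k<n. y i k * \<phi> (x k j)) = 0" if i: "i < n" for i
      proof -
        have "(\<Sum>k<n. y i k *\<^sub>C x k j) = (\<Sum>l<n. e l j *\<^sub>C (\<Sum>k<n. y i k *\<^sub>C v $$ (k, l)))"
          unfolding x_def scaleC_sum_right scaleC_scaleC by (subst sum.swap) (simp add: mult.commute)
        also have "\<dots> = (\<Sum>l<n. e l j *\<^sub>C (\<Sum>k<n. y k l *\<^sub>C u $$ (i, k)))"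
          using y i by (simp add: intertwines_def)
        also have "\<dots> = (\<Sum>k<n. (\<Sum>l<n. y k l * e l j) *\<^sub>C u $$ (i, k))"
          unfolding scaleC_sum_right scaleC_sum_left scaleC_scaleC by (subst sum.swap) (simp add: mult.commute)
        also have "\<dots> = 0" using e(2) ij by simp
        finally have "\<phi> (\<Sum>k<n. y i k *\<^sub>C x k j) = 0" using bclinearD(7)[OF \<phi>] by simp
        then show ?thesis by (simp add: bclinearD(8)[OF \<phi>] bclinear_scaleC_complex[OF \<phi>])
      qed
      then have "\<forall>i<n. (\<Sum>k<n. e i k * \<phi> (x k j)) = \<phi> (x i j)" by (intro e_ker) blast
      then have "\<phi> (\<Sum>k<n. e i k *\<^sub>C x k j) = \<phi> (x i j)"
        using ij by (simp add: bclinearD(8)[OF \<phi>] bclinear_scaleC_complex[OF \<phi>])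
      moreover have "(s * (v * s)) $$ (i, j) = (\<Sum>k<n. e i k *\<^sub>C x k j)"
      proof -
        have "(s * (v * s)) $$ (i, j) = (\<Sum>k<n. s $$ (i, k) * (v * s) $$ (k, j))"
          using ij vc s by (simp add: scalar_prod_def lessThan_atLeast0)
        also have "\<dots> = (\<Sum>k<n. e i k *\<^sub>C x k j)"
          using ij by (intro sum.cong) (simp_all add: vs s mult_scaleC_left)
        finally show ?thesis .
      qed
      ultimately show "\<phi> ((s * (v * s)) $$ (i, j)) = \<phi> ((v * s) $$ (i, j))" by (simp add: vs ij)
    qed
    then have "s * (v * s) = v * s" using vc s by (intro eq_matI) auto
    then show ?thesis unfolding s_def[symmetric] using vc s by (simp add: assoc_mult_mat[of _ n n _ n _ n])
  qed
  ultimately have "E = 0\<^sub>m n n \<or> E = 1\<^sub>m n"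
    using v E unfolding irreducible_rep_def by blast
  then show ?thesis
  proof
    assume E0: "E = 0\<^sub>m n n"
    have "e i k = 0" if "i < n" "k < n" for i k
      using arg_cong[OF E0, of "\<lambda>M. M $$ (i, k)"] that by (simp add: E_def)
    then have "(\<Sum>k<n. e i k * w k) = 0" if "i < n" for i w using that by (simp add: sum.neutral)
    then have "w i = 0" if "\<forall>i<n. (\<Sum>k<n. y i k * w k) = 0" "i < n" for w i
      using e_ker[OF that(1), rule_format, OF that(2)] that(2) by simp
    then show ?thesis by blast
  next
    assume E1: "E = 1\<^sub>m n"
    have e1: "e i k = (if i = k then 1 else 0)" if "i < n" "k < n" for i k
      using arg_cong[OF E1, of "\<lambda>M. M $$ (i, k)"] that by (simp add: E_def)
    have "y i j = 0" if "i < n" "j < n" for i j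
    proof -
      have "(\<Sum>k<n. y i k * e k j) = (\<Sum>k<n. (if k = j then y i k else 0))"
        using that by (intro sum.cong) (auto simp: e1)
      then show ?thesis using e(2) that by simp
    qed
    then show ?thesis by blast
  qed
qed

text \<open>A nonzero y is invertible, so v = z u y with z the inverse of y. The trace stays cyclic
  because the entries of z and y are scalars.\<close>

lemma intertwines_imp_char_eq:
  assumes v: "irreducible_rep t \<Phi> n v" and y: "intertwines n y v u"
    and nz: "i < n" "j < n" "y i j \<noteq> 0"
  shows "rep_char n v = rep_char n u"
proof -
  have "\<forall>w. (\<forall>i<n. (\<Sum>k<n. y i k * w k) = 0) \<longrightarrow> (\<forall>i<n. w i = 0)"
    using schur[OF v y] nz by blast
  then obtain z where z: "\<And>i j. i < n \<Longrightarrow> j < n \<Longrightarrow> (\<Sum>k<n. z i k * y k j) = (if i = j then 1 else 0)"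
    "\<And>i j. i < n \<Longrightarrow> j < n \<Longrightarrow> (\<Sum>k<n. y i k * z k j) = (if i = j then 1 else 0)"
    using injective_imp_inverse[of n y] by blast
  have v_eq: "v $$ (j, q) = (\<Sum>r<n. z j r *\<^sub>C (\<Sum>p<n. y p q *\<^sub>C u $$ (r, p)))" if "j < n" "q < n" for j q
  proof -
    have "(\<Sum>r<n. z j r *\<^sub>C (\<Sum>p<n. y p q *\<^sub>C u $$ (r, p))) = (\<Sum>r<n. z j r *\<^sub>C (\<Sum>k<n. y r k *\<^sub>C v $$ (k, q)))"
      using y that by (simp add: intertwines_def)
    also have "\<dots> = (\<Sum>k<n. (\<Sum>r<n. z j r * y r k) *\<^sub>C v $$ (k, q))"
      unfolding scaleC_sum_right scaleC_sum_left scaleC_scaleC by (rule sum.swap)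
    also have "\<dots> = (\<Sum>k<n. (if j = k then v $$ (k, q) else 0))"
      using that by (intro sum.cong) (auto simp: z)
    finally show ?thesis using that by simp
  qed
  have "rep_char n v = (\<Sum>j<n. \<Sum>r<n. \<Sum>p<n. (y p j * z j r) *\<^sub>C u $$ (r, p))"
    unfolding rep_char_def by (rule sum.cong) (simp_all add: v_eq scaleC_sum_right scaleC_scaleC mult.commute)
  also have "\<dots> = (\<Sum>r<n. \<Sum>p<n. (\<Sum>j<n. y p j * z j r) *\<^sub>C u $$ (r, p))"
    unfolding scaleC_sum_left by (subst sum.swap) (intro sum.cong refl sum.swap)
  also have "\<dots> = (\<Sum>r<n. \<Sum>p<n. (if p = r then u $$ (r, p) else 0))"
    by (intro sum.cong) (auto simp: z)
  also have "\<dots> = rep_char n u" unfolding rep_char_def by simp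
  finally show ?thesis .
qed

text \<open>For an eigenvalue c of y, y - c is again an intertwiner but is not injective, so it
  vanishes.\<close>

lemma self_intertwines_scalar:
  assumes v: "irreducible_rep t \<Phi> n v" and y: "intertwines n y v v"
  shows "\<exists>c. \<forall>i<n. \<forall>j<n. y i j = (if i = j then c else 0)"
proof -
  have "n > 0" using v by (simp add: irreducible_rep_def)
  then obtain c w i where w: "\<forall>i<n. (\<Sum>k<n. y i k * w k) = c * w i" "i < n" "w i \<noteq> 0"
    using eigenvalue_exists by blast
  define x where "x i k = y i k - (if i = k then c else 0)" for i k
  have "intertwines n x v v"
    unfolding intertwines_def
  proof (intro allI impI)
    fix i j assume ij: "i < n" "j < n"
    have "(\<Sum>k<n. x i k *\<^sub>C v $$ (k, j)) = (\<Sum>k<n. y i k *\<^sub>C v $$ (k, j)) - (\<Sum>k<n. (if i = k then c *\<^sub>C v $$ (k, j) else 0))"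
      unfolding sum_subtractf[symmetric] by (rule sum.cong) (auto simp: x_def scaleC_diff_left)
    moreover have "(\<Sum>k<n. x k j *\<^sub>C v $$ (i, k)) = (\<Sum>k<n. y k j *\<^sub>C v $$ (i, k)) - (\<Sum>k<n. (if k = j then c *\<^sub>C v $$ (i, k) else 0))"
      unfolding sum_subtractf[symmetric] by (rule sum.cong) (auto simp: x_def scaleC_diff_left)
    ultimately show "(\<Sum>k<n. x i k *\<^sub>C v $$ (k, j)) = (\<Sum>k<n. x k j *\<^sub>C v $$ (i, k))"
      using y ij by (simp add: intertwines_def)
  qed
  moreover have "(\<Sum>k<n. x i k * w k) = 0" if "i < n" for i
  proof -
    have "(\<Sum>k<n. x i k * w k) = (\<Sum>k<n. y i k * w k) - (\<Sum>k<n. (if i = k then c * w k else 0))"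
      unfolding sum_subtractf[symmetric] by (rule sum.cong) (auto simp: x_def algebra_simps)
    then show ?thesis using w(1) that by simp
  qed
  ultimately have "\<forall>i<n. \<forall>j<n. x i j = 0"
    using schur[OF v, of x v] w(2,3) by blast
  then show ?thesis by (auto simp: x_def intro!: exI[of _ c])
qed

section \<open>Orthogonality of irreducible characters\<close>

lemma fd_rep_unitary:
  assumes u: "fd_rep t \<Phi> n u" and ij: "i < n" "j < n"
  shows "(\<Sum>k<n. star (u $$ (k, i)) * u $$ (k, j)) = (if i = j then 1 else 0)"
    and "(\<Sum>k<n. u $$ (i, k) * star (u $$ (j, k))) = (if i = j then 1 else 0)"
proof -
  have c: "u \<in> carrier_mat n n" "mat_star u * u = 1\<^sub>m n" "u * mat_star u = 1\<^sub>m n"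
    using u by (simp_all add: fd_rep_def)
  have "(mat_star u * u) $$ (i, j) = (\<Sum>k<n. star (u $$ (k, i)) * u $$ (k, j))"
    using ij c(1) by (simp add: mat_star_def scalar_prod_def lessThan_atLeast0)
  then show "(\<Sum>k<n. star (u $$ (k, i)) * u $$ (k, j)) = (if i = j then 1 else 0)"
    using c(2) ij by simp
  have "(u * mat_star u) $$ (i, j) = (\<Sum>k<n. u $$ (i, k) * star (u $$ (j, k)))"
    using ij c(1) by (simp add: mat_star_def scalar_prod_def lessThan_atLeast0)
  then show "(\<Sum>k<n. u $$ (i, k) * star (u $$ (j, k))) = (if i = j then 1 else 0)"
    using c(3) ij by simp
qed

lemma fd_rep_comult:
  assumes "fd_rep t \<Phi> n u" "i < n" "j < n"
  shows "\<Phi> (u $$ (i, j)) = (\<Sum>k<n. t (u $$ (i, k)) (u $$ (k, j)))"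
  using assms by (simp add: fd_rep_def)

context
  fixes h :: "'a \<Rightarrow> complex"
  assumes h: "state h" "\<And>a. lslice t h (\<Phi> a) = h a *\<^sub>C 1"
begin

text \<open>The matrix y is h applied entrywise to u* E v, for E the matrix unit at (k, l).
  Invariance of h yields u* y v = y, and multiplying by u from the left gives y v = u y.\<close>

lemma Haar_intertwines:
  assumes u: "fd_rep t \<Phi> n u" and v: "fd_rep t \<Phi> n v" and kl: "k < n" "l < n"
  shows "intertwines n (\<lambda>i j. h (star (u $$ (k, i)) * v $$ (l, j))) v u"
proof -
  define y where "y i j = h (star (u $$ (k, i)) * v $$ (l, j))" for i j
  have inv: "(\<Sum>i<n. \<Sum>j<n. y i j *\<^sub>C (star (u $$ (i, p)) * v $$ (j, q))) = y p q *\<^sub>C 1"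
    if pq: "p < n" "q < n" for p q
  proof -
    have "\<Phi> (star (u $$ (k, p)) * v $$ (l, q)) =
        (\<Sum>i<n. \<Sum>j<n. t (star (u $$ (k, i)) * v $$ (l, j)) (star (u $$ (i, p)) * v $$ (j, q)))"
      using pq kl u v
      by (simp add: star_homD[OF star_hom_comult] fd_rep_comult star_sum t_star sum_product t_mult)
    then have "lslice t h (\<Phi> (star (u $$ (k, p)) * v $$ (l, q))) =
        (\<Sum>i<n. \<Sum>j<n. y i j *\<^sub>C (star (u $$ (i, p)) * v $$ (j, q)))"
      using lslice[OF tensor stateD(1)[OF h(1)]] by (simp add: bclinearD(8) y_def)
    then show ?thesis by (simp add: h(2) y_def)
  qed
  have "(\<Sum>j<n. y r j *\<^sub>C v $$ (j, q)) = (\<Sum>p<n. y p q *\<^sub>C u $$ (r, p))" if rq: "r < n" "q < n" for r q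
  proof -
    have "(\<Sum>p<n. y p q *\<^sub>C u $$ (r, p)) = (\<Sum>p<n. u $$ (r, p) * (y p q *\<^sub>C 1))"
      by (simp add: mult_scaleC_right)
    also have "\<dots> = (\<Sum>p<n. u $$ (r, p) * (\<Sum>i<n. \<Sum>j<n. y i j *\<^sub>C (star (u $$ (i, p)) * v $$ (j, q))))"
      using rq by (simp add: inv)
    also have "\<dots> = (\<Sum>p<n. \<Sum>i<n. \<Sum>j<n. y i j *\<^sub>C (u $$ (r, p) * star (u $$ (i, p)) * v $$ (j, q)))"
      by (simp add: sum_distrib_left mult_scaleC_right mult.assoc)
    also have "\<dots> = (\<Sum>i<n. \<Sum>j<n. \<Sum>p<n. y i j *\<^sub>C (u $$ (r, p) * star (u $$ (i, p)) * v $$ (j, q)))"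
      by (subst sum.swap) (intro sum.cong refl sum.swap)
    also have "\<dots> = (\<Sum>i<n. \<Sum>j<n. y i j *\<^sub>C ((\<Sum>p<n. u $$ (r, p) * star (u $$ (i, p))) * v $$ (j, q)))"
      by (simp add: scaleC_sum_right sum_distrib_right)
    also have "\<dots> = (\<Sum>i<n. (if r = i then (\<Sum>j<n. y i j *\<^sub>C v $$ (j, q)) else 0))"
      using rq by (intro sum.cong) (auto simp: fd_rep_unitary(2)[OF u])
    finally show ?thesis using rq by simp
  qed
  then show ?thesis by (simp add: intertwines_def y_def)
qed

lemma Haar_char_product:
  "h (star (rep_char n u) * rep_char n v) = (\<Sum>i<n. \<Sum>j<n. h (star (u $$ (i, i)) * v $$ (j, j)))"
  by (simp add: rep_char_def star_sum sum_product bclinearD(8)[OF stateD(1)[OF h(1)]])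

text \<open>Each summand is the (i, j) entry of the intertwiner built with k = i and l = j; were it
  nonzero, the characters would agree.\<close>

lemma Haar_char_orthogonal:
  assumes u: "fd_rep t \<Phi> n u" and v: "irreducible_rep t \<Phi> n v" and ne: "rep_char n v \<noteq> rep_char n u"
  shows "h (star (rep_char n u) * rep_char n v) = 0"
proof -
  have v': "fd_rep t \<Phi> n v" using v by (simp add: irreducible_rep_def)
  have "h (star (u $$ (i, i)) * v $$ (j, j)) = 0" if "i < n" "j < n" for i j
    using intertwines_imp_char_eq[OF v Haar_intertwines[OF u v' that], of i j] ne that by blast
  then show ?thesis by (simp add: Haar_char_product)
qed

text \<open>The scalars c k l stay individually unknown; only the sum of the c k k enters.\<close>

lemma Haar_char_norm:
  assumes v: "irreducible_rep t \<Phi> n v"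
  shows "h (star (rep_char n v) * rep_char n v) = 1"
proof -
  have n: "n > 0" and v': "fd_rep t \<Phi> n v" using v by (simp_all add: irreducible_rep_def)
  have "\<forall>k<n. \<forall>l<n. \<exists>c. \<forall>i<n. \<forall>j<n. h (star (v $$ (k, i)) * v $$ (l, j)) = (if i = j then c else 0)"
    using self_intertwines_scalar[OF v Haar_intertwines[OF v' v']] by blast
  then obtain c where c: "\<And>k l i j. k < n \<Longrightarrow> l < n \<Longrightarrow> i < n \<Longrightarrow> j < n \<Longrightarrow>
      h (star (v $$ (k, i)) * v $$ (l, j)) = (if i = j then c k l else 0)"
    by metis
  have "h (star (rep_char n v) * rep_char n v) = (\<Sum>i<n. \<Sum>j<n. (if i = j then c i j else 0))"
    unfolding Haar_char_product by (intro sum.cong) (auto simp: c)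
  also have "\<dots> = (\<Sum>k<n. c k k)" by simp
  \<comment> \<open>Any diagonal index computes c k k. Index 0 exists since n > 0, and unitarity
    sums the first column to 1.\<close>
  also have "\<dots> = (\<Sum>k<n. h (star (v $$ (k, 0)) * v $$ (k, 0)))"
    using n by (intro sum.cong) (auto simp: c)
  also have "\<dots> = h (\<Sum>k<n. star (v $$ (k, 0)) * v $$ (k, 0))"
    by (rule bclinearD(8)[OF stateD(1)[OF h(1)], symmetric])
  also have "\<dots> = 1"
    using n fd_rep_unitary(1)[OF v', of 0 0] stateD(2)[OF h(1)] by simp
  finally show ?thesis .
qed

end

text \<open>If the characters x and y differed, h would take star x (x - y) to 1, so its norm would
  be at least 1. The product form of the hypothesis avoids dividing by norm x.\<close>

theorem irreducible_chars_separated: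
  assumes u: "irreducible_rep t \<Phi> n u" and v: "irreducible_rep t \<Phi> n v"
    and close: "norm (rep_char n u) * norm (rep_char n u - rep_char n v) < 1"
  shows "rep_char n u = rep_char n v"
proof (rule ccontr)
  assume ne: "rep_char n u \<noteq> rep_char n v"
  obtain h where h: "state h" "\<And>a. lslice t h (\<Phi> a) = h a *\<^sub>C 1"
    using exists_Haar_state by blast
  let ?x = "rep_char n u" and ?y = "rep_char n v"
  have "fd_rep t \<Phi> n u" using u by (simp add: irreducible_rep_def)
  then have "h (star ?x * (?x - ?y)) = 1"
    using Haar_char_norm[OF h u] Haar_char_orthogonal[OF h _ v] ne
    by (simp add: right_diff_distrib bclinearD(3)[OF stateD(1)[OF h(1)]])
  then have "1 \<le> norm (star ?x * (?x - ?y))"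
    using stateD(3)[OF h(1), of "star ?x * (?x - ?y)"] by simp
  also have "\<dots> \<le> norm ?x * norm (?x - ?y)"
    using norm_mult_ineq[of "star ?x" "?x - ?y"] by simp
  finally show False using close by simp
qed

end

section \<open>Total disconnectedness\<close>

context compact_quantum_group
begin

section \<open>The automorphism group and its action on representations\<close>

lemma Aut_comp:
  assumes \<alpha>: "\<alpha> \<in> Aut t \<Phi>" and \<beta>: "\<beta> \<in> Aut t \<Phi>"
  shows "\<beta> \<circ> \<alpha> \<in> Aut t \<Phi>"
proof -
  obtain F where F: "is_tensor_hom t t \<alpha> \<alpha> F" "F \<circ> \<Phi> = \<Phi> \<circ> \<alpha>"
    using \<alpha> unfolding Aut_def mem_Collect_eq by blast
  obtain G where G: "is_tensor_hom t t \<beta> \<beta> G" "G \<circ> \<Phi> = \<Phi> \<circ> \<beta>"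
    using \<beta> unfolding Aut_def mem_Collect_eq by blast
  have "is_tensor_hom t t (\<beta> \<circ> \<alpha>) (\<beta> \<circ> \<alpha>) (G \<circ> F)"
    using F(1) G(1) by (simp add: is_tensor_hom_def star_hom_def)
  moreover have "(G \<circ> F) \<circ> \<Phi> = \<Phi> \<circ> (\<beta> \<circ> \<alpha>)"
    using F(2) G(2) by (simp add: fun_eq_iff)
  moreover have "bij (\<beta> \<circ> \<alpha>)" "star_hom (\<beta> \<circ> \<alpha>)"
    using \<alpha> \<beta> by (simp_all add: Aut_def star_hom_def bij_comp)
  ultimately show ?thesis
    unfolding Aut_def mem_Collect_eq by (intro conjI exI)
qed

lemma star_hom_inv:
  assumes "bij f" "star_hom f"
  shows "star_hom (inv_into UNIV f)"
proof -
  have eq: "inv_into UNIV f y = x" if "f x = y" for x y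
    using that assms(1) by (metis bij_inv_eq_iff)
  have f: "f (inv_into UNIV f y) = y" for y using assms(1) by (simp add: bij_is_surj surj_f_inv_f)
  show ?thesis
    unfolding star_hom_def by (intro conjI allI eq) (simp_all add: star_homD[OF assms(2)] f)
qed

text \<open>The inverse of \<open>F = \<alpha> \<otimes> \<alpha>\<close> serves for \<open>\<alpha>\<^sup>-\<^sup>1\<close>: \<open>F\<close> is injective because product functionals
  separate points, hence isometric, hence has closed range, which contains all \<open>a \<otimes> b\<close>.\<close>

lemma Aut_inv:
  assumes \<alpha>: "\<alpha> \<in> Aut t \<Phi>"
  shows "inv_into UNIV \<alpha> \<in> Aut t \<Phi>"
proof -
  have bij: "bij \<alpha>" and hom: "star_hom \<alpha>" using \<alpha> by (simp_all add: Aut_def)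
  obtain F where F: "star_hom F" "\<And>a b. F (t a b) = t (\<alpha> a) (\<alpha> b)" "F \<circ> \<Phi> = \<Phi> \<circ> \<alpha>"
    using \<alpha> unfolding Aut_def is_tensor_hom_def mem_Collect_eq by blast
  obtain \<pi> :: "'a \<Rightarrow> ('a \<Rightarrow> complex) \<Rightarrow> ('a \<Rightarrow> complex)" where \<pi>: "rep \<pi>" using rep_A by blast
  obtain \<rho> :: "'b \<Rightarrow> ('a \<times> 'a \<Rightarrow> complex) \<Rightarrow> ('a \<times> 'a \<Rightarrow> complex)" where \<rho>: "rep \<rho>" using rep_B by blast
  have bF: "bclinear F" by (rule rep.bclinear_star_hom[OF \<rho> F(1)])
  have \<alpha>_inv: "\<alpha> (inv_into UNIV \<alpha> a) = a" "inv_into UNIV \<alpha> (\<alpha> a) = a" for a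
    using bij by (simp_all add: bij_is_surj surj_f_inv_f bij_is_inj)
  have inv_hom: "star_hom (inv_into UNIV \<alpha>)" by (rule star_hom_inv[OF bij hom])
  have b\<alpha>: "bclinear (inv_into UNIV \<alpha>)" by (rule rep.bclinear_star_hom[OF \<pi> inv_hom])
  have inj: "inj F"
  proof (rule injI)
    fix X Y assume FXY: "F X = F Y"
    show "X = Y"
    proof (rule tens_separate[OF tensor])
      fix \<phi> \<psi> :: "'a \<Rightarrow> complex" assume b: "bclinear \<phi>" "bclinear \<psi>"
      let ?\<phi> = "\<lambda>a. \<phi> (inv_into UNIV \<alpha> a)" and ?\<psi> = "\<lambda>a. \<psi> (inv_into UNIV \<alpha> a)"
      have b': "bclinear ?\<phi>" "bclinear ?\<psi>" using b b\<alpha> by (auto intro: bclinear_compose)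
      \<comment> \<open>Every product functional factors through F, after both legs are composed
        with the inverse of \<alpha>.\<close>
      have "(\<lambda>X. tens t ?\<phi> ?\<psi> (F X)) = tens t \<phi> \<psi>"
        using b b' bclinear_compose[OF bclinear_tens[OF tensor b'] bF]
        by (intro tens_unique[OF tensor]) (simp_all add: F(2) tens_t[OF tensor] \<alpha>_inv)
      then show "tens t \<phi> \<psi> X = tens t \<phi> \<psi> Y" using FXY by (metis (no_types, lifting))
    qed
  qed
  have iso: "norm (F X) = norm X" for X
    by (rule star_hom_isometric[OF rep.faithful[OF \<rho>] rep.faithful[OF \<rho>] F(1) inj])
  have "closed (range F)"
  proof (rule complete_imp_closed, rule completeI)
    fix y :: "nat \<Rightarrow> 'b" assume y: "\<forall>n. y n \<in> range F" "Cauchy y"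
    then have "\<forall>n. \<exists>x. y n = F x" by blast
    from choice[OF this] obtain x where x: "\<And>n. y n = F (x n)" by blast
    have "dist (y m) (y n) = dist (x m) (x n)" for m n
      unfolding x dist_norm star_homD(9)[OF F(1), symmetric] by (rule iso)
    then have "Cauchy x" using y(2) by (simp add: Cauchy_def)
    then obtain X where "x \<longlonglongrightarrow> X" using Cauchy_convergent_iff convergent_def by blast
    then have "(\<lambda>n. y n) \<longlonglongrightarrow> F X"
      unfolding x by (rule bounded_linear.tendsto[OF bclinearD(1)[OF bF]])
    then show "\<exists>l\<in>range F. y \<longlonglongrightarrow> l" by blast
  qed
  moreover have "span {t a b | a b. True} \<subseteq> range F"
  proof (rule span_minimal)
    show "{t a b | a b. True} \<subseteq> range F"
    proof clarify
      fix a b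
      have "t a b = F (t (inv_into UNIV \<alpha> a) (inv_into UNIV \<alpha> b))" by (simp add: F(2) \<alpha>_inv)
      then show "t a b \<in> range F" by blast
    qed
    show "subspace (range F)"
      using linear_subspace_image[OF bounded_linear.linear[OF bclinearD(1)[OF bF]] subspace_UNIV] .
  qed
  ultimately have "closure (span {t a b | a b. True}) \<subseteq> range F" by (rule closure_minimal[rotated])
  then have "surj F" using tensor by (auto simp: min_tensor_def)
  then have bijF: "bij F" using inj by (simp add: bij_def)
  have F_inv: "inv_into UNIV F (F X) = X" for X using inj by simp
  have "is_tensor_hom t t (inv_into UNIV \<alpha>) (inv_into UNIV \<alpha>) (inv_into UNIV F)"
    unfolding is_tensor_hom_def
  proof (intro conjI allI)
    show "star_hom (inv_into UNIV F)" by (rule star_hom_inv[OF bijF F(1)])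
    fix a b
    have "t a b = F (t (inv_into UNIV \<alpha> a) (inv_into UNIV \<alpha> b))" by (simp add: F(2) \<alpha>_inv)
    then show "inv_into UNIV F (t a b) = t (inv_into UNIV \<alpha> a) (inv_into UNIV \<alpha> b)" by (simp add: F_inv)
  qed
  moreover have "inv_into UNIV F \<circ> \<Phi> = \<Phi> \<circ> inv_into UNIV \<alpha>"
  proof
    fix a
    have "\<Phi> a = F (\<Phi> (inv_into UNIV \<alpha> a))" using fun_cong[OF F(3), of "inv_into UNIV \<alpha> a"] by (simp add: \<alpha>_inv)
    then show "(inv_into UNIV F \<circ> \<Phi>) a = (\<Phi> \<circ> inv_into UNIV \<alpha>) a" by (simp add: F_inv)
  qed
  ultimately show ?thesis
    unfolding Aut_def mem_Collect_eq using bij inv_hom bij_imp_bij_inv by blast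
qed

text \<open>\<alpha> fixes scalar matrices, so by injectivity a projection invariant for the image
  of v is already invariant for v; F transports the comultiplication formula.\<close>

lemma Aut_irreducible:
  assumes \<alpha>: "\<alpha> \<in> Aut t \<Phi>" and v: "irreducible_rep t \<Phi> n v"
  shows "irreducible_rep t \<Phi> n (map_mat \<alpha> v)"
    and "rep_char n (map_mat \<alpha> v) = \<alpha> (rep_char n v)"
proof -
  have inj: "inj \<alpha>" and hom: "star_hom \<alpha>" using \<alpha> by (simp_all add: Aut_def bij_is_inj)
  obtain F where F: "star_hom F" "\<And>a b. F (t a b) = t (\<alpha> a) (\<alpha> b)" "F \<circ> \<Phi> = \<Phi> \<circ> \<alpha>"
    using \<alpha> unfolding Aut_def is_tensor_hom_def mem_Collect_eq by blast
  have fd: "fd_rep t \<Phi> n v" and vc: "v \<in> carrier_mat n n"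
    using v by (simp_all add: irreducible_rep_def fd_rep_def)
  have \<alpha>_mult: "map_mat \<alpha> (A * B) = map_mat \<alpha> A * map_mat \<alpha> B"
    if "A \<in> carrier_mat n n" "B \<in> carrier_mat n n" for A B
    using that by (intro eq_matI) (simp_all add: scalar_prod_def star_homD[OF hom])
  have \<alpha>_star: "mat_star (map_mat \<alpha> A) = map_mat \<alpha> (mat_star A)" for A
    by (intro eq_matI) (simp_all add: mat_star_def star_homD[OF hom])
  have \<alpha>_one: "map_mat \<alpha> (1\<^sub>m n) = 1\<^sub>m n"
    by (intro eq_matI) (simp_all add: star_homD[OF hom])
  have \<alpha>_scalar: "map_mat \<alpha> (scalar_mat e) = scalar_mat e" for e
    by (intro eq_matI) (simp_all add: scalar_mat_def star_homD[OF hom])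
  have \<alpha>_inj: "A = B" if "map_mat \<alpha> A = map_mat \<alpha> B" "A \<in> carrier_mat n n" "B \<in> carrier_mat n n" for A B
  proof (rule eq_matI)
    fix i j assume "i < dim_row B" "j < dim_col B"
    then have "\<alpha> (A $$ (i, j)) = \<alpha> (B $$ (i, j))"
      using arg_cong[OF that(1), of "\<lambda>M. M $$ (i, j)"] that(2,3) by simp
    then show "A $$ (i, j) = B $$ (i, j)" using inj by (simp add: inj_eq)
  qed (use that in auto)
  have vs: "mat_star v \<in> carrier_mat n n" using vc by (simp add: mat_star_def)
  show "rep_char n (map_mat \<alpha> v) = \<alpha> (rep_char n v)"
    using vc by (simp add: rep_char_def star_homD[OF hom])
  show "irreducible_rep t \<Phi> n (map_mat \<alpha> v)"
    unfolding irreducible_rep_def fd_rep_def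
  proof (intro conjI allI impI ballI)
    show "map_mat \<alpha> v \<in> carrier_mat n n" using vc by simp
    show "mat_star (map_mat \<alpha> v) * map_mat \<alpha> v = 1\<^sub>m n"
      unfolding \<alpha>_star \<alpha>_mult[OF vs vc, symmetric] using fd by (simp add: fd_rep_def \<alpha>_one)
    show "map_mat \<alpha> v * mat_star (map_mat \<alpha> v) = 1\<^sub>m n"
      unfolding \<alpha>_star \<alpha>_mult[OF vc vs, symmetric] using fd by (simp add: fd_rep_def \<alpha>_one)
    show "n > 0" using v by (simp add: irreducible_rep_def)
    fix i j assume ij: "i < n" "j < n"
    have "\<Phi> (\<alpha> (v $$ (i, j))) = F (\<Phi> (v $$ (i, j)))" using fun_cong[OF F(3)] by simp
    then show "\<Phi> (map_mat \<alpha> v $$ (i, j)) = (\<Sum>k<n. t (map_mat \<alpha> v $$ (i, k)) (map_mat \<alpha> v $$ (k, j)))"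
      using ij vc by (simp add: fd_rep_comult[OF fd] star_homD(10)[OF F(1)] F(2))
  next
    fix e :: "complex mat" assume ec: "e \<in> carrier_mat n n"
      and e: "e * e = e \<and> mat_star e = e \<and> scalar_mat e * map_mat \<alpha> v * scalar_mat e = map_mat \<alpha> v * scalar_mat e"
    have s: "(scalar_mat e :: 'a mat) \<in> carrier_mat n n" using ec by (simp add: scalar_mat_def)
    have "map_mat \<alpha> (scalar_mat e * v * scalar_mat e) = map_mat \<alpha> (v * scalar_mat e)"
      using e by (simp add: \<alpha>_mult[OF s vc] \<alpha>_mult[OF vc s] \<alpha>_mult[OF mult_carrier_mat[OF s vc] s] \<alpha>_scalar)
    then have "scalar_mat e * v * scalar_mat e = v * scalar_mat e"
      by (rule \<alpha>_inj) (use s vc in auto)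
    then show "e = 0\<^sub>m n n \<or> e = 1\<^sub>m n"
      using v e ec unfolding irreducible_rep_def by blast
  qed
qed

section \<open>Cosets and the quotient topology\<close>

lemma Aut_chi_coset: "Aut_chi t \<Phi> #>\<^bsub>Aut_group t \<Phi>\<^esub> \<alpha> = {\<eta> \<circ> \<alpha> | \<eta>. \<eta> \<in> Aut_chi t \<Phi>}"
  by (auto simp: r_coset_def Aut_group_def)

lemma id_in_Aut_chi: "id \<in> Aut_chi t \<Phi>"
  by (auto simp: Aut_chi_def Aut_def is_tensor_hom_def star_hom_def intro!: exI[of _ id])

text \<open>Here \<alpha> = \<eta> \<circ> \<beta>, and \<beta> maps the character of v to an
  irreducible character, which \<eta> fixes.\<close>

lemma Aut_chi_coset_eqD:
  assumes "\<alpha> \<in> Aut t \<Phi>" "\<beta> \<in> Aut t \<Phi>"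
    and "Aut_chi t \<Phi> #>\<^bsub>Aut_group t \<Phi>\<^esub> \<alpha> = Aut_chi t \<Phi> #>\<^bsub>Aut_group t \<Phi>\<^esub> \<beta>"
    and v: "irreducible_rep t \<Phi> n v"
  shows "\<alpha> (rep_char n v) = \<beta> (rep_char n v)"
proof -
  have "id \<circ> \<alpha> \<in> {\<eta> \<circ> \<beta> | \<eta>. \<eta> \<in> Aut_chi t \<Phi>}"
    using assms(3) id_in_Aut_chi unfolding Aut_chi_coset by blast
  then obtain \<eta> where \<eta>: "\<eta> \<in> Aut_chi t \<Phi>" "\<alpha> = \<eta> \<circ> \<beta>" by auto
  have "\<eta> (rep_char n (map_mat \<beta> v)) = rep_char n (map_mat \<beta> v)"
    using \<eta>(1) Aut_irreducible(1)[OF assms(2) v] by (simp add: Aut_chi_def)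
  then show ?thesis by (simp add: \<eta>(2) Aut_irreducible(2)[OF assms(2) v])
qed

text \<open>\<alpha> composed with the inverse of \<beta> fixes every character: apply the
  hypothesis to the image of v under that inverse, which is again irreducible.\<close>

lemma Aut_chi_coset_eqI:
  assumes \<alpha>: "\<alpha> \<in> Aut t \<Phi>" and \<beta>: "\<beta> \<in> Aut t \<Phi>"
    and eq: "\<And>n v. irreducible_rep t \<Phi> n v \<Longrightarrow> \<alpha> (rep_char n v) = \<beta> (rep_char n v)"
  shows "Aut_chi t \<Phi> #>\<^bsub>Aut_group t \<Phi>\<^esub> \<alpha> = Aut_chi t \<Phi> #>\<^bsub>Aut_group t \<Phi>\<^esub> \<beta>"
proof -
  have sub: "Aut_chi t \<Phi> #>\<^bsub>Aut_group t \<Phi>\<^esub> \<alpha> \<subseteq> Aut_chi t \<Phi> #>\<^bsub>Aut_group t \<Phi>\<^esub> \<beta>"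
    if \<alpha>: "\<alpha> \<in> Aut t \<Phi>" and \<beta>: "\<beta> \<in> Aut t \<Phi>"
      and eq: "\<And>n v. irreducible_rep t \<Phi> n v \<Longrightarrow> \<alpha> (rep_char n v) = \<beta> (rep_char n v)" for \<alpha> \<beta>
    unfolding Aut_chi_coset
  proof clarify
    fix \<eta> assume \<eta>: "\<eta> \<in> Aut_chi t \<Phi>"
    have \<beta>_bij: "bij \<beta>" using \<beta> by (simp add: Aut_def)
    have \<beta>_inv: "inv_into UNIV \<beta> \<in> Aut t \<Phi>" by (rule Aut_inv[OF \<beta>])
    have "\<eta> \<circ> (\<alpha> \<circ> inv_into UNIV \<beta>) \<in> Aut_chi t \<Phi>"
      unfolding Aut_chi_def mem_Collect_eq
    proof (intro conjI allI impI)
      show "\<eta> \<circ> (\<alpha> \<circ> inv_into UNIV \<beta>) \<in> Aut t \<Phi>"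
        using \<eta> by (intro Aut_comp \<alpha> \<beta>_inv) (simp add: Aut_chi_def)
      fix n v assume v: "irreducible_rep t \<Phi> n v"
      have "\<alpha> (inv_into UNIV \<beta> (rep_char n v)) = \<beta> (inv_into UNIV \<beta> (rep_char n v))"
        using eq[OF Aut_irreducible(1)[OF \<beta>_inv v]] by (simp add: Aut_irreducible(2)[OF \<beta>_inv v])
      also have "\<dots> = rep_char n v" using \<beta>_bij by (simp add: bij_is_surj surj_f_inv_f)
      finally show "(\<eta> \<circ> (\<alpha> \<circ> inv_into UNIV \<beta>)) (rep_char n v) = rep_char n v"
        using \<eta> v by (simp add: Aut_chi_def)
    qed
    moreover have "\<eta> \<circ> \<alpha> = \<eta> \<circ> (\<alpha> \<circ> inv_into UNIV \<beta>) \<circ> \<beta>"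
      using \<beta>_bij by (simp add: fun_eq_iff bij_is_inj)
    ultimately show "\<exists>\<eta>'. \<eta> \<circ> \<alpha> = \<eta>' \<circ> \<beta> \<and> \<eta>' \<in> Aut_chi t \<Phi>" by blast
  qed
  show ?thesis using sub[OF \<alpha> \<beta> eq] sub[OF \<beta> \<alpha> eq[symmetric]] by (intro equalityI)
qed

text \<open>The map \<gamma> \<mapsto> \<gamma>(\<chi>) is locally constant: an \<alpha> near the
  identity fixes \<chi>, so \<beta> \<circ> \<alpha> and \<beta> agree there. Allowing any predicate
  P treats a set and its complement at once.\<close>

lemma openin_Aut_by_char:
  assumes v: "irreducible_rep t \<Phi> n v"
  shows "openin (Aut_topology t \<Phi>) {\<gamma> \<in> Aut t \<Phi>. P (\<gamma> (rep_char n v))}"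
  unfolding openin_Aut_topology
proof (intro conjI ballI)
  fix \<beta> assume \<beta>: "\<beta> \<in> {\<gamma> \<in> Aut t \<Phi>. P (\<gamma> (rep_char n v))}"
  let ?x = "rep_char n v"
  \<comment> \<open>Chosen so that norm x times this radius stays below 1; the added 1 also keeps
    the denominator positive.\<close>
  let ?\<epsilon> = "1 / (norm ?x + 1)"
  have \<epsilon>: "?\<epsilon> > 0" by (simp add: add_nonneg_pos)
  have "(\<lambda>\<alpha>. \<beta> \<circ> \<alpha>) ` Aut_nbhd_id t \<Phi> {?x} ?\<epsilon> \<subseteq> {\<gamma> \<in> Aut t \<Phi>. P (\<gamma> ?x)}"
  proof clarify
    fix \<alpha> assume "\<alpha> \<in> Aut_nbhd_id t \<Phi> {?x} ?\<epsilon>"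
    then have \<alpha>: "\<alpha> \<in> Aut t \<Phi>" and close: "norm (?x - \<alpha> ?x) < ?\<epsilon>" by (auto simp: Aut_nbhd_id_def)
    have "norm ?x * norm (?x - \<alpha> ?x) \<le> norm ?x * ?\<epsilon>"
      using close by (intro mult_left_mono) auto
    also have "\<dots> < 1" by (simp add: add_nonneg_pos)
    finally have "?x = \<alpha> ?x"
      using irreducible_chars_separated[OF v Aut_irreducible(1)[OF \<alpha> v]] Aut_irreducible(2)[OF \<alpha> v] by simp
    then show "\<beta> \<circ> \<alpha> \<in> Aut t \<Phi> \<and> P ((\<beta> \<circ> \<alpha>) ?x)"
      using \<beta> Aut_comp[OF \<alpha>] by auto
  qed
  with \<epsilon> show "\<exists>S \<epsilon>. finite S \<and> \<epsilon> > 0 \<and> (\<lambda>\<alpha>. \<beta> \<circ> \<alpha>) ` Aut_nbhd_id t \<Phi> S \<epsilon> \<subseteq> {\<gamma> \<in> Aut t \<Phi>. P (\<gamma> ?x)}"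
    by (intro exI[of _ "{?x}"] exI[of _ ?\<epsilon>]) auto
qed auto

lemma totally_disconnected_Out_chi: "totally_disconnected_space (Out_chi_topology t \<Phi>)"
  unfolding totally_disconnected_space_def
proof
  let ?X = "Out_chi_topology t \<Phi>"
  define q where "q \<alpha> = Aut_chi t \<Phi> #>\<^bsub>Aut_group t \<Phi>\<^esub> \<alpha>" for \<alpha>
  have X: "topspace ?X = q ` Aut t \<Phi>"
    by (auto simp: Out_chi_topology_def topspace_quotient_topology topspace_Aut_topology q_def)
  have X_open: "openin ?X V \<longleftrightarrow> V \<subseteq> q ` Aut t \<Phi> \<and> openin (Aut_topology t \<Phi>) {\<alpha> \<in> Aut t \<Phi>. q \<alpha> \<in> V}" for V
    by (simp add: Out_chi_topology_def openin_quotient_topology topspace_Aut_topology q_def[abs_def])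
  fix x assume x: "x \<in> topspace ?X"
  then obtain \<alpha> where \<alpha>: "\<alpha> \<in> Aut t \<Phi>" "x = q \<alpha>" using X by blast
  have "y = x" if y: "connected_component_of ?X x y" for y
  proof (rule ccontr)
    assume ne: "y \<noteq> x"
    have "y \<in> topspace ?X" using connected_component_in_topspace[of ?X x y] y by blast
    then obtain \<beta> where \<beta>: "\<beta> \<in> Aut t \<Phi>" "y = q \<beta>" using X by blast
    obtain n v where v: "irreducible_rep t \<Phi> n v" and neq: "\<alpha> (rep_char n v) \<noteq> \<beta> (rep_char n v)"
      using ne Aut_chi_coset_eqI[OF \<alpha>(1) \<beta>(1)] \<alpha>(2) \<beta>(2) unfolding q_def by blast
    define U where "U P = q ` {\<gamma> \<in> Aut t \<Phi>. P (\<gamma> (rep_char n v))}" for P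
    \<comment> \<open>The value at the character is constant on cosets, so these sets are saturated:
      they have open images, and P and its negation have disjoint ones.\<close>
    have pre: "{\<gamma> \<in> Aut t \<Phi>. q \<gamma> \<in> U P} = {\<gamma> \<in> Aut t \<Phi>. P (\<gamma> (rep_char n v))}" for P
    proof -
      have "P (\<gamma> (rep_char n v))" if \<gamma>: "\<gamma> \<in> Aut t \<Phi>" "q \<gamma> \<in> U P" for \<gamma>
      proof -
        obtain \<delta> where \<delta>: "\<delta> \<in> Aut t \<Phi>" "P (\<delta> (rep_char n v))" "q \<gamma> = q \<delta>"
          using \<gamma>(2) unfolding U_def by blast
        have "\<gamma> (rep_char n v) = \<delta> (rep_char n v)"
          using Aut_chi_coset_eqD[OF \<gamma>(1) \<delta>(1) \<delta>(3)[unfolded q_def] v] .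
        then show ?thesis using \<delta>(2) by simp
      qed
      then show ?thesis unfolding U_def by blast
    qed
    have U_open: "openin ?X (U P)" for P
      unfolding X_open pre using openin_Aut_by_char[OF v] by (auto simp: U_def)
    define P where "P z \<longleftrightarrow> z = \<alpha> (rep_char n v)" for z
    obtain C where C: "connectedin ?X C" "x \<in> C" "y \<in> C"
      using y unfolding connected_component_of_def by blast
    have "C \<subseteq> U P \<union> U (\<lambda>z. \<not> P z)"
      using connectedin_subset_topspace[OF C(1)] unfolding X U_def by blast
    moreover have "U P \<inter> U (\<lambda>z. \<not> P z) \<inter> C = {}"
      using pre[of P] pre[of "\<lambda>z. \<not> P z"] unfolding U_def by blast
    moreover have "x \<in> U P"
      unfolding U_def \<alpha>(2) by (rule imageI) (use \<alpha>(1) in \<open>simp add: P_def\<close>)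
    then have "U P \<inter> C \<noteq> {}" using C(2) by blast
    moreover have "y \<in> U (\<lambda>z. \<not> P z)"
      unfolding U_def \<beta>(2) by (rule imageI) (use \<beta>(1) neq in \<open>simp add: P_def\<close>)
    then have "U (\<lambda>z. \<not> P z) \<inter> C \<noteq> {}" using C(3) by blast
    ultimately show False
      using conjunct2[OF C(1)[unfolded connectedin]] U_open by metis
  qed
  moreover have "connected_component_of ?X x x" using x by (simp add: connected_component_of_refl)
  ultimately show "connected_component_of_set ?X x = {x}" by blast
qed

end

theorem theorem3p7:
  fixes t :: "'a::cstar_algebra \<Rightarrow> 'a \<Rightarrow> 'b::cstar_algebra"
    and tl :: "'b \<Rightarrow> 'a \<Rightarrow> 'c::cstar_algebra"
    and tr :: "'a \<Rightarrow> 'b \<Rightarrow> 'c"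
    and \<Phi> :: "'a \<Rightarrow> 'b"
  assumes "compact_quantum_group t tl tr \<Phi>"
  shows "totally_disconnected_space (Out_chi_topology t \<Phi>)"
  using assms by (rule compact_quantum_group.totally_disconnected_Out_chi)

end
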